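(* Let $N\in\mathbb{N}$, let $\Omega\subseteq\mathbb{R}^N$ be a bounded open set with Lipschitz boundary, let $u_0\in W^{1,1}(\mathbb{R}^N)$, let $\varphi$ be an admissible integrand, and let $\mu_+,\mu_-$ be admissible measures on $\Omega$. If the functional $$\widehat\Phi[w]=|\mathrm{D}w|_\varphi(\Omega)+\int_{\partial\Omega}\varphi(\,\cdot\,,(w-u_0)\nu_\Omega)\,\mathrm{d}\mathcal{H}^{N-1}+\int_\Omega w^-\,\mathrm{d}\mu_+-\int_\Omega w^+\,\mathrm{d}\mu_-\,,\qquad w\in BV(\Omega)\,,$$ is bounded from below on $BV(\Omega)$, then $(\mu_-,\mu_+)$ satisfies the $\varphi$-IC in $\Omega$ with constant $1$, and $(\mu_+,\mu_-)$ satisfies the $\widetilde\varphi$-IC in $\Omega$ with constant $1$.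
   Context: Admissible integrand: a Borel function $\varphi\colon\mathbb{R}^N\times\mathbb{R}^N\to[0,\infty)$ with $\varphi(x,t\xi)=t\varphi(x,\xi)$ for all $t\ge0$, $x,\xi\in\mathbb{R}^N$, and $\alpha|\xi|\le\varphi(x,\xi)\le\beta|\xi|$ for all $x,\xi$ with constants $0<\alpha\le\beta<\infty$. Mirrored integrand: $\widetilde\varphi(x,\xi)=\varphi(x,-\xi)$. Anisotropic variation: for $w\in BV_{\mathrm{loc}}(U)$, $U$ open, and Borel $B\subseteq U$, $|\mathrm{D}w|_\varphi(B)=\int_B\varphi(\,\cdot\,,\nu_w)\,\mathrm{d}|\mathrm{D}w|$ with $\nu_w=\frac{\mathrm{d}\mathrm{D}w}{\mathrm{d}|\mathrm{D}w|}$. For (Lebesgue) measurable $A\subseteq\mathbb{R}^N$, $\mathrm{P}_\varphi(A)=|\mathrm{D}\mathbf{1}_A|_\varphi(\mathbb{R}^N)$ if $A$ has finite perimeter in $\mathbb{R}^N$, and $\mathrm{P}_\varphi(A)=\infty$ otherwise. Densities and representatives: for measurable $A\subseteq\mathbb{R}^N$, $A^1$ is the set of points of density $1$ of $A$, and $A^+=\{x:\limsup_{r\to0}|B_r(x)\cap A|/|B_r|>0\}$. For measurable $w\colon\Omega\to\mathbb{R}$ and $x\in\Omega$, $w^+(x)=\sup\{t:x\in\{w>t\}^+\}$, $w^-(x)=\sup\{t:x\in\{w>t\}^1\}$. $\varphi$-IC: a pair $(\mu,\nu)$ of finite non-negative Radon measures on open $U\subseteq\mathbb{R}^N$ satisfies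 the $\varphi$-IC in $U$ with constant $C\in[0,\infty)$ if $\mu(A^+)-\nu(A^1)\le C\,\mathrm{P}_\varphi(A)$ for all measurable $A\Subset U$ ($\Subset$: compactly contained). Admissible measures on $\Omega$: non-negative Radon measures $\mu_+,\mu_-$ on $\Omega$ such that $\mu_\pm(Z)=0$ for every $\mathcal{H}^{N-1}$-negligible Borel set $Z\subseteq\Omega$ and $\int_\Omega v^+\,\mathrm{d}\mu_\pm<\infty$ for every non-negative $v\in BV(\Omega)$. (They need not be mutually singular.) In the boundary integral $w$ and $u_0$ are evaluated in the sense of traces, and $\nu_\Omega$ is the inward unit normal on $\partial\Omega$. *)

theory Defs
  imports "HOL-Analysis.Analysis"
begin

text \<open>
  The space \<open>\<real>\<^sup>N\<close> is a type \<^typ>\<open>'a::euclidean_space\<close> with \<open>N = DIM('a)\<close>. Functions on an open set \<open>U\<close>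
  are total functions on \<open>'a\<close> whose values outside \<open>U\<close> are never used; measures on \<open>U\<close> are
  measures whose measurable sets are the Borel subsets of \<open>U\<close>.
\<close>


section \<open>Integrands\<close>

definition admissible_integrand :: "('a::euclidean_space \<Rightarrow> 'a \<Rightarrow> real) \<Rightarrow> bool" where
  "admissible_integrand \<phi> \<longleftrightarrow>
     (\<lambda>(x, \<xi>). \<phi> x \<xi>) \<in> borel_measurable borel \<and>
     (\<forall>x \<xi>. 0 \<le> \<phi> x \<xi>) \<and>
     (\<forall>t x \<xi>. 0 \<le> t \<longrightarrow> \<phi> x (t *\<^sub>R \<xi>) = t * \<phi> x \<xi>) \<and>
     (\<exists>\<alpha> \<beta>. 0 < \<alpha> \<and> \<alpha> \<le> \<beta> \<and> (\<forall>x \<xi>. \<alpha> * norm \<xi> \<le> \<phi> x \<xi> \<and> \<phi> x \<xi> \<le> \<beta> * norm \<xi>))"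

definition mirrored :: "('a::euclidean_space \<Rightarrow> 'a \<Rightarrow> real) \<Rightarrow> 'a \<Rightarrow> 'a \<Rightarrow> real" where
  "mirrored \<phi> x \<xi> = \<phi> x (- \<xi>)"


section \<open>Radon measures\<close>

definition compactly_contained :: "'a::topological_space set \<Rightarrow> 'a set \<Rightarrow> bool" where
  "compactly_contained A U \<longleftrightarrow> compact (closure A) \<and> closure A \<subseteq> U"

definition radon_measure_on :: "'a::euclidean_space set \<Rightarrow> 'a measure \<Rightarrow> bool" where
  "radon_measure_on U \<mu> \<longleftrightarrow>
     sets \<mu> = sets (restrict_space borel U) \<and> (\<forall>K. compact K \<and> K \<subseteq> U \<longrightarrow> emeasure \<mu> K < \<infinity>)"

definition cc_borel :: "'a::euclidean_space set \<Rightarrow> 'a set set" where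
  "cc_borel U = {B \<in> sets borel. compactly_contained B U}"

text \<open>
  An \<open>\<real>\<^sup>N\<close>-valued Radon measure need not be finite, so it is a set function on the Borel sets
  compactly contained in \<open>U\<close>; its values on other sets are irrelevant. Taking all \<open>B i\<close> empty
  gives \<open>D {} = 0\<close>.
\<close>

definition vector_radon_measure :: "'a::euclidean_space set \<Rightarrow> ('a set \<Rightarrow> 'a) \<Rightarrow> bool" where
  "vector_radon_measure U D \<longleftrightarrow>
     (\<forall>B :: nat \<Rightarrow> 'a set. disjoint_family B \<longrightarrow> range B \<subseteq> cc_borel U \<longrightarrow> (\<Union>i. B i) \<in> cc_borel U \<longrightarrow>
        (\<lambda>i. D (B i)) sums D (\<Union>i. B i))"

definition total_variation :: "'a::euclidean_space set \<Rightarrow> ('a set \<Rightarrow> 'a) \<Rightarrow> 'a measure" where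
  "total_variation U D = measure_of U (sets (restrict_space borel U))
     (\<lambda>B. SUP F \<in> {F. finite F \<and> disjoint F \<and> F \<subseteq> cc_borel U \<and> \<Union>F \<subseteq> B}. \<Sum>E\<in>F. ennreal (norm (D E)))"

text \<open>The Radon--Nikodym density \<open>dD / d|D|\<close>, unique up to \<open>|D|\<close>-null sets.\<close>

definition is_polar_density :: "'a::euclidean_space set \<Rightarrow> ('a set \<Rightarrow> 'a) \<Rightarrow> ('a \<Rightarrow> 'a) \<Rightarrow> bool" where
  "is_polar_density U D \<nu> \<longleftrightarrow>
     \<nu> \<in> borel_measurable (restrict_space borel U) \<and>
     (\<forall>B\<in>cc_borel U. set_integrable (total_variation U D) B \<nu> \<and>
        D B = set_lebesgue_integral (total_variation U D) B \<nu>)"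


section \<open>Functions of bounded variation and Sobolev functions\<close>

text \<open>\<open>\<psi>\<close> is a \<open>C\<^sup>1\<close> function with compact support in \<open>U\<close>, and \<open>G\<close> is its gradient.\<close>

definition test_function :: "'a::euclidean_space set \<Rightarrow> ('a \<Rightarrow> real) \<Rightarrow> ('a \<Rightarrow> 'a) \<Rightarrow> bool" where
  "test_function U \<psi> G \<longleftrightarrow>
     (\<forall>x. GDERIV \<psi> x :> G x) \<and> continuous_on UNIV G \<and> compactly_contained {x. \<psi> x \<noteq> 0} U"

text \<open>
  \<open>D\<close> is the distributional derivative of \<open>w\<close> on \<open>U\<close>: the integral of \<open>\<psi>\<close> against \<open>D\<close> is the integral
  of \<open>\<psi> dD/d|D|\<close> against \<open>|D|\<close>.
\<close>

definition is_derivative_measure ::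
    "'a::euclidean_space set \<Rightarrow> ('a \<Rightarrow> real) \<Rightarrow> ('a set \<Rightarrow> 'a) \<Rightarrow> bool" where
  "is_derivative_measure U w D \<longleftrightarrow>
     vector_radon_measure U D \<and>
     (\<exists>\<nu>. is_polar_density U D \<nu> \<and>
        (\<forall>\<psi> G. test_function U \<psi> G \<longrightarrow>
           (LINT x:U|lebesgue. w x *\<^sub>R G x) = - (LINT x|total_variation U D. \<psi> x *\<^sub>R \<nu> x)))"

definition BV_loc :: "'a::euclidean_space set \<Rightarrow> ('a \<Rightarrow> real) set" where
  "BV_loc U = {w. (\<forall>K. compact K \<and> K \<subseteq> U \<longrightarrow> set_integrable lebesgue K w) \<and>
                  (\<exists>D. is_derivative_measure U w D)}"

definition deriv_measure :: "'a::euclidean_space set \<Rightarrow> ('a \<Rightarrow> real) \<Rightarrow> 'a set \<Rightarrow> 'a" where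
  "deriv_measure U w = (SOME D. is_derivative_measure U w D)"

definition var_measure :: "'a::euclidean_space set \<Rightarrow> ('a \<Rightarrow> real) \<Rightarrow> 'a measure" where
  "var_measure U w = total_variation U (deriv_measure U w)"

definition var_direction :: "'a::euclidean_space set \<Rightarrow> ('a \<Rightarrow> real) \<Rightarrow> 'a \<Rightarrow> 'a" where
  "var_direction U w = (SOME \<nu>. is_polar_density U (deriv_measure U w) \<nu>)"

definition BV :: "'a::euclidean_space set \<Rightarrow> ('a \<Rightarrow> real) set" where
  "BV U = {w \<in> BV_loc U. set_integrable lebesgue U w \<and> emeasure (var_measure U w) U < \<infinity>}"

definition Sobolev_1_1 :: "'a::euclidean_space set \<Rightarrow> ('a \<Rightarrow> real) set" where
  "Sobolev_1_1 U = {u. set_integrable lebesgue U u \<and>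
     (\<exists>g. set_integrable lebesgue U g \<and>
        (\<forall>\<psi> G. test_function U \<psi> G \<longrightarrow>
           (LINT x:U|lebesgue. u x *\<^sub>R G x) = - (LINT x:U|lebesgue. \<psi> x *\<^sub>R g x)))}"

definition aniso_variation ::
    "('a::euclidean_space \<Rightarrow> 'a \<Rightarrow> real) \<Rightarrow> 'a set \<Rightarrow> ('a \<Rightarrow> real) \<Rightarrow> 'a set \<Rightarrow> ennreal" where
  "aniso_variation \<phi> U w B = (\<integral>\<^sup>+x\<in>B. ennreal (\<phi> x (var_direction U w x)) \<partial>var_measure U w)"

definition finite_perimeter :: "'a::euclidean_space set \<Rightarrow> bool" where
  "finite_perimeter A \<longleftrightarrow>
     indicator A \<in> BV_loc (UNIV :: 'a set) \<and> emeasure (var_measure UNIV (indicator A)) UNIV < \<infinity>"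

definition aniso_perimeter :: "('a::euclidean_space \<Rightarrow> 'a \<Rightarrow> real) \<Rightarrow> 'a set \<Rightarrow> ennreal" where
  "aniso_perimeter \<phi> A =
     (if finite_perimeter A then aniso_variation \<phi> UNIV (indicator A) UNIV else \<infinity>)"


section \<open>Densities and representatives\<close>

definition density_ratio :: "'a::euclidean_space set \<Rightarrow> 'a \<Rightarrow> real \<Rightarrow> ennreal" where
  "density_ratio A x r = emeasure lebesgue (ball x r \<inter> A) / emeasure lebesgue (ball x r)"

definition density_one :: "'a::euclidean_space set \<Rightarrow> 'a set" where
  "density_one A = {x. (density_ratio A x \<longlongrightarrow> 1) (at_right 0)}"

definition density_plus :: "'a::euclidean_space set \<Rightarrow> 'a set" where
  "density_plus A = {x. 0 < Limsup (at_right 0) (density_ratio A x)}"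

definition upper_rep :: "'a::euclidean_space set \<Rightarrow> ('a \<Rightarrow> real) \<Rightarrow> 'a \<Rightarrow> ereal" where
  "upper_rep \<Omega> w x = Sup {ereal t | t. x \<in> density_plus {y \<in> \<Omega>. w y > t}}"

definition lower_rep :: "'a::euclidean_space set \<Rightarrow> ('a \<Rightarrow> real) \<Rightarrow> 'a \<Rightarrow> ereal" where
  "lower_rep \<Omega> w x = Sup {ereal t | t. x \<in> density_one {y \<in> \<Omega>. w y > t}}"


section \<open>Hausdorff measure\<close>

text \<open>
  The dimension is a natural number so that \<open>0 ^ 0 = 1\<close> makes the zero-dimensional measure the
  counting measure. Boundedness of the covering sets is required explicitly because
  \<^const>\<open>diameter\<close> has no meaningful value on unbounded sets.
\<close>

definition hausdorff_premeasure :: "nat \<Rightarrow> real \<Rightarrow> 'a::metric_space set \<Rightarrow> ennreal" where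
  "hausdorff_premeasure m \<delta> E =
     (INF S \<in> {S :: nat \<Rightarrow> 'a set. E \<subseteq> (\<Union>i. S i) \<and> (\<forall>i. bounded (S i) \<and> diameter (S i) \<le> \<delta>)}.
        \<Sum>i. if S i = {} then 0 else ennreal (unit_ball_vol (real m) * (diameter (S i) / 2) ^ m))"

definition hausdorff_outer :: "nat \<Rightarrow> 'a::metric_space set \<Rightarrow> ennreal" where
  "hausdorff_outer m E = (SUP \<delta> \<in> {0<..}. hausdorff_premeasure m \<delta> E)"

definition hausdorff_measure :: "nat \<Rightarrow> 'a::metric_space measure" where
  "hausdorff_measure m = measure_of UNIV (sets borel) (hausdorff_outer m)"


section \<open>Lipschitz boundary, normal and traces\<close>

text \<open>
  In \<open>ball x r\<close>, the set \<open>\<Omega>\<close> is the part above the graph of \<open>\<gamma>\<close> in direction \<open>e\<close>; only the values of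
  \<open>\<gamma>\<close> on the hyperplane orthogonal to \<open>e\<close> matter.
\<close>

definition local_graph ::
    "'a::euclidean_space set \<Rightarrow> 'a \<Rightarrow> 'a \<Rightarrow> ('a \<Rightarrow> real) \<Rightarrow> real \<Rightarrow> bool" where
  "local_graph \<Omega> x e \<gamma> r \<longleftrightarrow>
     norm e = 1 \<and> 0 < r \<and> (\<exists>L. L-lipschitz_on {z. z \<bullet> e = 0} \<gamma>) \<and>
     (\<forall>y\<in>ball x r. y \<in> \<Omega> \<longleftrightarrow> \<gamma> (y - (y \<bullet> e) *\<^sub>R e) < y \<bullet> e)"

definition lipschitz_boundary :: "'a::euclidean_space set \<Rightarrow> bool" where
  "lipschitz_boundary \<Omega> \<longleftrightarrow> (\<forall>x\<in>frontier \<Omega>. \<exists>e \<gamma> r. local_graph \<Omega> x e \<gamma> r)"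

text \<open>\<open>g\<close> is the gradient of \<open>\<gamma>\<close> within the hyperplane orthogonal to \<open>e\<close>.\<close>

definition is_inward_normal :: "'a::euclidean_space set \<Rightarrow> 'a \<Rightarrow> 'a \<Rightarrow> bool" where
  "is_inward_normal \<Omega> x \<nu> \<longleftrightarrow>
     (\<exists>e \<gamma> r g. local_graph \<Omega> x e \<gamma> r \<and> g \<bullet> e = 0 \<and>
        (\<gamma> has_derivative (\<lambda>h. g \<bullet> h)) (at (x - (x \<bullet> e) *\<^sub>R e) within {z. z \<bullet> e = 0}) \<and>
        \<nu> = (e - g) /\<^sub>R norm (e - g))"

text \<open>
  On a Lipschitz boundary the normal and the trace of a \<open>BV\<close> function are defined
  almost everywhere for the \<open>(N-1)\<close>-dimensional Hausdorff measure; on the exceptional null set both are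
  set to \<open>0\<close>.
\<close>

definition inward_normal :: "'a::euclidean_space set \<Rightarrow> 'a \<Rightarrow> 'a" where
  "inward_normal \<Omega> x =
     (if \<exists>\<nu>. is_inward_normal \<Omega> x \<nu> then SOME \<nu>. is_inward_normal \<Omega> x \<nu> else 0)"

definition is_trace_at :: "'a::euclidean_space set \<Rightarrow> ('a \<Rightarrow> real) \<Rightarrow> 'a \<Rightarrow> real \<Rightarrow> bool" where
  "is_trace_at \<Omega> w x t \<longleftrightarrow>
     ((\<lambda>r. (LINT y:(ball x r \<inter> \<Omega>)|lebesgue. \<bar>w y - t\<bar>) / r ^ DIM('a)) \<longlongrightarrow> 0) (at_right 0)"

definition bv_trace :: "'a::euclidean_space set \<Rightarrow> ('a \<Rightarrow> real) \<Rightarrow> 'a \<Rightarrow> real" where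
  "bv_trace \<Omega> w x = (if \<exists>t. is_trace_at \<Omega> w x t then SOME t. is_trace_at \<Omega> w x t else 0)"


section \<open>Isoperimetric conditions, admissible measures and the functional\<close>

definition IC ::
    "('a::euclidean_space \<Rightarrow> 'a \<Rightarrow> real) \<Rightarrow> 'a set \<Rightarrow> real \<Rightarrow> 'a measure \<Rightarrow> 'a measure \<Rightarrow> bool" where
  "IC \<phi> U C \<mu> \<nu> \<longleftrightarrow>
     0 \<le> C \<and>
     radon_measure_on U \<mu> \<and> finite_measure \<mu> \<and> radon_measure_on U \<nu> \<and> finite_measure \<nu> \<and>
     (\<forall>A\<in>sets lebesgue. compactly_contained A U \<longrightarrow>
        ereal (measure \<mu> (density_plus A) - measure \<nu> (density_one A))
          \<le> ereal C * enn2ereal (aniso_perimeter \<phi> A))"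

definition admissible_measure :: "'a::euclidean_space set \<Rightarrow> 'a measure \<Rightarrow> bool" where
  "admissible_measure \<Omega> \<mu> \<longleftrightarrow>
     radon_measure_on \<Omega> \<mu> \<and>
     (\<forall>Z\<in>sets borel. Z \<subseteq> \<Omega> \<longrightarrow> hausdorff_outer (DIM('a) - 1) Z = 0 \<longrightarrow> emeasure \<mu> Z = 0) \<and>
     (\<forall>v\<in>BV \<Omega>. (\<forall>x\<in>\<Omega>. 0 \<le> v x) \<longrightarrow> (\<integral>\<^sup>+x. e2ennreal (upper_rep \<Omega> v x) \<partial>\<mu>) < \<infinity>)"

text \<open>
  For \<open>w\<close> in \<open>BV \<Omega>\<close> the representatives of \<open>w\<close> are finite outside an \<open>(N-1)\<close>-dimensionally negligible set
  and bounded in modulus by the upper representative of \<open>|w|\<close>, hence real-valued almost everywhere and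
  integrable for admissible measures.
\<close>

definition Phi_hat ::
    "('a::euclidean_space \<Rightarrow> 'a \<Rightarrow> real) \<Rightarrow> 'a set \<Rightarrow> ('a \<Rightarrow> real) \<Rightarrow> 'a measure \<Rightarrow> 'a measure \<Rightarrow>
      ('a \<Rightarrow> real) \<Rightarrow> ereal" where
  "Phi_hat \<phi> \<Omega> u\<^sub>0 \<mu>\<^sub>p \<mu>\<^sub>m w =
     enn2ereal (aniso_variation \<phi> \<Omega> w \<Omega>) +
     enn2ereal (\<integral>\<^sup>+x\<in>frontier \<Omega>.
        ennreal (\<phi> x ((bv_trace \<Omega> w x - bv_trace \<Omega> u\<^sub>0 x) *\<^sub>R inward_normal \<Omega> x))
        \<partial>hausdorff_measure (DIM('a) - 1)) +
     ereal (\<integral>x. real_of_ereal (lower_rep \<Omega> w x) \<partial>\<mu>\<^sub>p) -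
     ereal (\<integral>x. real_of_ereal (upper_rep \<Omega> w x) \<partial>\<mu>\<^sub>m)"

end

theory Submission
  imports Defs
begin

text \<open>
  Let \<open>A\<close> have compact closure in \<open>\<Omega>\<close> and finite perimeter; otherwise its \<open>\<phi>\<close>-perimeter is infinite
  and nothing has to be shown. The functional is tested with
  \<open>w\<^sub>s = s 1\<^sub>A + (1 - \<eta>) u\<^sub>0\<close>, where \<open>\<eta>\<close> is a smooth cutoff function that is \<open>1\<close> near the closure
  of \<open>A\<close> and has compact support in \<open>\<Omega>\<close>. Near the boundary \<open>w\<^sub>s\<close> is \<open>u\<^sub>0\<close>, so the boundary integral
  vanishes; near the closure of \<open>A\<close> it is \<open>s 1\<^sub>A\<close>. The two parts live in disjoint regions, so
  they do not interact: the variation of \<open>w\<^sub>s\<close> is at most \<open>\<bar>s\<bar> P + C\<close>, where \<open>P\<close> is the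
  \<open>\<phi>\<close>-perimeter of \<open>A\<close> if \<open>s > 0\<close> and its mirrored version if \<open>s < 0\<close>, and the representatives of
  \<open>w\<^sub>s\<close> are those of \<open>s 1\<^sub>A\<close> plus those of \<open>(1 - \<eta>) u\<^sub>0\<close>. Since \<open>(1\<^sub>A)\<^sup>+\<close> and \<open>(1\<^sub>A)\<^sup>-\<close> are the
  indicators of \<open>A\<^sup>+\<close> and \<open>A\<^sup>1\<close>, the functional at \<open>w\<^sub>s\<close> is, for \<open>s > 0\<close>, at most
  \<open>s (P + \<mu>\<^sub>p(A\<^sup>1) - \<mu>\<^sub>m(A\<^sup>+))\<close> plus a constant. Boundedness from below forces the slope to be
  nonnegative, which is the first isoperimetric condition; \<open>s < 0\<close> exchanges the roles of \<open>A\<^sup>+\<close> and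
  \<open>A\<^sup>1\<close> and gives the second.

  The summand \<open>(1 - \<eta>) u\<^sub>0\<close> avoids any trace estimate: with \<open>s 1\<^sub>A\<close> alone the boundary integral
  would involve the trace of \<open>u\<^sub>0\<close>. Its price is that the representatives of \<open>(1 - \<eta>) u\<^sub>0\<close> have to be
  integrable for \<open>\<mu>\<^sub>p\<close> and \<open>\<mu>\<^sub>m\<close>. An admissible measure integrates the upper representative of
  nonnegative functions of bounded variation, so a nonnegative majorant is needed, and
  \<open>sqrt (1 + u\<^sub>0\<^sup>2)\<close> is one (\<open>sqrt_majorant_BV\<close>). As it is at least \<open>1\<close>, it also shows that the measures are
  finite. The chain rule behind it is obtained from difference quotients, which converge in mean
  for a Sobolev function (\<open>difference_quotient_L1\<close>).

  The derivative of a function is only given as some vector measure, and its direction as some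
  polar density. These choices are harmless: whenever the distributional derivative can be written as
  \<open>\<nu> M\<close> with a positive measure \<open>M\<close>, the total variation is \<open>\<bar>\<nu>\<bar> M\<close> (\<open>total_variation_density\<close>), the
  vector measure is determined by test functions (\<open>vector_density_unique\<close>), and homogeneity of \<open>\<phi>\<close> turns
  the anisotropic variation into the integral of \<open>\<phi>(\<cdot>, \<nu>)\<close> against \<open>M\<close> (\<open>BV_density\<close>). For \<open>w\<^sub>s\<close> the
  measure \<open>M\<close> is glued from the perimeter measure of \<open>A\<close> and Lebesgue measure (\<open>competitor_BV\<close>).
\<close>

section \<open>Smooth cutoff functions\<close>

text \<open>
  The support condition of a test function is left out, so that sums, products and
  compositions can be formed freely; it is added at the end.
\<close>

definition has_continuous_gradient :: "('a::euclidean_space \<Rightarrow> real) \<Rightarrow> ('a \<Rightarrow> 'a) \<Rightarrow> bool" where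
  "has_continuous_gradient f G \<longleftrightarrow> (\<forall>x. GDERIV f x :> G x) \<and> continuous_on UNIV G"

lemma has_continuous_gradient_continuous:
  assumes "has_continuous_gradient f G"
  shows "continuous_on UNIV f"
  using assms unfolding has_continuous_gradient_def gderiv_def
  by (meson continuous_at_imp_continuous_on has_derivative_continuous)

lemma has_continuous_gradient_const: "has_continuous_gradient (\<lambda>x. c) (\<lambda>x. 0)"
  unfolding has_continuous_gradient_def by (auto intro: GDERIV_const)

lemma has_continuous_gradient_inner: "has_continuous_gradient (\<lambda>x. x \<bullet> e) (\<lambda>x. e)"
proof -
  have "((\<lambda>x. x \<bullet> e) has_derivative (\<lambda>h. h \<bullet> e)) (at x)" for x :: 'a
    by (auto intro!: derivative_eq_intros)
  then show ?thesis
    unfolding has_continuous_gradient_def gderiv_def by (auto simp: inner_commute)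
qed

lemma has_continuous_gradient_add:
  assumes "has_continuous_gradient f F" "has_continuous_gradient g G"
  shows "has_continuous_gradient (\<lambda>x. f x + g x) (\<lambda>x. F x + G x)"
  using assms unfolding has_continuous_gradient_def
  by (auto intro!: GDERIV_add continuous_on_add)

lemma has_continuous_gradient_diff:
  assumes "has_continuous_gradient f F" "has_continuous_gradient g G"
  shows "has_continuous_gradient (\<lambda>x. f x - g x) (\<lambda>x. F x - G x)"
  using assms unfolding has_continuous_gradient_def
  by (auto intro!: GDERIV_diff continuous_on_diff)

lemma has_continuous_gradient_mult:
  assumes "has_continuous_gradient f F" "has_continuous_gradient g G"
  shows "has_continuous_gradient (\<lambda>x. f x * g x) (\<lambda>x. f x *\<^sub>R G x + g x *\<^sub>R F x)"
  using assms has_continuous_gradient_continuous[OF assms(1)] has_continuous_gradient_continuous[OF assms(2)]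
  unfolding has_continuous_gradient_def
  by (auto intro!: GDERIV_mult continuous_intros)

lemma has_continuous_gradient_compose:
  assumes "has_continuous_gradient f F" "\<And>s. (h has_real_derivative h' s) (at s)" "continuous_on UNIV h'"
  shows "has_continuous_gradient (\<lambda>x. h (f x)) (\<lambda>x. h' (f x) *\<^sub>R F x)"
proof -
  have "continuous_on UNIV (\<lambda>x. h' (f x))"
    using continuous_on_compose2[OF assms(3) has_continuous_gradient_continuous[OF assms(1)]] by auto
  then show ?thesis
    using assms(1) GDERIV_DERIV_compose[OF _ assms(2)] unfolding has_continuous_gradient_def
    by (auto intro!: continuous_on_scaleR)
qed

lemma has_continuous_gradient_sum:
  assumes "finite I" "\<And>i. i \<in> I \<Longrightarrow> \<exists>G. has_continuous_gradient (f i) G"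
  shows "\<exists>G. has_continuous_gradient (\<lambda>x. \<Sum>i\<in>I. f i x) G"
  using assms
proof (induction I)
  case empty
  then show ?case by (auto intro: has_continuous_gradient_const)
next
  case (insert i I)
  then obtain G H where "has_continuous_gradient (\<lambda>x. \<Sum>i\<in>I. f i x) G" "has_continuous_gradient (f i) H"
    by (meson insertI1 insertI2)
  from has_continuous_gradient_add[OF this(2,1)] insert show ?case by auto
qed

lemma has_continuous_gradient_prod:
  assumes "finite I" "\<And>i. i \<in> I \<Longrightarrow> \<exists>G. has_continuous_gradient (f i) G"
  shows "\<exists>G. has_continuous_gradient (\<lambda>x. \<Prod>i\<in>I. f i x) G"
  using assms
proof (induction I)
  case empty
  then show ?case by (auto intro: has_continuous_gradient_const)
next
  case (insert i I)
  then obtain G H where "has_continuous_gradient (\<lambda>x. \<Prod>i\<in>I. f i x) G" "has_continuous_gradient (f i) H"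
    by (meson insertI1 insertI2)
  from has_continuous_gradient_mult[OF this(2,1)] insert show ?case by auto
qed

text \<open>
  Squaring removes the kink of the positive part, which makes it a building block for
  continuously differentiable bumps and profiles.
\<close>

lemma DERIV_positive_part_squared:
  "((\<lambda>s::real. (max 0 s)\<^sup>2) has_real_derivative 2 * max 0 s) (at s)"
proof -
  consider "s > 0" | "s < 0" | "s = 0" by linarith
  then show ?thesis
  proof cases
    case 1
    have "((\<lambda>s::real. s\<^sup>2) has_real_derivative 2 * max 0 s) (at s)"
      using 1 by (auto intro!: derivative_eq_intros)
    then show ?thesis
      by (rule has_field_derivative_transform_within_open[where S = "{0<..}"]) (use 1 in auto)
  next
    case 2
    have "((\<lambda>s::real. 0) has_real_derivative 2 * max 0 s) (at s)"
      using 2 by auto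
    then show ?thesis
      by (rule has_field_derivative_transform_within_open[where S = "{..<0}"]) (use 2 in auto)
  next
    case 3
    have "(\<lambda>h::real. ((max 0 (0 + h))\<^sup>2 - (max 0 0)\<^sup>2) / h) \<midarrow>0\<rightarrow> 0"
    proof (rule Lim_null_comparison)
      show "\<forall>\<^sub>F h in at 0. norm (((max 0 (0 + h))\<^sup>2 - (max 0 0)\<^sup>2) / h) \<le> \<bar>h\<bar>"
        by (intro always_eventually) (auto simp: max_def power2_eq_square)
      show "(\<lambda>h::real. \<bar>h\<bar>) \<midarrow>0\<rightarrow> 0" by (rule tendsto_rabs_zero) auto
    qed
    then show ?thesis using 3 unfolding DERIV_def by simp
  qed
qed

text \<open>
  The bump is a product over the coordinates of squared positive parts, one factor for each
  face of the box; such a product is nonzero exactly where all of them are.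
\<close>

lemma box_bump_exists:
  fixes a b :: "'a::euclidean_space"
  shows "\<exists>P G. has_continuous_gradient P G \<and> (\<forall>x. 0 \<le> P x) \<and> (\<forall>x. P x \<noteq> 0 \<longleftrightarrow> x \<in> box a b)"
proof -
  define p where "p s = (max 0 s)\<^sup>2" for s :: real
  define P where "P x = (\<Prod>i\<in>Basis. p (x \<bullet> i - a \<bullet> i) * p (b \<bullet> i - x \<bullet> i))" for x
  have comp: "has_continuous_gradient (\<lambda>x. p (f x)) (\<lambda>x. (2 * max 0 (f x)) *\<^sub>R F x)"
    if "has_continuous_gradient f F" for f F
    using has_continuous_gradient_compose[OF that, of p "\<lambda>s. 2 * max 0 s"] DERIV_positive_part_squared
    unfolding p_def by (simp add: continuous_on_mult_left continuous_on_max)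
  have "\<exists>G. has_continuous_gradient (\<lambda>x. p (x \<bullet> i - a \<bullet> i) * p (b \<bullet> i - x \<bullet> i)) G" for i :: 'a
    using has_continuous_gradient_mult[OF
        comp[OF has_continuous_gradient_diff[OF has_continuous_gradient_inner has_continuous_gradient_const]]
        comp[OF has_continuous_gradient_diff[OF has_continuous_gradient_const has_continuous_gradient_inner]]]
    by blast
  then have "\<exists>G. has_continuous_gradient P G"
    unfolding P_def by (intro has_continuous_gradient_prod) auto
  moreover have "0 \<le> P x" for x
    unfolding P_def p_def by (intro prod_nonneg) auto
  moreover have "P x \<noteq> 0 \<longleftrightarrow> x \<in> box a b" for x
    unfolding P_def p_def by (auto simp: mem_box max_def not_le)
  ultimately show ?thesis by blast
qed

text \<open>
  Finitely many box bumps have a sum that exceeds some \<open>c > 0\<close> on \<open>K\<close>. Composing it with a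
  profile that rises from \<open>0\<close> at \<open>0\<close> to the value \<open>1\<close> on \<open>[c, \<infinity>)\<close> gives a plateau on a neighbourhood of \<open>K\<close>.
\<close>

lemma smooth_cutoff_exists:
  fixes K U :: "'a::euclidean_space set"
  assumes "compact K" "open U" "K \<subseteq> U"
  obtains \<psi> G V where "test_function U \<psi> G" "\<And>x. 0 \<le> \<psi> x" "\<And>x. \<psi> x \<le> 1"
    "open V" "K \<subseteq> V" "\<And>x. x \<in> V \<Longrightarrow> \<psi> x = 1"
proof -
  have "\<exists>a b. x \<in> box a b \<and> cbox a b \<subseteq> U" if "x \<in> K" for x
    using that assms open_contains_cbox[of U x] by (metis subsetD)
  then obtain a b where ab: "\<And>x. x \<in> K \<Longrightarrow> x \<in> box (a x) (b x) \<and> cbox (a x) (b x) \<subseteq> U"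
    by metis
  obtain J where J: "J \<subseteq> K" "finite J" "K \<subseteq> (\<Union>x\<in>J. box (a x) (b x))"
    using compactE_image[OF assms(1), of K "\<lambda>x. box (a x) (b x)"] ab by (metis (no_types, lifting) UN_iff open_box subsetI)
  have "\<exists>P G. has_continuous_gradient P G \<and> (\<forall>y. 0 \<le> P y) \<and> (\<forall>y. P y \<noteq> 0 \<longleftrightarrow> y \<in> box (a x) (b x))" for x
    by (rule box_bump_exists)
  then obtain P where P: "\<And>x. \<exists>G. has_continuous_gradient (P x) G" "\<And>x y. 0 \<le> P x y"
    "\<And>x y. P x y \<noteq> 0 \<longleftrightarrow> y \<in> box (a x) (b x)"
    by metis
  define S where "S y = (\<Sum>x\<in>J. P x y)" for y
  obtain GS where GS: "has_continuous_gradient S GS"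
    using has_continuous_gradient_sum[OF J(2), of P] P(1) unfolding S_def by blast
  have Scont: "continuous_on UNIV S" by (rule has_continuous_gradient_continuous[OF GS])
  have S0: "0 \<le> S y" for y unfolding S_def by (intro sum_nonneg P)
  have Spos: "S y > 0" if "y \<in> K" for y
  proof -
    obtain x where "x \<in> J" "y \<in> box (a x) (b x)" using J(3) \<open>y \<in> K\<close> by auto
    then have "0 < P x y" using P(2)[of x y] P(3)[of x y] by linarith
    then show ?thesis unfolding S_def using J(2) P(2) \<open>x \<in> J\<close> by (meson sum_pos2)
  qed
  obtain c where c: "c > 0" "\<And>y. y \<in> K \<Longrightarrow> S y > c"
  proof (cases "K = {}")
    case True then show ?thesis using that[of 1] by auto
  next
    case False
    obtain y where y: "y \<in> K" "\<And>z. z \<in> K \<Longrightarrow> S y \<le> S z"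
      using continuous_attains_inf[OF assms(1) False continuous_on_subset[OF Scont]] by auto
    show ?thesis
    proof (rule that[of "S y / 2"])
      show "S y / 2 < S z" if "z \<in> K" for z
        using Spos[OF y(1)] y(2)[OF that] by linarith
    qed (use Spos[OF y(1)] in auto)
  qed
  \<comment> \<open>The profile is quadratic up to \<open>c\<close>, where its derivative reaches zero, and constant afterwards.\<close>
  define T where "T s = 1 - (max 0 (1 - s / c))\<^sup>2" for s :: real
  have T: "(T has_real_derivative 2 / c * max 0 (1 - s / c)) (at s)" for s
    unfolding T_def
    by (rule derivative_eq_intros DERIV_chain2[OF DERIV_positive_part_squared] refl)+ (use c in auto)
  define \<psi> where "\<psi> y = T (S y)" for y
  define G where "G y = (2 / c * max 0 (1 - S y / c)) *\<^sub>R GS y" for y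
  have grad: "has_continuous_gradient \<psi> G"
    unfolding \<psi>_def G_def
    by (rule has_continuous_gradient_compose[OF GS T]) (use c in \<open>auto intro!: continuous_intros\<close>)
  define C where "C = (\<Union>x\<in>J. cbox (a x) (b x))"
  have C: "compact C" "C \<subseteq> U" unfolding C_def using J ab by (auto intro!: compact_UN)
  have sub: "{y. \<psi> y \<noteq> 0} \<subseteq> C"
  proof
    fix y assume "y \<in> {y. \<psi> y \<noteq> 0}"
    then have "S y \<noteq> 0" unfolding \<psi>_def T_def by auto
    then obtain x where "x \<in> J" "P x y \<noteq> 0" unfolding S_def by (meson sum.neutral)
    then show "y \<in> C" unfolding C_def using P(3) box_subset_cbox by blast
  qed
  have cc: "closure {y. \<psi> y \<noteq> 0} \<subseteq> C" by (rule closure_minimal[OF sub compact_imp_closed[OF C(1)]])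
  then have "compactly_contained {y. \<psi> y \<noteq> 0} U"
    unfolding compactly_contained_def using C
    by (meson bounded_subset closed_closure compact_eq_bounded_closed subset_trans)
  then have test: "test_function U \<psi> G"
    unfolding test_function_def using grad unfolding has_continuous_gradient_def by auto
  show ?thesis
  proof (rule that[of \<psi> G "{y. S y > c}", OF test])
    fix x
    have "0 \<le> max 0 (1 - S x / c)" "max 0 (1 - S x / c) \<le> 1" using S0[of x] c by auto
    then show "0 \<le> \<psi> x" "\<psi> x \<le> 1" unfolding \<psi>_def T_def by (auto simp: power_le_one)
    show "open {y. c < S y}" by (rule open_Collect_less) (auto intro: Scont)
    show "K \<subseteq> {y. c < S y}" using c by auto
    show "\<psi> x = 1" if "x \<in> {y. c < S y}"
      using that c unfolding \<psi>_def T_def by (auto simp: max_def field_simps)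
  qed
qed

lemma test_function_gradient: "test_function U \<psi> G \<Longrightarrow> has_continuous_gradient \<psi> G"
  unfolding test_function_def has_continuous_gradient_def by auto

lemma test_function_continuous: "test_function U \<psi> G \<Longrightarrow> continuous_on UNIV \<psi>"
  using test_function_gradient has_continuous_gradient_continuous by blast

lemma test_function_subset: "test_function U \<psi> G \<Longrightarrow> U \<subseteq> W \<Longrightarrow> test_function W \<psi> G"
  unfolding test_function_def compactly_contained_def by auto

text \<open>
  A function that vanishes on the open complement of its support has zero derivative there.
\<close>

lemma test_function_gradient_zero:
  assumes "test_function U \<psi> G" "x \<notin> closure {x. \<psi> x \<noteq> 0}"
  shows "G x = 0"
proof -
  have d: "(\<psi> has_derivative (\<lambda>h. h \<bullet> G x)) (at x)"
    using assms unfolding test_function_def gderiv_def by auto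
  have "((\<lambda>x. 0) has_derivative (\<lambda>h. 0)) (at x)" by simp
  then have "(\<psi> has_derivative (\<lambda>h. 0)) (at x)"
    by (rule has_derivative_transform_within_open[where s = "- closure {x. \<psi> x \<noteq> 0}"])
       (use assms closure_subset[of "{x. \<psi> x \<noteq> 0}"] in auto)
  from has_derivative_unique[OF d this] have "h \<bullet> G x = 0" for h by metis
  then show ?thesis by (metis inner_eq_zero_iff)
qed

lemma compactly_supported_bounded:
  fixes f :: "'a::euclidean_space \<Rightarrow> 'b::real_normed_vector"
  assumes "continuous_on UNIV f" "compact K" "\<And>x. x \<notin> K \<Longrightarrow> f x = 0"
  obtains c where "c \<ge> 0" "\<And>x. norm (f x) \<le> c"
proof -
  have "bounded (f ` K)"
    using assms by (meson compact_continuous_image compact_imp_bounded continuous_on_subset subset_UNIV)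
  then obtain c where "\<And>x. x \<in> K \<Longrightarrow> norm (f x) \<le> c" by (auto simp: bounded_iff)
  then have "norm (f x) \<le> max 0 c" for x
    by (cases "x \<in> K") (use assms(3) in \<open>auto simp: max.coboundedI2\<close>)
  then show ?thesis using that[of "max 0 c"] by auto
qed

lemma test_function_bounded:
  assumes "test_function U \<psi> G"
  obtains c where "c \<ge> 0" "\<And>x. \<bar>\<psi> x\<bar> \<le> c"
proof -
  have "compact (closure {x. \<psi> x \<noteq> 0})"
    using assms unfolding test_function_def compactly_contained_def by auto
  then show ?thesis
    using compactly_supported_bounded[OF test_function_continuous[OF assms]] that
    by (metis (mono_tags, lifting) closure_subset mem_Collect_eq real_norm_def subsetD)
qed

lemma test_function_gradient_bounded:
  assumes "test_function U \<psi> G"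
  obtains c where "c \<ge> 0" "\<And>x. norm (G x) \<le> c"
proof -
  have "compact (closure {x. \<psi> x \<noteq> 0})" "continuous_on UNIV G"
    using assms unfolding test_function_def compactly_contained_def by auto
  then show ?thesis
    using compactly_supported_bounded[of G] test_function_gradient_zero[OF assms] that by metis
qed

section \<open>Vector measures with a density\<close>

text \<open>
  This is the condition for a polar density, with an arbitrary measure \<open>M\<close> in place of the total
  variation; in particular \<open>\<nu>\<close> need not have norm one.
\<close>

definition vector_density ::
    "'a::euclidean_space set \<Rightarrow> ('a set \<Rightarrow> 'a) \<Rightarrow> 'a measure \<Rightarrow> ('a \<Rightarrow> 'a) \<Rightarrow> bool" where
  "vector_density U D M \<nu> \<longleftrightarrow>
     sets M = sets (restrict_space borel U) \<and> \<nu> \<in> borel_measurable M \<and>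
     (\<forall>B\<in>cc_borel U. set_integrable M B \<nu> \<and> D B = set_lebesgue_integral M B \<nu>)"

lemma sets_restrict_borel_iff:
  assumes "open U" "sets M = sets (restrict_space borel U)"
  shows "B \<in> sets M \<longleftrightarrow> B \<in> sets borel \<and> B \<subseteq> U"
  using assms sets_restrict_space_iff[of U borel B] by auto

lemma space_restrict_borel: "sets M = sets (restrict_space borel U) \<Longrightarrow> space M = U"
  using sets_eq_imp_space_eq[of M "restrict_space borel U"] by (simp add: space_restrict_space)

lemma cc_borel_subset: "B \<in> cc_borel U \<Longrightarrow> B \<subseteq> U"
  unfolding cc_borel_def compactly_contained_def using closure_subset by blast

lemma cc_borel_in_sets:
  assumes "open U" "sets M = sets (restrict_space borel U)" "B \<in> cc_borel U"
  shows "B \<in> sets M"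
  using assms cc_borel_subset[OF assms(3)] sets_restrict_borel_iff[OF assms(1,2)]
  unfolding cc_borel_def by auto

lemma cc_borel_mono:
  assumes "B \<in> cc_borel U" "C \<in> sets borel" "C \<subseteq> B"
  shows "C \<in> cc_borel U"
  using assms closure_mono[OF assms(3)] unfolding cc_borel_def compactly_contained_def
  by (auto simp: compact_eq_bounded_closed intro: bounded_subset)

lemma compact_cc_borel: "compact K \<Longrightarrow> K \<subseteq> U \<Longrightarrow> K \<in> cc_borel U"
  unfolding cc_borel_def compactly_contained_def
  by (auto simp: closure_closed compact_imp_closed compact_imp_bounded)

lemma borel_measurable_restrict_borel:
  assumes "sets M = sets (restrict_space borel U)" "f \<in> borel_measurable borel"
  shows "f \<in> borel_measurable M"
  using measurable_restrict_space1[OF assms(2), of U]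
  unfolding measurable_cong_sets[OF assms(1) refl, of borel] .

lemma open_exhaustion:
  fixes U :: "'a::euclidean_space set"
  assumes "open U"
  obtains K :: "nat \<Rightarrow> 'a set" where "\<And>n. compact (K n)" "incseq K" "(\<Union>n. K n) = U" "\<And>n. K n \<subseteq> U"
proof -
  obtain C :: "nat \<Rightarrow> 'a set" where C: "\<And>n. compact (C n)" "\<And>n. C n \<subseteq> U"
    "\<And>n. C n \<subseteq> interior (C (Suc n))" "\<Union>(range C) = U"
    using open_Union_compact_subsets[OF assms] by metis
  have "incseq C" using C(3) interior_subset by (intro incseq_SucI) blast
  with C show ?thesis using that[of C] by auto
qed

text \<open>
  Partial sums are integrals over finite unions, which converge by dominated convergence.
\<close>

lemma vector_radon_measure_density:
  assumes "open U" "vector_density U D M \<nu>"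
  shows "vector_radon_measure U D"
  unfolding vector_radon_measure_def
proof (intro allI impI)
  fix B :: "nat \<Rightarrow> 'a set"
  assume B: "disjoint_family B" "range B \<subseteq> cc_borel U" "(\<Union>i. B i) \<in> cc_borel U"
  have M: "sets M = sets (restrict_space borel U)" using assms(2) unfolding vector_density_def by auto
  have Bs: "B i \<in> sets M" for i using cc_borel_in_sets[OF assms(1) M] B(2) by auto
  have int: "set_integrable M (\<Union>i. B i) \<nu>" using assms(2) B(3) unfolding vector_density_def by auto
  have "(\<lambda>i. set_lebesgue_integral M (B i) \<nu>) sums set_lebesgue_integral M (\<Union>i. B i) \<nu>"
    unfolding set_lebesgue_integral_def
  proof -
    have eq: "(\<lambda>n. \<Sum>i<n. integral\<^sup>L M (\<lambda>x. indicat_real (B i) x *\<^sub>R \<nu> x)) =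
        (\<lambda>n. integral\<^sup>L M (\<lambda>x. indicat_real (\<Union>i<n. B i) x *\<^sub>R \<nu> x))"
    proof
      fix n
      have ii: "integrable M (\<lambda>x. indicat_real (B i) x *\<^sub>R \<nu> x)" for i
        using set_integrable_subset[OF int Bs[of i]] unfolding set_integrable_def by auto
      have d: "disjoint_family_on B {..<n}" using B(1) by (rule disjoint_family_on_mono[rotated]) auto
      have "(\<Sum>i<n. integral\<^sup>L M (\<lambda>x. indicat_real (B i) x *\<^sub>R \<nu> x)) =
          integral\<^sup>L M (\<lambda>x. \<Sum>i<n. indicat_real (B i) x *\<^sub>R \<nu> x)"
        by (rule Bochner_Integration.integral_sum[symmetric]) (rule ii)
      also have "\<dots> = integral\<^sup>L M (\<lambda>x. indicat_real (\<Union>i<n. B i) x *\<^sub>R \<nu> x)"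
        unfolding indicator_UN_disjoint[OF finite_lessThan d] scaleR_sum_left ..
      finally show "(\<Sum>i<n. integral\<^sup>L M (\<lambda>x. indicat_real (B i) x *\<^sub>R \<nu> x)) =
          integral\<^sup>L M (\<lambda>x. indicat_real (\<Union>i<n. B i) x *\<^sub>R \<nu> x)" .
    qed
    have "(\<lambda>n. integral\<^sup>L M (\<lambda>x. indicat_real (\<Union>i<n. B i) x *\<^sub>R \<nu> x))
       \<longlonglongrightarrow> integral\<^sup>L M (\<lambda>x. indicat_real (\<Union>i. B i) x *\<^sub>R \<nu> x)"
    proof (rule integral_dominated_convergence[where w = "\<lambda>x. norm (indicat_real (\<Union>i. B i) x *\<^sub>R \<nu> x)"])
      show "(\<lambda>x. indicat_real (\<Union> (range B)) x *\<^sub>R \<nu> x) \<in> borel_measurable M"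
        using int unfolding set_integrable_def by auto
      show "(\<lambda>x. indicat_real (\<Union>i<n. B i) x *\<^sub>R \<nu> x) \<in> borel_measurable M" for n
        using assms(2) Bs unfolding vector_density_def by (intro borel_measurable_scaleR) auto
      show "integrable M (\<lambda>x. norm (indicat_real (\<Union> (range B)) x *\<^sub>R \<nu> x))"
        using int unfolding set_integrable_def by (rule integrable_norm)
      show "AE x in M. (\<lambda>i. indicat_real (\<Union> (B ` {..<i})) x *\<^sub>R \<nu> x)
          \<longlonglongrightarrow> indicat_real (\<Union> (range B)) x *\<^sub>R \<nu> x"
        by (intro AE_I2 tendsto_scaleR tendsto_const LIMSEQ_indicator_UN)
      show "AE x in M. norm (indicat_real (\<Union> (B ` {..<i})) x *\<^sub>R \<nu> x)
          \<le> norm (indicat_real (\<Union> (range B)) x *\<^sub>R \<nu> x)" for i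
        by (intro AE_I2) (auto simp: indicator_def)
    qed
    then show "(\<lambda>i. integral\<^sup>L M (\<lambda>x. indicat_real (B i) x *\<^sub>R \<nu> x)) sums
        integral\<^sup>L M (\<lambda>x. indicat_real (\<Union>i. B i) x *\<^sub>R \<nu> x)"
      unfolding sums_def eq .
  qed
  then show "(\<lambda>i. D (B i)) sums D (\<Union>i. B i)"
    using assms(2) B(2,3) unfolding vector_density_def by (simp add: image_subset_iff)
qed

lemma set_nn_integral_norm:
  fixes f :: "'a \<Rightarrow> 'b::{banach, second_countable_topology}"
  assumes "set_integrable M A f"
  shows "(\<integral>\<^sup>+x\<in>A. norm (f x) \<partial>M) = ennreal (set_lebesgue_integral M A (\<lambda>x. norm (f x)))"
proof -
  have "(\<integral>\<^sup>+x\<in>A. norm (f x) \<partial>M) = (\<integral>\<^sup>+x. ennreal (indicator A x *\<^sub>R norm (f x)) \<partial>M)"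
    by (intro nn_integral_cong) (auto simp: indicator_def)
  also have "\<dots> = ennreal (set_lebesgue_integral M A (\<lambda>x. norm (f x)))"
    unfolding set_lebesgue_integral_def
    by (rule nn_integral_eq_integral)
      (use set_integrable_norm[OF assms] in \<open>auto simp: set_integrable_def\<close>)
  finally show ?thesis .
qed

text \<open>
  On a level set of a simple function \<open>t\<close> the norm of the integral of \<open>t\<close> is the integral of the
  norm of \<open>t\<close>. Partitioning by the level sets of a \<open>t\<close> close to \<open>f\<close> in mean therefore loses at most twice the
  distance of \<open>t\<close> and \<open>f\<close>.
\<close>

lemma nn_integral_norm_le_partition_sum:
  fixes f :: "'a \<Rightarrow> 'b::{banach, second_countable_topology}"
  assumes f: "integrable M f" and C: "C \<in> sets M" and "0 < (\<epsilon>::real)"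
  shows "\<exists>F. finite F \<and> disjoint F \<and> F \<subseteq> sets M \<and> \<Union>F \<subseteq> C \<and>
    (\<integral>\<^sup>+x\<in>C. norm (f x) \<partial>M) \<le> (\<Sum>E\<in>F. ennreal (norm (set_lebesgue_integral M E f))) + ennreal \<epsilon>"
proof -
  have fm[measurable]: "f \<in> borel_measurable M" using f by auto
  obtain s where s: "\<And>i. Bochner_Integration.simple_bochner_integrable M (s i)"
    "(\<lambda>i. \<integral>\<^sup>+ x. ennreal (norm (f x - s i x)) \<partial>M) \<longlonglongrightarrow> 0"
    using f unfolding integrable.simps has_bochner_integral.simps by blast
  have "eventually (\<lambda>i. (\<integral>\<^sup>+ x. ennreal (norm (f x - s i x)) \<partial>M) < ennreal (\<epsilon>/2)) sequentially"
    using s(2) assms(3) by (intro order_tendstoD(2)) auto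
  then obtain i where i: "(\<integral>\<^sup>+ x. ennreal (norm (f x - s i x)) \<partial>M) < ennreal (\<epsilon>/2)"
    by (auto simp: eventually_sequentially)
  define t where "t = s i"
  have t: "Bochner_Integration.simple_bochner_integrable M t" using s unfolding t_def by auto
  have tsf: "simple_function M t" and tfin: "emeasure M {y\<in>space M. t y \<noteq> 0} \<noteq> \<infinity>"
    using t by (auto elim: Bochner_Integration.simple_bochner_integrable.cases)
  have tm[measurable]: "t \<in> borel_measurable M" by (rule borel_measurable_simple_function[OF tsf])
  have ti: "integrable M t" using has_bochner_integral_simple_bochner_integrable[OF t] by (auto simp: integrable.simps)
  define E where "E c = C \<inter> {x\<in>space M. t x = c}" for c
  define I where "I = t ` space M"
  have Ifin: "finite I" unfolding I_def using tsf by (auto simp: simple_function_def)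
  have Es[measurable]: "E c \<in> sets M" for c unfolding E_def using C by auto
  define r where "r x = ennreal (norm (f x - t x))" for x
  have rm[measurable]: "r \<in> borel_measurable M" unfolding r_def by measurable
  have piece: "(\<integral>\<^sup>+x\<in>E c. norm (f x) \<partial>M) \<le> ennreal (norm (set_lebesgue_integral M (E c) f)) + 2 * (\<integral>\<^sup>+x\<in>E c. r x \<partial>M)" for c
  proof -
    have fi: "set_integrable M (E c) f" and tti: "set_integrable M (E c) t"
      unfolding set_integrable_def by (auto intro!: integrable_mult_indicator f ti)
    have di: "set_integrable M (E c) (\<lambda>x. f x - t x)"
      by (rule set_integral_diff(1)[OF fi tti])
    have ind: "c \<noteq> 0 \<Longrightarrow> integrable M (indicat_real (E c))"
    proof (rule integrable_real_indicator[OF Es])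
      assume "c \<noteq> 0"
      then have "emeasure M (E c) \<le> emeasure M {y\<in>space M. t y \<noteq> 0}"
        unfolding E_def by (intro emeasure_mono) auto
      then show "emeasure M (E c) < \<infinity>" using tfin by (simp add: less_top le_less_trans)
    qed
    have tI: "set_lebesgue_integral M (E c) t = measure M (E c) *\<^sub>R c"
    proof -
      have "set_lebesgue_integral M (E c) t = integral\<^sup>L M (\<lambda>x. indicat_real (E c) x *\<^sub>R c)"
        unfolding set_lebesgue_integral_def
        by (intro Bochner_Integration.integral_cong) (auto simp: indicator_def E_def)
      then show ?thesis using ind by (simp add: sets.Int_space_eq2)
    qed
    have nt: "set_lebesgue_integral M (E c) (\<lambda>x. norm (t x)) = measure M (E c) * norm c"
    proof -
      have "set_lebesgue_integral M (E c) (\<lambda>x. norm (t x)) = integral\<^sup>L M (\<lambda>x. indicat_real (E c) x *\<^sub>R norm c)"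
        unfolding set_lebesgue_integral_def
        by (intro Bochner_Integration.integral_cong) (auto simp: indicator_def E_def)
      then show ?thesis using ind by (simp add: sets.Int_space_eq2)
    qed
    let ?d = "set_lebesgue_integral M (E c) (\<lambda>x. norm (f x - t x))"
    have nd: "norm (set_lebesgue_integral M (E c) (\<lambda>x. f x - t x)) \<le> ?d"
      by (rule set_integral_norm_bound[OF di])
    have "set_lebesgue_integral M (E c) (\<lambda>x. norm (f x)) \<le>
        set_lebesgue_integral M (E c) (\<lambda>x. norm (t x) + norm (f x - t x))"
      by (intro set_integral_mono set_integral_add set_integrable_norm fi tti di)
        (metis add_diff_cancel_left' diff_add_cancel norm_triangle_ineq add.commute)
    also have "\<dots> = set_lebesgue_integral M (E c) (\<lambda>x. norm (t x)) + ?d"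
      by (intro set_integral_add set_integrable_norm tti di)
    also have "set_lebesgue_integral M (E c) (\<lambda>x. norm (t x)) = norm (set_lebesgue_integral M (E c) t)"
      unfolding nt tI by simp
    also have "\<dots> \<le> norm (set_lebesgue_integral M (E c) f) + ?d"
      using nd set_integral_diff(2)[OF fi tti] norm_triangle_sub[of "set_lebesgue_integral M (E c) t" "set_lebesgue_integral M (E c) f"]
      by (simp add: norm_minus_commute)
    finally have real: "set_lebesgue_integral M (E c) (\<lambda>x. norm (f x)) \<le>
      norm (set_lebesgue_integral M (E c) f) + 2 * ?d" by simp
    have nn1: "(\<integral>\<^sup>+x\<in>E c. norm (f x) \<partial>M) = ennreal (set_lebesgue_integral M (E c) (\<lambda>x. norm (f x)))"
      by (rule set_nn_integral_norm[OF fi])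
    have nn2: "(\<integral>\<^sup>+x\<in>E c. r x \<partial>M) = ennreal ?d"
      unfolding r_def by (rule set_nn_integral_norm[OF di])
    have d0: "0 \<le> ?d" unfolding set_lebesgue_integral_def by simp
    have "(\<integral>\<^sup>+x\<in>E c. norm (f x) \<partial>M) \<le> ennreal (norm (set_lebesgue_integral M (E c) f) + 2 * ?d)"
      unfolding nn1 using real by (rule ennreal_leI)
    also have "\<dots> = ennreal (norm (set_lebesgue_integral M (E c) f)) + 2 * (\<integral>\<^sup>+x\<in>E c. r x \<partial>M)"
      unfolding nn2 using d0 by (simp add: ennreal_mult)
    finally show ?thesis .
  qed
  have split: "(\<integral>\<^sup>+x\<in>C. g x \<partial>M) = (\<Sum>c\<in>I. \<integral>\<^sup>+x\<in>E c. g x \<partial>M)"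
    if [measurable]: "g \<in> borel_measurable M" for g :: "'a \<Rightarrow> ennreal"
  proof -
    have "(\<integral>\<^sup>+x\<in>C. g x \<partial>M) = (\<integral>\<^sup>+x. (\<Sum>c\<in>I. g x * indicator (E c) x) \<partial>M)"
    proof (rule nn_integral_cong)
      fix x assume x: "x \<in> space M"
      have "(\<Sum>c\<in>I. g x * indicator (E c) x) = (\<Sum>c\<in>I. if c = t x then g x * indicator C x else 0)"
        using x by (intro sum.cong) (auto simp: E_def indicator_def)
      also have "\<dots> = g x * indicator C x" using Ifin x unfolding I_def by (simp add: sum.delta)
      finally show "g x * indicator C x = (\<Sum>c\<in>I. g x * indicator (E c) x)" by simp
    qed
    also have "\<dots> = (\<Sum>c\<in>I. \<integral>\<^sup>+x\<in>E c. g x \<partial>M)" by (rule nn_integral_sum) measurable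
    finally show ?thesis .
  qed
  have "(\<integral>\<^sup>+x\<in>C. norm (f x) \<partial>M) = (\<Sum>c\<in>I. \<integral>\<^sup>+x\<in>E c. norm (f x) \<partial>M)" by (rule split) measurable
  also have "\<dots> \<le> (\<Sum>c\<in>I. ennreal (norm (set_lebesgue_integral M (E c) f)) + 2 * (\<integral>\<^sup>+x\<in>E c. r x \<partial>M))"
    by (rule sum_mono) (rule piece)
  also have "\<dots> = (\<Sum>c\<in>I. ennreal (norm (set_lebesgue_integral M (E c) f))) + 2 * (\<integral>\<^sup>+x\<in>C. r x \<partial>M)"
    unfolding split[OF rm] by (simp add: sum.distrib sum_distrib_left)
  also have "\<dots> \<le> (\<Sum>c\<in>I. ennreal (norm (set_lebesgue_integral M (E c) f))) + ennreal \<epsilon>"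
  proof (rule add_left_mono)
    have "(\<integral>\<^sup>+x\<in>C. r x \<partial>M) \<le> (\<integral>\<^sup>+x. r x \<partial>M)"
      by (rule nn_integral_mono) (auto simp: indicator_def)
    also have "\<dots> \<le> ennreal (\<epsilon>/2)" using i unfolding r_def t_def by simp
    finally have "2 * (\<integral>\<^sup>+x\<in>C. r x \<partial>M) \<le> 2 * ennreal (\<epsilon>/2)" by (rule mult_left_mono) auto
    also have "\<dots> = ennreal 2 * ennreal (\<epsilon>/2)" by simp
    also have "\<dots> = ennreal \<epsilon>" using assms(3) by (subst ennreal_mult[symmetric]) auto
    finally show "2 * (\<integral>\<^sup>+x\<in>C. r x \<partial>M) \<le> ennreal \<epsilon>" .
  qed
  also have "(\<Sum>c\<in>I. ennreal (norm (set_lebesgue_integral M (E c) f))) =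
      (\<Sum>A\<in>E ` I. ennreal (norm (set_lebesgue_integral M A f)))"
  proof (rule sum.reindex_nontrivial[OF Ifin, symmetric, unfolded comp_def])
    fix c d assume "c \<noteq> d" "E c = E d"
    then have "E c = {}" unfolding E_def by blast
    then show "ennreal (norm (set_lebesgue_integral M (E c) f)) = 0"
      by (simp add: set_lebesgue_integral_def)
  qed
  finally have main: "(\<integral>\<^sup>+x\<in>C. norm (f x) \<partial>M) \<le>
    (\<Sum>A\<in>E ` I. ennreal (norm (set_lebesgue_integral M A f))) + ennreal \<epsilon>" .
  have "finite (E ` I)" "disjoint (E ` I)" "\<Union>(E ` I) \<subseteq> C"
    using Ifin by (auto simp: E_def disjoint_def)
  moreover have "E ` I \<subseteq> sets M" using Es by auto
  ultimately show ?thesis using main by (intro exI[of _ "E ` I"] conjI)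
qed

text \<open>
  One inequality is the triangle inequality. For the other, partitions are almost optimal by the
  previous lemma; as only sets compactly contained in \<open>U\<close> may occur in them, it is applied within the compact
  sets of an exhaustion of \<open>U\<close>.
\<close>

lemma total_variation_density:
  assumes U: "open U" and D: "vector_density U D M \<nu>"
  shows "total_variation U D = density M (\<lambda>x. ennreal (norm (\<nu> x)))"
proof -
  have M: "sets M = sets (restrict_space borel U)" and nu[measurable]: "\<nu> \<in> borel_measurable M"
    and int: "\<And>B. B \<in> cc_borel U \<Longrightarrow> set_integrable M B \<nu>"
    and DB: "\<And>B. B \<in> cc_borel U \<Longrightarrow> D B = set_lebesgue_integral M B \<nu>"
    using D unfolding vector_density_def by auto
  have space: "space M = U" by (rule space_restrict_borel[OF M])
  define \<F> where "\<F> B = {F. finite F \<and> disjoint F \<and> F \<subseteq> cc_borel U \<and> \<Union>F \<subseteq> B}" for B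
  have upper: "(\<Sum>E\<in>F. ennreal (norm (D E))) \<le> (\<integral>\<^sup>+x\<in>B. norm (\<nu> x) \<partial>M)" if "F \<in> \<F> B" for F B
  proof -
    have F: "finite F" "disjoint F" "F \<subseteq> cc_borel U" "\<Union>F \<subseteq> B" using that unfolding \<F>_def by auto
    have Es[measurable]: "E \<in> sets M" if "E \<in> F" for E
      using cc_borel_in_sets[OF U M] F(3) that by auto
    have "(\<Sum>E\<in>F. ennreal (norm (D E))) \<le> (\<Sum>E\<in>F. \<integral>\<^sup>+x\<in>E. norm (\<nu> x) \<partial>M)"
    proof (rule sum_mono)
      fix E assume "E \<in> F"
      then have E: "E \<in> cc_borel U" using F by auto
      show "ennreal (norm (D E)) \<le> (\<integral>\<^sup>+x\<in>E. norm (\<nu> x) \<partial>M)"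
        unfolding set_nn_integral_norm[OF int[OF E]] DB[OF E]
        by (rule ennreal_leI) (rule set_integral_norm_bound[OF int[OF E]])
    qed
    also have "\<dots> = (\<integral>\<^sup>+x. (\<Sum>E\<in>F. ennreal (norm (\<nu> x)) * indicator E x) \<partial>M)"
      by (rule nn_integral_sum[symmetric]) measurable
    also have "\<dots> \<le> (\<integral>\<^sup>+x\<in>B. norm (\<nu> x) \<partial>M)"
    proof (rule nn_integral_mono)
      fix x
      show "(\<Sum>E\<in>F. ennreal (norm (\<nu> x)) * indicator E x) \<le> ennreal (norm (\<nu> x)) * indicator B x"
      proof (cases "\<exists>A\<in>F. x \<in> A")
        case True
        then obtain A where A: "A \<in> F" "x \<in> A" by auto
        have "(\<Sum>E\<in>F. ennreal (norm (\<nu> x)) * indicator E x) = (\<Sum>E\<in>F. if E = A then ennreal (norm (\<nu> x)) else 0)"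
          using A F(2) by (intro sum.cong) (auto simp: indicator_def disjoint_def)
        also have "\<dots> = ennreal (norm (\<nu> x)) * indicator B x"
          using A F(1,4) by (auto simp: sum.delta indicator_def)
        finally show ?thesis by simp
      next
        case False
        then have "(\<Sum>E\<in>F. ennreal (norm (\<nu> x)) * indicator E x) = 0"
          by (intro sum.neutral) (auto simp: indicator_def)
        then show ?thesis by simp
      qed
    qed
    finally show ?thesis .
  qed
  have lower: "(\<integral>\<^sup>+x\<in>B. norm (\<nu> x) \<partial>M) \<le> (SUP F\<in>\<F> B. \<Sum>E\<in>F. ennreal (norm (D E)))"
    if B: "B \<in> sets M" for B
  proof -
    obtain K :: "nat \<Rightarrow> 'a set" where K: "\<And>n. compact (K n)" "incseq K" "(\<Union>n. K n) = U" "\<And>n. K n \<subseteq> U"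
      using open_exhaustion[OF U] by metis
    have Ksets: "K n \<in> sets M" for n
      using sets_restrict_borel_iff[OF U M] K by (auto intro: borel_compact)
    have part: "(\<integral>\<^sup>+x\<in>B \<inter> K n. norm (\<nu> x) \<partial>M) \<le> (SUP F\<in>\<F> B. \<Sum>E\<in>F. ennreal (norm (D E)))" for n
    proof (rule ennreal_le_epsilon)
      fix \<epsilon> :: real assume "0 < \<epsilon>"
      have C: "B \<inter> K n \<in> sets M" using B Ksets by auto
      have Cc: "B \<inter> K n \<in> cc_borel U"
        by (rule cc_borel_mono[OF compact_cc_borel[OF K(1,4)]])
          (use C sets_restrict_borel_iff[OF U M] in auto)
      let ?f = "\<lambda>x. indicat_real (B \<inter> K n) x *\<^sub>R \<nu> x"
      have f: "integrable M ?f" using int[OF Cc] unfolding set_integrable_def .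
      obtain F where F: "finite F" "disjoint F" "F \<subseteq> sets M" "\<Union>F \<subseteq> B \<inter> K n"
        "(\<integral>\<^sup>+x\<in>B \<inter> K n. norm (?f x) \<partial>M) \<le> (\<Sum>E\<in>F. ennreal (norm (set_lebesgue_integral M E ?f))) + ennreal \<epsilon>"
        using nn_integral_norm_le_partition_sum[OF f C \<open>0 < \<epsilon>\<close>] by auto
      have Fcc: "E \<in> cc_borel U" if "E \<in> F" for E
        by (rule cc_borel_mono[OF Cc]) (use that F(3,4) sets_restrict_borel_iff[OF U M] in auto)
      have "set_lebesgue_integral M E ?f = D E" if "E \<in> F" for E
        unfolding DB[OF Fcc[OF that]] set_lebesgue_integral_def
        by (intro Bochner_Integration.integral_cong) (use F(4) that in \<open>auto simp: indicator_def\<close>)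
      then have "(\<Sum>E\<in>F. ennreal (norm (set_lebesgue_integral M E ?f))) = (\<Sum>E\<in>F. ennreal (norm (D E)))"
        by (intro sum.cong) auto
      also have "\<dots> \<le> (SUP F\<in>\<F> B. \<Sum>E\<in>F. ennreal (norm (D E)))"
        by (rule SUP_upper) (use F(1,2,4) Fcc in \<open>auto simp: \<F>_def\<close>)
      finally have "(\<integral>\<^sup>+x\<in>B \<inter> K n. norm (?f x) \<partial>M) \<le> (SUP F\<in>\<F> B. \<Sum>E\<in>F. ennreal (norm (D E))) + ennreal \<epsilon>"
        by (rule order_trans[OF F(5) add_right_mono])
      moreover have "(\<integral>\<^sup>+x\<in>B \<inter> K n. norm (?f x) \<partial>M) = (\<integral>\<^sup>+x\<in>B \<inter> K n. norm (\<nu> x) \<partial>M)"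
        by (intro nn_integral_cong) (auto simp: indicator_def)
      ultimately show "(\<integral>\<^sup>+x\<in>B \<inter> K n. norm (\<nu> x) \<partial>M) \<le> (SUP F\<in>\<F> B. \<Sum>E\<in>F. ennreal (norm (D E))) + ennreal \<epsilon>"
        by (simp only:)
    qed
    let ?N = "density M (\<lambda>x. ennreal (norm (\<nu> x)))"
    have inc: "incseq (\<lambda>n. B \<inter> K n)" using K(2) by (auto simp: incseq_def)
    have "(\<integral>\<^sup>+x\<in>B. norm (\<nu> x) \<partial>M) = emeasure ?N B"
      using B by (subst emeasure_density) auto
    also have "\<dots> = emeasure ?N (\<Union>n. B \<inter> K n)"
    proof -
      have "B = (\<Union>n. B \<inter> K n)" using K(3) B sets_restrict_borel_iff[OF U M] by auto
      then show ?thesis by (rule arg_cong[where f = "emeasure ?N"])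
    qed
    also have "\<dots> = (SUP n. emeasure ?N (B \<inter> K n))"
      by (rule SUP_emeasure_incseq[symmetric]) (use inc B Ksets in auto)
    also have "\<dots> \<le> (SUP F\<in>\<F> B. \<Sum>E\<in>F. ennreal (norm (D E)))"
      by (rule SUP_least) (use part B Ksets in \<open>simp add: emeasure_density\<close>)
    finally show ?thesis .
  qed
  have eq: "(SUP F\<in>\<F> B. \<Sum>E\<in>F. ennreal (norm (D E))) = emeasure (density M (\<lambda>x. ennreal (norm (\<nu> x)))) B"
    if "B \<in> sets M" for B
  proof -
    have "emeasure (density M (\<lambda>x. ennreal (norm (\<nu> x)))) B = (\<integral>\<^sup>+x\<in>B. norm (\<nu> x) \<partial>M)"
      by (rule emeasure_density) (use that in auto)
    moreover have "(SUP F\<in>\<F> B. \<Sum>E\<in>F. ennreal (norm (D E))) \<le> (\<integral>\<^sup>+x\<in>B. norm (\<nu> x) \<partial>M)"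
      by (rule SUP_least) (rule upper)
    ultimately show ?thesis using antisym[OF _ lower[OF that]] by (simp only:)
  qed
  have "total_variation U D = measure_of U (sets M) (\<lambda>B. SUP F\<in>\<F> B. \<Sum>E\<in>F. ennreal (norm (D E)))"
    unfolding total_variation_def M \<F>_def ..
  also have "\<dots> = measure_of U (sets M) (emeasure (density M (\<lambda>x. ennreal (norm (\<nu> x)))))"
  proof (rule measure_of_eq)
    show "sets M \<subseteq> Pow U" using sets.space_closed[of M] space by auto
    fix B assume "B \<in> sigma_sets U (sets M)"
    then have "B \<in> sets M" using sets.sigma_sets_eq[of M] space by auto
    then show "(SUP F\<in>\<F> B. \<Sum>E\<in>F. ennreal (norm (D E))) = emeasure (density M (\<lambda>x. ennreal (norm (\<nu> x)))) B"
      by (rule eq)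
  qed
  also have "\<dots> = density M (\<lambda>x. ennreal (norm (\<nu> x)))"
    using measure_of_of_measure[of "density M (\<lambda>x. ennreal (norm (\<nu> x)))"] space by simp
  finally show ?thesis .
qed

lemma vector_density_cong:
  assumes "vector_density U D M \<nu>" "\<And>B. B \<in> cc_borel U \<Longrightarrow> D' B = D B"
  shows "vector_density U D' M \<nu>"
  using assms unfolding vector_density_def by auto

lemma is_polar_density_iff_vector_density:
  fixes U :: "'a::euclidean_space set"
  shows "is_polar_density U D \<nu> \<longleftrightarrow> vector_density U D (total_variation U D) \<nu>"
proof -
  have "sets (total_variation U D) = sets (restrict_space borel U)"
    unfolding total_variation_def
    using sets.sets_measure_of_eq[of "restrict_space borel U"] by (simp add: space_restrict_space)
  from measurable_cong_sets[OF this refl, of "borel :: 'a measure"] this show ?thesis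
    unfolding is_polar_density_def vector_density_def by (simp only: simp_thms)
qed

text \<open>
  The zero set function has total variation zero, and this is the integral of \<open>\<bar>\<nu>\<bar>\<close>.
\<close>

lemma vector_density_zero_AE:
  assumes "open U" "vector_density U (\<lambda>B. 0) M \<nu>"
  shows "AE x in M. \<nu> x = 0"
proof -
  have M: "sets M = sets (restrict_space borel U)" and [measurable]: "\<nu> \<in> borel_measurable M"
    using assms(2) unfolding vector_density_def by auto
  have sp: "space M = U" by (rule space_restrict_borel[OF M])
  have UM: "U \<in> sets M" using sp sets.top by metis
  have "(\<integral>\<^sup>+x. norm (\<nu> x) \<partial>M) = emeasure (total_variation U (\<lambda>B. 0)) U"
    unfolding total_variation_density[OF assms] using UM sp
    by (subst emeasure_density) (auto intro!: nn_integral_cong)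
  also have "\<dots> = 0"
  proof -
    have "vector_density U (\<lambda>B. 0::'a) M (\<lambda>x. 0)"
      unfolding vector_density_def using M by (auto simp: set_integrable_def set_lebesgue_integral_def)
    from total_variation_density[OF assms(1) this] UM
    show ?thesis by (simp add: emeasure_density)
  qed
  finally have "AE x in M. ennreal (norm (\<nu> x)) = 0"
    by (subst (asm) nn_integral_0_iff_AE) auto
  then show ?thesis by auto
qed

text \<open>
  Both sides have the same integral over all sets compactly contained in \<open>U\<close>, because the total
  variation is \<open>\<bar>\<nu>\<bar> M\<close>. Consequently every polar density is the normalisation of \<open>\<nu>\<close> where \<open>\<nu>\<close> is nonzero.
\<close>

lemma polar_density_AE:
  assumes U: "open U" and D: "vector_density U D M \<nu>" and P: "is_polar_density U D \<nu>'"
  shows "AE x in M. norm (\<nu> x) *\<^sub>R \<nu>' x = \<nu> x"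
proof -
  have M: "sets M = sets (restrict_space borel U)" and [measurable]: "\<nu> \<in> borel_measurable M"
    using D unfolding vector_density_def by auto
  have P': "vector_density U D (density M (\<lambda>x. ennreal (norm (\<nu> x)))) \<nu>'"
    using P unfolding is_polar_density_iff_vector_density total_variation_density[OF U D] .
  then have [measurable]: "\<nu>' \<in> borel_measurable M" unfolding vector_density_def by auto
  have "vector_density U (\<lambda>B. 0) M (\<lambda>x. norm (\<nu> x) *\<^sub>R \<nu>' x - \<nu> x)"
    unfolding vector_density_def
  proof (intro conjI ballI M)
    show "(\<lambda>x. norm (\<nu> x) *\<^sub>R \<nu>' x - \<nu> x) \<in> borel_measurable M" by measurable
    fix B assume B: "B \<in> cc_borel U"
    have [measurable]: "B \<in> sets M" by (rule cc_borel_in_sets[OF U M B])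
    have 1: "set_integrable (density M (\<lambda>x. ennreal (norm (\<nu> x)))) B \<nu>'"
      "D B = set_lebesgue_integral (density M (\<lambda>x. ennreal (norm (\<nu> x)))) B \<nu>'"
      using P' B unfolding vector_density_def by auto
    have 2: "set_integrable M B \<nu>" "D B = set_lebesgue_integral M B \<nu>"
      using D B unfolding vector_density_def by auto
    have 3: "set_integrable M B (\<lambda>x. norm (\<nu> x) *\<^sub>R \<nu>' x)"
      using 1(1) unfolding set_integrable_def
      by (subst (asm) integrable_density) (auto simp: mult.commute)
    have 4: "D B = set_lebesgue_integral M B (\<lambda>x. norm (\<nu> x) *\<^sub>R \<nu>' x)"
      unfolding 1(2) set_lebesgue_integral_def
      by (subst integral_density) (auto simp: mult.commute)
    show "set_integrable M B (\<lambda>x. norm (\<nu> x) *\<^sub>R \<nu>' x - \<nu> x)"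
      by (rule set_integral_diff(1)[OF 3 2(1)])
    show "0 = (LINT x:B|M. norm (\<nu> x) *\<^sub>R \<nu>' x - \<nu> x)"
      using set_integral_diff(2)[OF 3 2(1)] 4 2(2) by simp
  qed
  from vector_density_zero_AE[OF U this] show ?thesis by auto
qed

lemma exists_polar_density:
  assumes U: "open U" and D: "vector_density U D M \<nu>"
  shows "is_polar_density U D (\<lambda>x. sgn (\<nu> x))"
proof -
  have M: "sets M = sets (restrict_space borel U)" and [measurable]: "\<nu> \<in> borel_measurable M"
    using D unfolding vector_density_def by auto
  have s[measurable]: "(\<lambda>x. sgn (\<nu> x)) \<in> borel_measurable M" unfolding sgn_div_norm by measurable
  have e: "norm (\<nu> x) *\<^sub>R (c *\<^sub>R sgn (\<nu> x)) = c *\<^sub>R \<nu> x" for x and c :: real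
    by (cases "\<nu> x = 0") (auto simp: sgn_div_norm)
  show ?thesis
    unfolding is_polar_density_iff_vector_density total_variation_density[OF assms] vector_density_def
  proof (intro conjI ballI)
    fix B assume B: "B \<in> cc_borel U"
    have [measurable]: "B \<in> sets M" by (rule cc_borel_in_sets[OF U M B])
    have 2: "set_integrable M B \<nu>" "D B = set_lebesgue_integral M B \<nu>"
      using D B unfolding vector_density_def by auto
    show "set_integrable (density M (\<lambda>x. ennreal (norm (\<nu> x)))) B (\<lambda>x. sgn (\<nu> x))"
      using 2(1) unfolding set_integrable_def
      by (subst integrable_density) (auto simp: e simp del: scaleR_scaleR)
    show "D B = (LINT x:B|density M (\<lambda>x. ennreal (norm (\<nu> x))). sgn (\<nu> x))"
      unfolding 2(2) set_lebesgue_integral_def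
      by (subst integral_density) (auto simp: e simp del: scaleR_scaleR)
  qed (use M in auto)
qed

section \<open>Functions of bounded variation given by a density\<close>

text \<open>
  Cutoff functions of an exhaustion of an open set \<open>W\<close> converge to its indicator, so the two measures
  agree on relatively compact open sets. Open sets are stable under intersection and generate the Borel sets,
  and the general case follows by induction over the generated \<open>\<sigma>\<close>-algebra.
\<close>

lemma vector_density_unique:
  fixes U :: "'a::euclidean_space set"
  assumes U: "open U" and D: "vector_density U D M \<nu>" and D': "vector_density U D' M' \<nu>'"
    and eq: "\<And>\<psi> G. test_function U \<psi> G \<Longrightarrow> (LINT x|M. \<psi> x *\<^sub>R \<nu> x) = (LINT x|M'. \<psi> x *\<^sub>R \<nu>' x)"
    and B: "B \<in> cc_borel U"
  shows "D B = D' B"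
proof -
  have cptB: "compact (closure B)" "closure B \<subseteq> U"
    using B unfolding cc_borel_def compactly_contained_def by auto
  \<comment> \<open>Inside a fixed relatively compact neighbourhood of \<open>B\<close> complements and countable unions stay in the common domain of both set functions.\<close>
  obtain Q where Q: "open Q" "closure B \<subseteq> Q" "compact (closure Q)" "closure Q \<subseteq> U"
  proof -
    obtain \<psi> G V where *: "test_function U \<psi> G" "open V" "closure B \<subseteq> V" "\<And>x. x \<in> V \<Longrightarrow> \<psi> x = (1::real)"
      using smooth_cutoff_exists[OF cptB(1) U cptB(2)] by metis
    have "closure V \<subseteq> closure {x. \<psi> x \<noteq> 0}" by (rule closure_mono) (use *(4) in auto)
    moreover have "compact (closure {x. \<psi> x \<noteq> 0})" "closure {x. \<psi> x \<noteq> 0} \<subseteq> U"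
      using *(1) unfolding test_function_def compactly_contained_def by auto
    ultimately have "compact (closure V)" "closure V \<subseteq> U"
      using bounded_subset[of _ "closure V"] by (auto simp: compact_eq_bounded_closed)
    with * that[of V] show ?thesis by blast
  qed
  have Qcc: "Q \<inter> E \<in> cc_borel U" if "E \<in> sets borel" for E
  proof (rule cc_borel_mono[of "closure Q"])
    show "closure Q \<in> cc_borel U" by (rule compact_cc_borel[OF Q(3,4)])
  qed (use that Q(1) closure_subset in auto)
  have conv: "(\<lambda>n. LINT x|N. \<psi> n x *\<^sub>R \<mu> x) \<longlonglongrightarrow> E W"
    if E: "vector_density U E N \<mu>" and W: "W \<in> cc_borel U"
      and psi: "\<And>n. \<psi> n \<in> borel_measurable borel" "\<And>n x. \<bar>\<psi> n x\<bar> \<le> indicator W x"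
        "\<And>x. (\<lambda>n. \<psi> n x) \<longlonglongrightarrow> indicator W x"
    for E N \<mu> W and \<psi> :: "nat \<Rightarrow> 'a \<Rightarrow> real"
  proof -
    have N: "sets N = sets (restrict_space borel U)" and [measurable]: "\<mu> \<in> borel_measurable N"
      and EW: "set_integrable N W \<mu>" "E W = set_lebesgue_integral N W \<mu>"
      using E W unfolding vector_density_def by auto
    have [measurable]: "\<psi> n \<in> borel_measurable N" for n
      by (rule borel_measurable_restrict_borel[OF N psi(1)])
    have [measurable]: "W \<in> sets N" by (rule cc_borel_in_sets[OF U N W])
    show ?thesis
      unfolding EW(2) set_lebesgue_integral_def
    proof (rule integral_dominated_convergence[where w = "\<lambda>x. norm (indicat_real W x *\<^sub>R \<mu> x)"])
      show "integrable N (\<lambda>x. norm (indicat_real W x *\<^sub>R \<mu> x))"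
        using EW(1) unfolding set_integrable_def by (rule integrable_norm)
      show "AE x in N. (\<lambda>i. \<psi> i x *\<^sub>R \<mu> x) \<longlonglongrightarrow> indicat_real W x *\<^sub>R \<mu> x"
        by (intro AE_I2 tendsto_scaleR psi(3) tendsto_const)
      show "AE x in N. norm (\<psi> i x *\<^sub>R \<mu> x) \<le> norm (indicat_real W x *\<^sub>R \<mu> x)" for i
        by (intro AE_I2) (use psi(2)[of i] in \<open>auto intro!: mult_right_mono\<close>)
    qed measurable
  qed
  have open_eq: "D W = D' W" if W: "open W" "W \<in> cc_borel U" for W
  proof -
    have WU: "W \<subseteq> U" using cc_borel_subset[OF W(2)] .
    obtain K :: "nat \<Rightarrow> 'a set" where K: "\<And>n. compact (K n)" "incseq K" "(\<Union>n. K n) = W" "\<And>n. K n \<subseteq> W"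
      using open_exhaustion[OF W(1)] by metis
    have "\<exists>\<psi> G. test_function W \<psi> G \<and> (\<forall>x. 0 \<le> \<psi> x \<and> \<psi> x \<le> 1) \<and> (\<forall>x\<in>K n. \<psi> x = 1)" for n
      using smooth_cutoff_exists[OF K(1) W(1) K(4), of n] by (metis subsetD)
    then obtain \<psi> G where psi: "\<And>n. test_function W (\<psi> n) (G n)" "\<And>n x. 0 \<le> \<psi> n x" "\<And>n x. \<psi> n x \<le> 1"
      "\<And>n x. x \<in> K n \<Longrightarrow> \<psi> n x = 1" by metis
    have out: "\<psi> n x = 0" if "x \<notin> W" for n x
      using psi(1)[of n] that closure_subset[of "{x. \<psi> n x \<noteq> 0}"]
      unfolding test_function_def compactly_contained_def by auto
    have 1: "\<psi> n \<in> borel_measurable borel" for n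
      by (rule borel_measurable_continuous_onI[OF test_function_continuous[OF psi(1)]])
    have 2: "\<bar>\<psi> n x\<bar> \<le> indicator W x" for n x
      using psi(2,3)[of n x] out[of x n] by (auto simp: indicator_def)
    have 3: "(\<lambda>n. \<psi> n x) \<longlonglongrightarrow> indicator W x" for x
    proof (cases "x \<in> W")
      case True
      then obtain m where m: "x \<in> K m" using K(3) by auto
      have "\<psi> n x = indicator W x" if "n \<ge> m" for n
        using m K(2) that psi(4)[of x n] True by (auto simp: incseq_def)
      then show ?thesis by (intro tendsto_eventually eventually_sequentiallyI)
    qed (use out in auto)
    have "(LINT x|M. \<psi> n x *\<^sub>R \<nu> x) = (LINT x|M'. \<psi> n x *\<^sub>R \<nu>' x)" for n
      by (rule eq[OF test_function_subset[OF psi(1) WU]])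
    with conv[OF D W(2) 1 2 3] conv[OF D' W(2) 1 2 3] show ?thesis
      using LIMSEQ_unique by simp
  qed
  have Dsum: "(\<lambda>i. E (Q \<inter> A i)) sums E (Q \<inter> (\<Union>i. A i))"
    if "vector_radon_measure U E" "disjoint_family A" "\<And>i. A i \<in> sets borel" for E :: "'a set \<Rightarrow> 'a" and A :: "nat \<Rightarrow> 'a set"
  proof -
    have "disjoint_family (\<lambda>i. Q \<inter> A i)" using that(2) unfolding disjoint_family_on_def by auto
    moreover have "range (\<lambda>i. Q \<inter> A i) \<subseteq> cc_borel U" using Qcc that(3) by auto
    moreover have "(\<Union>i. Q \<inter> A i) = Q \<inter> (\<Union>i. A i)" by auto
    moreover have "Q \<inter> (\<Union>i. A i) \<in> cc_borel U" using Qcc that(3) by auto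
    ultimately show ?thesis using that(1) unfolding vector_radon_measure_def by metis
  qed
  have vD: "vector_radon_measure U D" "vector_radon_measure U D'"
    using vector_radon_measure_density[OF U D] vector_radon_measure_density[OF U D'] by auto
  have Bor: "sets (borel :: 'a measure) = sigma_sets UNIV {S. open S}" by (simp add: sets_borel)
  have istab: "Int_stable {S :: 'a set. open S}" by (auto simp: Int_stable_def)
  have Pow_UNIV_sub: "{S :: 'a set. open S} \<subseteq> Pow UNIV" by simp
  have "D (Q \<inter> A) = D' (Q \<inter> A)" if "A \<in> sigma_sets UNIV {S. open S}" for A :: "'a set"
    using istab Pow_UNIV_sub that
  proof (induction A rule: sigma_sets_induct_disjoint)
    case (basic A)
    then show ?case using open_eq[of "Q \<inter> A"] Q(1) Qcc[of A] by auto
  next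
    case empty
    then show ?case using open_eq[of "{}"] Qcc[of "{}"] by simp
  next
    case (compl A)
    have Ab: "A \<in> sets borel" using compl Bor by simp
    \<comment> \<open>Additivity for two sets is countable additivity for a sequence that continues with empty sets.\<close>
    define S where "S n = (if n = (0::nat) then A else if n = 1 then - A else {})" for n
    have "disjoint_family S" unfolding S_def disjoint_family_on_def by auto
    moreover have "S i \<in> sets borel" for i unfolding S_def using Ab by auto
    moreover have "(\<Union>i. S i) = UNIV" unfolding S_def by (auto split: if_splits)
    ultimately have s: "(\<lambda>i. D (Q \<inter> S i)) sums D Q" "(\<lambda>i. D' (Q \<inter> S i)) sums D' Q"
      using Dsum[OF vD(1), of S] Dsum[OF vD(2), of S] by auto
    have z: "D {} = 0" "D' {} = 0"
      using D D' Qcc[of "{}"] unfolding vector_density_def by (auto simp: set_lebesgue_integral_def)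
    have fin: "(\<lambda>i. E (Q \<inter> S i)) sums (E (Q \<inter> A) + E (Q \<inter> - A))" if "E {} = 0" for E :: "'a set \<Rightarrow> 'a"
      using sums_finite[of "{0,1}" "\<lambda>i. E (Q \<inter> S i)"] that by (auto simp: S_def)
    have "D Q = D (Q \<inter> A) + D (Q \<inter> - A)" "D' Q = D' (Q \<inter> A) + D' (Q \<inter> - A)"
      using sums_unique2[OF s(1) fin[of D, OF z(1)]] sums_unique2[OF s(2) fin[of D', OF z(2)]] by auto
    moreover have "D Q = D' Q" using open_eq[of Q] Q(1) Qcc[of UNIV] by auto
    ultimately show ?case using compl by (simp add: Compl_eq_Diff_UNIV)
  next
    case (union A)
    have Ab: "A i \<in> sets borel" for i using union Bor by auto
    have "(\<lambda>i. D (Q \<inter> A i)) sums D (Q \<inter> (\<Union>i. A i))" "(\<lambda>i. D' (Q \<inter> A i)) sums D' (Q \<inter> (\<Union>i. A i))"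
      using Dsum[OF vD(1)] Dsum[OF vD(2)] union(1) Ab by auto
    then show ?case using union by (auto dest: sums_unique2)
  qed
  moreover have "B \<in> sigma_sets UNIV {S. open S}" using B Bor unfolding cc_borel_def by auto
  moreover have "Q \<inter> B = B" using Q(2) closure_subset by blast
  ultimately show ?thesis using B by metis
qed

lemma admissible_integrandD:
  assumes "admissible_integrand \<phi>"
  shows "(\<lambda>(x, \<xi>). \<phi> x \<xi>) \<in> borel_measurable borel" "0 \<le> \<phi> x \<xi>" "0 \<le> t \<Longrightarrow> \<phi> x (t *\<^sub>R \<xi>) = t * \<phi> x \<xi>"
  using assms unfolding admissible_integrand_def by auto

lemma admissible_integrand_measurable:
  fixes \<phi> :: "'a::euclidean_space \<Rightarrow> 'a \<Rightarrow> real"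
  assumes "admissible_integrand \<phi>" "sets M = sets (restrict_space borel U)" "\<nu> \<in> borel_measurable M"
  shows "(\<lambda>x. \<phi> x (\<nu> x)) \<in> borel_measurable M"
proof -
  have 1: "(\<lambda>x. x) \<in> M \<rightarrow>\<^sub>M borel" by (rule borel_measurable_restrict_borel[OF assms(2)]) simp
  have 2: "(\<lambda>x. (x, \<nu> x)) \<in> M \<rightarrow>\<^sub>M borel \<Otimes>\<^sub>M borel" by (rule measurable_Pair[OF 1 assms(3)])
  have 3: "(\<lambda>(x, \<xi>). \<phi> x \<xi>) \<in> borel_measurable (borel \<Otimes>\<^sub>M borel)"
    using admissible_integrandD(1)[OF assms(1)] by (simp add: borel_prod)
  show ?thesis using measurable_compose[OF 2 3] by simp
qed

text \<open>
  By uniqueness every derivative measure of \<open>w\<close> has the density \<open>\<nu>\<close> with respect to \<open>M\<close>. The variation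
  measure is then \<open>\<bar>\<nu>\<bar> M\<close>, and the chosen direction is \<open>\<nu> / \<bar>\<nu>\<bar>\<close>; positive homogeneity of \<open>\<phi>\<close> cancels the factor
  \<open>\<bar>\<nu>\<bar>\<close>.
\<close>

lemma BV_density:
  fixes U :: "'a::euclidean_space set"
  assumes U: "open U" and D: "vector_density U D M \<nu>"
    and w: "set_integrable lebesgue U w"
    and parts: "\<And>\<psi> G. test_function U \<psi> G \<Longrightarrow>
      (LINT x:U|lebesgue. w x *\<^sub>R G x) = - (LINT x|M. \<psi> x *\<^sub>R \<nu> x)"
    and fin: "(\<integral>\<^sup>+x. norm (\<nu> x) \<partial>M) < \<infinity>"
  shows "w \<in> BV U"
    and "admissible_integrand \<phi> \<Longrightarrow> aniso_variation \<phi> U w U = (\<integral>\<^sup>+x. ennreal (\<phi> x (\<nu> x)) \<partial>M)"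
proof -
  have M: "sets M = sets (restrict_space borel U)" and nu[measurable]: "\<nu> \<in> borel_measurable M"
    using D unfolding vector_density_def by auto
  have sp: "space M = U" by (rule space_restrict_borel[OF M])
  have [measurable]: "U \<in> sets M" using sp sets.top by metis
  have psim: "\<psi> \<in> borel_measurable M" if "test_function U \<psi> G" for \<psi> G
    by (rule borel_measurable_restrict_borel[OF M])
      (rule borel_measurable_continuous_onI[OF test_function_continuous[OF that]])
  have polar: "is_derivative_measure U w D"
    unfolding is_derivative_measure_def
  proof (intro conjI exI allI impI)
    show "vector_radon_measure U D" by (rule vector_radon_measure_density[OF U D])
    show "is_polar_density U D (\<lambda>x. sgn (\<nu> x))" by (rule exists_polar_density[OF U D])
    fix \<psi> G assume t: "test_function U \<psi> G"
    note [measurable] = psim[OF t]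
    have [measurable]: "(\<lambda>x. sgn (\<nu> x)) \<in> borel_measurable M" unfolding sgn_div_norm by measurable
    have "(LINT x|total_variation U D. \<psi> x *\<^sub>R sgn (\<nu> x)) = (LINT x|M. norm (\<nu> x) *\<^sub>R (\<psi> x *\<^sub>R sgn (\<nu> x)))"
      unfolding total_variation_density[OF U D] by (subst integral_density) auto
    also have "\<dots> = (LINT x|M. \<psi> x *\<^sub>R \<nu> x)"
    proof (rule Bochner_Integration.integral_cong[OF refl])
      show "norm (\<nu> x) *\<^sub>R (\<psi> x *\<^sub>R sgn (\<nu> x)) = \<psi> x *\<^sub>R \<nu> x" for x
        by (cases "\<nu> x = 0") (auto simp: sgn_div_norm)
    qed
    finally show "(LINT x:U|lebesgue. w x *\<^sub>R G x) = - (LINT x|total_variation U D. \<psi> x *\<^sub>R sgn (\<nu> x))"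
      using parts[OF t] by simp
  qed
  define D' where "D' = deriv_measure U w"
  have D': "is_derivative_measure U w D'"
    unfolding D'_def deriv_measure_def by (rule someI[of "is_derivative_measure U w", OF polar])
  then obtain \<nu>' where \<nu>': "is_polar_density U D' \<nu>'"
    "\<And>\<psi> G. test_function U \<psi> G \<Longrightarrow>
           (LINT x:U|lebesgue. w x *\<^sub>R G x) = - (LINT x|total_variation U D'. \<psi> x *\<^sub>R \<nu>' x)"
    unfolding is_derivative_measure_def by auto
  have "D' B = D B" if "B \<in> cc_borel U" for B
  proof (rule vector_density_unique[OF U _ D _ that])
    show "vector_density U D' (total_variation U D') \<nu>'"
      using \<nu>'(1) unfolding is_polar_density_iff_vector_density .
    show "(LINT x|total_variation U D'. \<psi> x *\<^sub>R \<nu>' x) = (LINT x|M. \<psi> x *\<^sub>R \<nu> x)" if "test_function U \<psi> G" for \<psi> G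
      using parts[OF that] \<nu>'(2)[OF that] by simp
  qed
  then have DD: "vector_density U D' M \<nu>" by (rule vector_density_cong[OF D])
  have var: "var_measure U w = density M (\<lambda>x. ennreal (norm (\<nu> x)))"
    unfolding var_measure_def D'_def[symmetric] by (rule total_variation_density[OF U DD])
  have "emeasure (var_measure U w) U = (\<integral>\<^sup>+x. norm (\<nu> x) \<partial>M)"
    unfolding var using sp by (subst emeasure_density) (auto intro!: nn_integral_cong)
  then have "emeasure (var_measure U w) U < \<infinity>" using fin by simp
  moreover have "set_integrable lebesgue K w" if "compact K" "K \<subseteq> U" for K
    by (rule set_integrable_subset[OF w]) (use that in \<open>auto intro: fmeasurableD lmeasurable_compact\<close>)
  ultimately show "w \<in> BV U"
    unfolding BV_def BV_loc_def using polar w by auto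
  assume phi: "admissible_integrand \<phi>"
  define \<nu>'' where "\<nu>'' = var_direction U w"
  have pol: "is_polar_density U D' \<nu>''"
    unfolding \<nu>''_def var_direction_def D'_def[symmetric] by (rule someI[of "is_polar_density U D'", OF \<nu>'(1)])
  then have [measurable]: "\<nu>'' \<in> borel_measurable M"
    unfolding is_polar_density_def measurable_cong_sets[OF M refl, of borel] by simp
  have [measurable]: "(\<lambda>x. \<phi> x (\<nu>'' x)) \<in> borel_measurable M"
    by (rule admissible_integrand_measurable[OF phi M]) measurable
  have "aniso_variation \<phi> U w U = (\<integral>\<^sup>+x. ennreal (norm (\<nu> x)) * (ennreal (\<phi> x (\<nu>'' x)) * indicator U x) \<partial>M)"
    unfolding aniso_variation_def var \<nu>''_def[symmetric]
    by (subst nn_integral_density) auto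
  also have "\<dots> = (\<integral>\<^sup>+x. ennreal (\<phi> x (\<nu> x)) \<partial>M)"
  proof (rule nn_integral_cong_AE)
    have "AE x in M. x \<in> U" using sp by (auto intro: AE_I2)
    with polar_density_AE[OF U DD pol]
    show "AE x in M. ennreal (norm (\<nu> x)) * (ennreal (\<phi> x (\<nu>'' x)) * indicator U x) = ennreal (\<phi> x (\<nu> x))"
    proof eventually_elim
      case (elim x)
      have "\<phi> x (\<nu> x) = norm (\<nu> x) * \<phi> x (\<nu>'' x)"
        using admissible_integrandD(3)[OF phi, of "norm (\<nu> x)" x "\<nu>'' x"] elim(1) by simp
      then show ?case using elim(2) by (simp add: ennreal_mult')
    qed
  qed
  finally show "aniso_variation \<phi> U w U = (\<integral>\<^sup>+x. ennreal (\<phi> x (\<nu> x)) \<partial>M)" .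
qed

section \<open>Density points and representatives\<close>

text \<open>
  The rule rewrites the measure of a Lebesgue set to that of its main part, which destroys every
  monotonicity argument below.
\<close>

declare emeasure_completion [simp del]

lemma emeasure_lebesgue_ball:
  fixes x :: "'a::euclidean_space"
  assumes "0 < r"
  shows "emeasure lebesgue (ball x r) \<noteq> 0" "emeasure lebesgue (ball x r) < \<infinity>"
    "emeasure lebesgue (ball x r) = emeasure lborel (ball x r)"
proof -
  show e: "emeasure lebesgue (ball x r) = emeasure lborel (ball x r)"
    by (simp add: emeasure_completion)
  show "emeasure lebesgue (ball x r) < \<infinity>" unfolding e by (rule emeasure_lborel_ball_finite)
  show "emeasure lebesgue (ball x r) \<noteq> 0"
    unfolding e using content_ball_pos[OF assms, of x] by (auto simp: measure_def)
qed

lemma sets_lebesgue_Compl: "A \<in> sets lebesgue \<Longrightarrow> - A \<in> sets lebesgue"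
  using sets.compl_sets[of A lebesgue] by (simp add: Compl_eq_Diff_UNIV)

lemma density_ratio_complement:
  fixes A :: "'a::euclidean_space set"
  assumes "A \<in> sets lebesgue" "0 < r"
  shows "density_ratio A x r + density_ratio (- A) x r = 1"
proof -
  have "emeasure lebesgue (ball x r \<inter> A) + emeasure lebesgue (ball x r \<inter> - A) = emeasure lebesgue ((ball x r \<inter> A) \<union> (ball x r \<inter> - A))"
    by (rule plus_emeasure) (use assms sets_lebesgue_Compl[OF assms(1)] in auto)
  also have "(ball x r \<inter> A) \<union> (ball x r \<inter> - A) = ball x r" by auto
  finally show ?thesis
    unfolding density_ratio_def add_divide_distrib_ennreal[symmetric]
    using emeasure_lebesgue_ball[OF assms(2), of x] by simp
qed

text \<open>
  Ratios are nonnegative, so an upper limit that is not positive is a limit.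
\<close>

lemma density_plus_iff:
  "x \<in> density_plus A \<longleftrightarrow> \<not> (density_ratio A x \<longlongrightarrow> 0) (at_right 0)"
proof -
  have "Limsup (at_right 0) (density_ratio A x) = 0 \<longleftrightarrow> (density_ratio A x \<longlongrightarrow> 0) (at_right 0)"
  proof
    assume l: "Limsup (at_right 0) (density_ratio A x) = 0"
    have "Liminf (at_right 0) (density_ratio A x) \<le> 0"
      using Liminf_le_Limsup[of "at_right (0::real)" "density_ratio A x"] l by simp
    then show "(density_ratio A x \<longlongrightarrow> 0) (at_right 0)"
      using l by (intro Liminf_eq_Limsup) auto
  qed (auto intro: lim_imp_Limsup)
  then show ?thesis unfolding density_plus_def by (auto simp: zero_less_iff_neq_zero)
qed

text \<open>
  The ratios of \<open>A\<close> and of its complement add up to one. Through this duality facts on points of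
  density one follow from facts on points of positive upper density.
\<close>

lemma density_one_iff:
  assumes "A \<in> sets lebesgue"
  shows "x \<in> density_one A \<longleftrightarrow> x \<notin> density_plus (- A)"
proof -
  have ev: "\<forall>\<^sub>F r in at_right 0. density_ratio A x r + density_ratio (- A) x r = 1"
    using density_ratio_complement[OF assms] by (auto simp: eventually_at_filter)
  have d: "a = 1 - b" if "a + b = 1" for a b :: ennreal
    using that by (metis add.commute ennreal_add_diff_cancel_left ennreal_add_eq_top ennreal_one_neq_top top.not_eq_extremum less_top)
  have "\<forall>\<^sub>F r in at_right 0. density_ratio A x r = 1 - density_ratio (- A) x r"
    using ev by eventually_elim (rule d)
  moreover have "\<forall>\<^sub>F r in at_right 0. density_ratio (- A) x r = 1 - density_ratio A x r"
    using ev by eventually_elim (rule d, simp add: add.commute)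
  moreover have "((\<lambda>r. 1 - density_ratio (- A) x r) \<longlongrightarrow> 1 - 0) (at_right 0)"
    if "(density_ratio (- A) x \<longlongrightarrow> 0) (at_right 0)"
    by (rule tendsto_diff_ennreal[OF tendsto_const that]) auto
  moreover have "((\<lambda>r. 1 - density_ratio A x r) \<longlongrightarrow> 1 - 1) (at_right 0)"
    if "(density_ratio A x \<longlongrightarrow> 1) (at_right 0)"
    by (rule tendsto_diff_ennreal[OF tendsto_const that]) auto
  ultimately have "(density_ratio A x \<longlongrightarrow> 1) (at_right 0) \<longleftrightarrow> (density_ratio (- A) x \<longlongrightarrow> 0) (at_right 0)"
    by (auto simp: tendsto_cong)
  then show ?thesis unfolding density_plus_iff density_one_def by auto
qed

lemma density_plus_mono:
  assumes "A \<subseteq> B" "B \<in> sets lebesgue"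
  shows "density_plus A \<subseteq> density_plus B"
proof
  fix x assume "x \<in> density_plus A"
  have le: "density_ratio A x r \<le> density_ratio B x r" for r
    unfolding density_ratio_def
    by (intro divide_right_mono_ennreal emeasure_mono) (use assms in auto)
  have "(density_ratio A x \<longlongrightarrow> 0) (at_right 0)" if "(density_ratio B x \<longlongrightarrow> 0) (at_right 0)"
    by (rule tendsto_sandwich[OF _ _ tendsto_const that]) (auto simp: le)
  then show "x \<in> density_plus B" using \<open>x \<in> density_plus A\<close> unfolding density_plus_iff by auto
qed

text \<open>
  Small balls around an interior point of \<open>S\<close> do not see what happens outside \<open>S\<close>.
\<close>

lemma density_plus_local:
  fixes A :: "'a::euclidean_space set"
  assumes "open S" "x \<in> S" "A \<inter> S = B \<inter> S"
  shows "x \<in> density_plus A \<longleftrightarrow> x \<in> density_plus B"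
proof -
  obtain e where e: "e > 0" "ball x e \<subseteq> S" using assms openE by blast
  have "density_ratio A x r = density_ratio B x r" if "r < e" for r
  proof -
    have "ball x r \<subseteq> S" using e(2) subset_ball[of r e x] that by auto
    then have "ball x r \<inter> A = ball x r \<inter> B" using assms(3) by auto
    then show ?thesis unfolding density_ratio_def by simp
  qed
  then have "\<forall>\<^sub>F r in at_right 0. density_ratio A x r = density_ratio B x r"
    using e(1) by (auto simp: eventually_at_right_field intro!: exI[of _ e])
  then show ?thesis unfolding density_plus_iff by (simp add: tendsto_cong)
qed

lemma density_plus_empty: "x \<notin> density_plus {}"
  unfolding density_plus_iff by (simp add: density_ratio_def[abs_def])

lemma density_plus_UNIV: "x \<in> density_plus (UNIV :: 'a::euclidean_space set)"
proof -
  have "density_ratio UNIV x r = 1" if "r > 0" for r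
    using emeasure_lebesgue_ball[OF that, of x] unfolding density_ratio_def by simp
  then have "\<forall>\<^sub>F r in at_right 0. density_ratio UNIV x r = 1" by (auto simp: eventually_at_filter)
  then have "(density_ratio UNIV x \<longlongrightarrow> 1) (at_right 0)" by (rule tendsto_eventually)
  then show ?thesis unfolding density_plus_iff
    using tendsto_unique[of "at_right (0::real)" "density_ratio UNIV x" 1 0] by auto
qed

lemma density_one_subset_plus: 
  fixes A :: "'a::euclidean_space set"
  shows "density_one A \<subseteq> density_plus A"
proof
  fix x assume "x \<in> density_one A"
  then have "(density_ratio A x \<longlongrightarrow> 1) (at_right 0)" unfolding density_one_def by auto
  then show "x \<in> density_plus A"
    unfolding density_plus_iff using tendsto_unique[of "at_right (0::real)" _ "1::ennreal" 0] by auto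
qed

lemma density_plus_subset_closure: "density_plus A \<subseteq> closure A"
proof
  fix x assume x: "x \<in> density_plus A"
  show "x \<in> closure A"
  proof (rule ccontr)
    assume "x \<notin> closure A"
    then have "x \<in> density_plus A \<longleftrightarrow> x \<in> density_plus {}"
      by (intro density_plus_local[of "- closure A"]) (use closure_subset in auto)
    with x density_plus_empty show False by auto
  qed
qed

text \<open>
  For fixed radius the numerator is a partial integral of a Borel function of two variables.
\<close>

lemma density_ratio_borel_measurable:
  fixes A :: "'a::euclidean_space set"
  assumes "A \<in> sets lebesgue" "0 < r"
  shows "(\<lambda>x. density_ratio A x r) \<in> borel_measurable borel"
proof -
  define V where "V = emeasure lebesgue (ball (0::'a) r)"
  obtain S N N' where SN: "A = S \<union> N" "N \<subseteq> N'" "N' \<in> null_sets lborel" "S \<in> sets lborel"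
    using sets_completionE[OF assms(1)] .
  have [measurable]: "S \<in> sets borel" using SN(4) by simp
  have "emeasure lebesgue (ball x r \<inter> A) = (\<integral>\<^sup>+y. indicator S y * indicator {p::'a\<times>'a. dist (fst p) (snd p) < r} (x,y) \<partial>lborel)" for x
  proof -
    have N: "N' \<in> null_sets lebesgue" using SN(3) by (simp add: null_sets_completionI)
    have "emeasure lebesgue (ball x r \<inter> A) = emeasure lebesgue (ball x r \<inter> S)"
    proof (rule emeasure_eq_AE)
      show "AE y in lebesgue. (y \<in> ball x r \<inter> A) = (y \<in> ball x r \<inter> S)"
        using AE_not_in[OF N] by eventually_elim (use SN in auto)
    qed (use assms SN(4) in auto)
    also have "\<dots> = emeasure lborel (ball x r \<inter> S)"
      using SN(4) by (simp add: emeasure_completion)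
    also have "\<dots> = (\<integral>\<^sup>+y. indicator (ball x r \<inter> S) y \<partial>lborel)"
      using SN(4) by simp
    also have "\<dots> = (\<integral>\<^sup>+y. indicator S y * indicator {p::'a\<times>'a. dist (fst p) (snd p) < r} (x,y) \<partial>lborel)"
      by (intro nn_integral_cong) (auto simp: indicator_def)
    finally show ?thesis .
  qed
  moreover have "open {p::'a\<times>'a. dist (fst p) (snd p) < r}"
    by (intro open_Collect_less continuous_intros)
  then have [measurable]: "{p::'a\<times>'a. dist (fst p) (snd p) < r} \<in> sets (borel \<Otimes>\<^sub>M borel)"
    unfolding borel_prod by auto
  moreover have "(\<lambda>x. \<integral>\<^sup>+y. indicator S y * indicator {p::'a\<times>'a. dist (fst p) (snd p) < r} (x,y) \<partial>lborel) \<in> borel_measurable borel"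
    by measurable
  moreover have "emeasure lebesgue (ball x r) = V" for x :: 'a
    unfolding V_def using emeasure_lebesgue_ball(3)[OF assms(2), of "_ :: 'a"] assms(2) by (simp add: emeasure_ball)
  ultimately show ?thesis unfolding density_ratio_def
    by (simp only:) (intro borel_measurable_divide_ennreal borel_measurable_const)
qed

lemma inverse_antimono_ennreal:
  assumes "a \<le> (b :: ennreal)"
  shows "inverse b \<le> inverse a"
proof (cases "a = 0 \<or> b = top")
  case False
  then have "a \<noteq> top" using assms top.extremum_uniqueI by auto
  obtain r where r: "a = ennreal r" "0 \<le> r" using \<open>a \<noteq> top\<close> by (cases a) auto
  obtain s where s: "b = ennreal s" "0 \<le> s" using False by (cases b) auto
  have "0 < r" using False r by (cases "r = 0") auto
  moreover have "r \<le> s" using assms r s by auto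
  ultimately show ?thesis unfolding r s by (auto simp: inverse_ennreal intro!: ennreal_leI le_imp_inverse_le)
qed auto

text \<open>
  A ball is the increasing union of smaller concentric balls, so the numerator hardly changes when the
  radius is decreased slightly, while the denominator does not increase.
\<close>

lemma density_ratio_rational_radius:
  fixes A :: "'a::euclidean_space set"
  assumes A: "A \<in> sets lebesgue" and r: "0 < r" and c: "c < density_ratio A x r"
  shows "\<exists>q\<in>\<rat>. 0 < q \<and> q < r \<and> c < density_ratio A x q"
proof -
  \<comment> \<open>The offset \<open>2\<close> keeps all radii positive.\<close>
  define \<rho> where "\<rho> n = r - r / (real n + 2)" for n :: nat
  have rho: "0 < \<rho> n" "\<rho> n < r" for n using r unfolding \<rho>_def by (auto simp: field_simps add_pos_nonneg)
  have inc: "incseq \<rho>" unfolding \<rho>_def incseq_def using r by (auto intro!: divide_left_mono)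
  have lim: "\<rho> \<longlonglongrightarrow> r" unfolding \<rho>_def by real_asymp
  have "(\<Union>n. ball x (\<rho> n) \<inter> A) = ball x r \<inter> A"
  proof -
    have "\<exists>n. dist x y < \<rho> n" if "dist x y < r" for y
      using order_tendstoD(1)[OF lim that] by (auto simp: eventually_sequentially)
    then have "ball x r \<subseteq> (\<Union>n. ball x (\<rho> n))" by auto
    moreover have "ball x (\<rho> n) \<subseteq> ball x r" for n
      by (rule subset_ball) (use rho(2)[of n] in simp)
    ultimately show ?thesis by blast
  qed
  moreover have "(SUP n. emeasure lebesgue (ball x (\<rho> n) \<inter> A)) = emeasure lebesgue (\<Union>n. ball x (\<rho> n) \<inter> A)"
  proof (rule SUP_emeasure_incseq)
    show "incseq (\<lambda>n. ball x (\<rho> n) \<inter> A)"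
    proof (rule incseq_SucI)
      show "ball x (\<rho> n) \<inter> A \<subseteq> ball x (\<rho> (Suc n)) \<inter> A" for n
        by (intro Int_mono order_refl subset_ball incseq_SucD[OF inc])
    qed
  qed (use A in auto)
  ultimately have sup: "(SUP n. emeasure lebesgue (ball x (\<rho> n) \<inter> A) / emeasure lebesgue (ball x r)) = density_ratio A x r"
    unfolding density_ratio_def SUP_divide_ennreal[symmetric] by (simp only:)
  obtain n where n: "c < emeasure lebesgue (ball x (\<rho> n) \<inter> A) / emeasure lebesgue (ball x r)"
    using c unfolding sup[symmetric] less_SUP_iff by blast
  obtain q where q: "q \<in> \<rat>" "\<rho> n < q" "q < r" using Rats_dense_in_real[OF rho(2)] by auto
  have "q > 0" using q rho(1)[of n] by linarith
  have "emeasure lebesgue (ball x (\<rho> n) \<inter> A) / emeasure lebesgue (ball x r) \<le> emeasure lebesgue (ball x q \<inter> A) / emeasure lebesgue (ball x r)"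
    by (intro divide_right_mono_ennreal emeasure_mono) (use q A in auto)
  also have "\<dots> \<le> density_ratio A x q"
    unfolding density_ratio_def divide_ennreal_def
  proof (rule mult_left_mono)
    have "emeasure lebesgue (ball x q) \<le> emeasure lebesgue (ball x r)"
      by (intro emeasure_mono subset_ball) (use q in auto)
    then show "inverse (emeasure lebesgue (ball x r)) \<le> inverse (emeasure lebesgue (ball x q))"
      by (rule inverse_antimono_ennreal)
  qed simp
  finally show ?thesis using n q \<open>q > 0\<close> by (auto intro: less_le_trans)
qed

text \<open>
  Rational radii suffice to test whether the upper density is positive, so the set arises by
  countable operations from superlevel sets of density ratios.
\<close>

lemma density_plus_borel:
  fixes A :: "'a::euclidean_space set"
  assumes A: "A \<in> sets lebesgue"
  shows "density_plus A \<in> sets borel"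
proof -
  define T where "T n k q = {x. ennreal (1 / (real n + 1)) < density_ratio A x q}" for n k :: nat and q
  define Q where "Q k = {q \<in> \<rat>. 0 < q \<and> q < 1 / (real k + 1)}" for k
  have "density_plus A = (\<Union>n. \<Inter>k. \<Union>q\<in>Q k. T n k q)"
  proof (intro set_eqI iffI)
    fix x assume x: "x \<in> density_plus A"
    have "\<exists>a>0. \<not> (\<forall>\<^sub>F r in at_right 0. density_ratio A x r < a)"
      using x order_tendstoI[of 0 "density_ratio A x" "at_right 0"] unfolding density_plus_iff by auto
    then obtain a where a: "a > 0" "\<not> (\<forall>\<^sub>F r in at_right 0. density_ratio A x r < a)" by auto
    obtain b where b: "0 < b" "ennreal b < a"
      using a(1) by (metis dense ennreal_cases ennreal_less_zero_iff less_top not_less_zero top.not_eq_extremum less_trans)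
    obtain n where n: "1 / (real n + 1) < b"
      using reals_Archimedean[OF b(1)] by (auto simp: inverse_eq_divide algebra_simps)
    have na: "ennreal (1 / (real n + 1)) < a"
      using b(2) n by (meson ennreal_leI le_less_trans less_imp_le)
    have "\<exists>q\<in>Q k. x \<in> T n k q" for k
    proof -
      have "\<not> (\<forall>r>0. r < 1 / (real k + 1) \<longrightarrow> density_ratio A x r < a)"
      proof
        assume "\<forall>r>0. r < 1 / (real k + 1) \<longrightarrow> density_ratio A x r < a"
        then have "\<forall>\<^sub>F r in at_right 0. density_ratio A x r < a"
          unfolding eventually_at_right_field by (intro exI[of _ "1 / (real k + 1)"]) auto
        with a show False by simp
      qed
      then obtain r where r: "r > 0" "r < 1 / (real k + 1)" "a \<le> density_ratio A x r" by (auto simp: not_less)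
      obtain q where "q \<in> \<rat>" "0 < q" "q < r" "ennreal (1 / (real n + 1)) < density_ratio A x q"
        using density_ratio_rational_radius[OF A r(1) less_le_trans[OF na r(3)]] by auto
      then show ?thesis using r unfolding Q_def T_def by auto
    qed
    then show "x \<in> (\<Union>n. \<Inter>k. \<Union>q\<in>Q k. T n k q)" by auto
  next
    fix x assume "x \<in> (\<Union>n. \<Inter>k. \<Union>q\<in>Q k. T n k q)"
    then obtain n where n: "\<And>k. \<exists>q\<in>Q k. x \<in> T n k q" by auto
    have False if "(density_ratio A x \<longlongrightarrow> 0) (at_right 0)"
    proof -
      have "\<forall>\<^sub>F r in at_right 0. density_ratio A x r < ennreal (1 / (real n + 1))"
        by (rule order_tendstoD(2)[OF that]) auto
      then obtain b where b: "b > 0" "\<And>r. 0 < r \<Longrightarrow> r < b \<Longrightarrow> density_ratio A x r < ennreal (1 / (real n + 1))"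
        unfolding eventually_at_right_field by auto
      obtain k where k: "1 / (real k + 1) < b"
        using reals_Archimedean[OF b(1)] by (auto simp: inverse_eq_divide algebra_simps)
      obtain q where "q \<in> Q k" "x \<in> T n k q" using n by auto
      then show False using b(2)[of q] k unfolding Q_def T_def by auto
    qed
    then show "x \<in> density_plus A" unfolding density_plus_iff by auto
  qed
  moreover have "(\<Union>n. \<Inter>k. \<Union>q\<in>Q k. T n k q) \<in> sets borel"
  proof (intro sets.countable_UN sets.countable_INT image_subsetI)
    fix n k :: nat
    have "countable (Q k)" unfolding Q_def by (rule countable_subset[OF _ countable_rat]) auto
    moreover have "T n k q \<in> sets borel" if "q \<in> Q k" for q
    proof -
      have "0 < q" using that unfolding Q_def by auto
      note [measurable] = density_ratio_borel_measurable[OF A this]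
      show ?thesis unfolding T_def by measurable
    qed
    ultimately show "(\<Union>q\<in>Q k. T n k q) \<in> sets borel" by (intro sets.countable_UN') auto
  qed auto
  ultimately show ?thesis by simp
qed

lemma density_one_borel:
  fixes A :: "'a::euclidean_space set"
  assumes "A \<in> sets lebesgue"
  shows "density_one A \<in> sets borel"
proof -
  have "density_one A = - density_plus (- A)" using density_one_iff[OF assms] by auto
  then show ?thesis using borel_comp[OF density_plus_borel[OF sets_lebesgue_Compl[OF assms]]] by simp
qed

lemma superlevel_sets_lebesgue:
  fixes \<Omega> :: "'a::euclidean_space set" and w :: "'a \<Rightarrow> real"
  assumes "open \<Omega>" "w \<in> borel_measurable (lebesgue_on \<Omega>)"
  shows "{y \<in> \<Omega>. t < w y} \<in> sets lebesgue" "{y \<in> \<Omega>. w y < t} \<in> sets lebesgue"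
    "{y \<in> \<Omega>. w y \<le> t} \<in> sets lebesgue"
proof -
  have O: "\<Omega> \<in> sets lebesgue" using assms(1) by auto
  have "{y \<in> space (lebesgue_on \<Omega>). t < w y} \<in> sets (lebesgue_on \<Omega>)"
    using assms(2)[unfolded borel_measurable_iff_greater] ..
  moreover have "{y \<in> space (lebesgue_on \<Omega>). w y < t} \<in> sets (lebesgue_on \<Omega>)"
    using assms(2)[unfolded borel_measurable_iff_less] ..
  moreover have "{y \<in> space (lebesgue_on \<Omega>). w y \<le> t} \<in> sets (lebesgue_on \<Omega>)"
    using assms(2)[unfolded borel_measurable_iff_le] ..
  ultimately show "{y \<in> \<Omega>. t < w y} \<in> sets lebesgue" "{y \<in> \<Omega>. w y < t} \<in> sets lebesgue"
    "{y \<in> \<Omega>. w y \<le> t} \<in> sets lebesgue"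
    using sets_restrict_space_iff[of \<Omega> lebesgue] O by (auto simp: space_restrict_space)
qed

lemma upper_rep_mono:
  assumes "open \<Omega>" "v \<in> borel_measurable (lebesgue_on \<Omega>)" "\<And>y. y \<in> \<Omega> \<Longrightarrow> w y \<le> v y"
  shows "upper_rep \<Omega> w x \<le> upper_rep \<Omega> v x"
proof -
  have "density_plus {y \<in> \<Omega>. w y > t} \<subseteq> density_plus {y \<in> \<Omega>. v y > t}" for t
    by (rule density_plus_mono[OF _ superlevel_sets_lebesgue(1)[OF assms(1,2)]])
      (use assms(3) in \<open>auto intro: less_le_trans\<close>)
  then show ?thesis unfolding upper_rep_def by (intro Sup_subset_mono) auto
qed

text \<open>
  Representatives only depend on the germ of a function, which allows the two parts of a
  competitor to be treated separately.
\<close>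

lemma upper_rep_local:
  assumes "open S" "x \<in> S" "\<And>y. y \<in> S \<Longrightarrow> y \<in> \<Omega> \<Longrightarrow> w y = v y"
  shows "upper_rep \<Omega> w x = upper_rep \<Omega> v x"
proof -
  have "x \<in> density_plus {y \<in> \<Omega>. w y > t} \<longleftrightarrow> x \<in> density_plus {y \<in> \<Omega>. v y > t}" for t
    by (rule density_plus_local[OF assms(1,2)]) (use assms(3) in auto)
  then show ?thesis unfolding upper_rep_def by simp
qed

lemma upper_rep_borel_measurable:
  fixes \<Omega> :: "'a::euclidean_space set"
  assumes "open \<Omega>" "w \<in> borel_measurable (lebesgue_on \<Omega>)"
  shows "upper_rep \<Omega> w \<in> borel_measurable borel"
proof (rule borel_measurableI_greater)
  fix a :: ereal
  have "{x. a < upper_rep \<Omega> w x} = (\<Union>q\<in>{q\<in>\<rat>. a < ereal q}. density_plus {y \<in> \<Omega>. w y > q})"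
  proof (intro set_eqI iffI)
    fix x assume "x \<in> {x. a < upper_rep \<Omega> w x}"
    then obtain t where t: "a < ereal t" "x \<in> density_plus {y \<in> \<Omega>. w y > t}"
      unfolding upper_rep_def by (auto simp: less_Sup_iff)
    obtain q where q: "a < ereal (real_of_rat q)" "ereal (real_of_rat q) < ereal t" using ereal_dense3[OF t(1)] by auto
    have "density_plus {y \<in> \<Omega>. w y > t} \<subseteq> density_plus {y \<in> \<Omega>. w y > real_of_rat q}"
      by (rule density_plus_mono[OF _ superlevel_sets_lebesgue(1)[OF assms]]) (use q in auto)
    then show "x \<in> (\<Union>q\<in>{q\<in>\<rat>. a < ereal q}. density_plus {y \<in> \<Omega>. w y > q})"
      using t(2) q(1) by (intro UN_I[of "real_of_rat q"]) auto
  next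
    fix x assume "x \<in> (\<Union>q\<in>{q\<in>\<rat>. a < ereal q}. density_plus {y \<in> \<Omega>. w y > q})"
    then show "x \<in> {x. a < upper_rep \<Omega> w x}" unfolding upper_rep_def by (auto simp: less_Sup_iff)
  qed
  moreover have "(\<Union>q\<in>{q\<in>\<rat>. a < ereal q}. density_plus {y \<in> \<Omega>. w y > q}) \<in> sets borel"
  proof -
    have "countable {q\<in>\<rat>. a < ereal q}" by (rule countable_subset[OF _ countable_rat]) auto
    moreover have "density_plus {y \<in> \<Omega>. w y > q} \<in> sets borel" for q
      by (rule density_plus_borel[OF superlevel_sets_lebesgue(1)[OF assms]])
    ultimately show ?thesis by (intro sets.countable_UN') auto
  qed
  ultimately show "{x \<in> space (borel :: 'a measure). a < upper_rep \<Omega> w x} \<in> sets (borel :: 'a measure)" by simp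
qed

text \<open>
  A point has density one in \<open>{w > t}\<close> unless \<open>{w \<le> t}\<close> has positive upper density there, and the
  latter sets are, up to an arbitrarily small change of the level, superlevel sets of \<open>- w\<close>.
\<close>

lemma lower_rep_eq_uminus_upper_rep:
  fixes \<Omega> :: "'a::euclidean_space set"
  assumes O: "open \<Omega>" and w: "w \<in> borel_measurable (lebesgue_on \<Omega>)" and x: "x \<in> \<Omega>"
  shows "lower_rep \<Omega> w x = - upper_rep \<Omega> (\<lambda>y. - w y) x"
proof -
  have one: "x \<in> density_one {y \<in> \<Omega>. w y > t} \<longleftrightarrow> x \<notin> density_plus {y \<in> \<Omega>. w y \<le> t}" for t
  proof -
    have "x \<in> density_plus (- {y \<in> \<Omega>. w y > t}) \<longleftrightarrow> x \<in> density_plus {y \<in> \<Omega>. w y \<le> t}"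
      by (rule density_plus_local[OF O x]) auto
    then show ?thesis using density_one_iff[OF superlevel_sets_lebesgue(1)[OF O w]] by auto
  qed
  have up: "x \<in> density_plus {y \<in> \<Omega>. w y \<le> t}" if "x \<in> density_plus {y \<in> \<Omega>. - w y > s}" "- t < s" for s t
    using density_plus_mono[of "{y \<in> \<Omega>. - w y > s}" "{y \<in> \<Omega>. w y \<le> t}"] superlevel_sets_lebesgue(3)[OF O w, of t] that by fastforce
  have down: "x \<in> density_plus {y \<in> \<Omega>. - w y > - t}" if "x \<in> density_plus {y \<in> \<Omega>. w y \<le> s}" "s < t" for s t
    using density_plus_mono[of "{y \<in> \<Omega>. w y \<le> s}" "{y \<in> \<Omega>. - w y > - t}"] superlevel_sets_lebesgue(2)[OF O w, of t] that by fastforce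
  show ?thesis
  proof (rule antisym)
    show "lower_rep \<Omega> w x \<le> - upper_rep \<Omega> (\<lambda>y. - w y) x"
      unfolding lower_rep_def
    proof (rule Sup_least, clarify)
      fix t assume t: "x \<in> density_one {y \<in> \<Omega>. w y > t}"
      have "upper_rep \<Omega> (\<lambda>y. - w y) x \<le> ereal (- t)"
        unfolding upper_rep_def
      proof (rule Sup_least, clarify)
        fix s assume "x \<in> density_plus {y \<in> \<Omega>. - w y > s}"
        then have "\<not> - t < s" using up[of s t] t one by auto
        then show "ereal s \<le> ereal (- t)" by simp
      qed
      then show "ereal t \<le> - upper_rep \<Omega> (\<lambda>y. - w y) x"
        by (metis ereal_minus_le_minus ereal_uminus_uminus uminus_ereal.simps(1))
    qed
    show "- upper_rep \<Omega> (\<lambda>y. - w y) x \<le> lower_rep \<Omega> w x"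
    proof (rule ccontr)
      assume "\<not> - upper_rep \<Omega> (\<lambda>y. - w y) x \<le> lower_rep \<Omega> w x"
      then obtain c where c: "lower_rep \<Omega> w x < ereal c" "ereal c < - upper_rep \<Omega> (\<lambda>y. - w y) x"
        using ereal_dense2 by (auto simp: not_le)
      obtain d where d: "ereal c < ereal d" "ereal d < - upper_rep \<Omega> (\<lambda>y. - w y) x"
        using ereal_dense2[OF c(2)] by auto
      have "x \<notin> density_one {y \<in> \<Omega>. w y > c}"
        using c(1) unfolding lower_rep_def by (metis (mono_tags, lifting) Sup_upper mem_Collect_eq not_le)
      then have "x \<in> density_plus {y \<in> \<Omega>. - w y > - d}" using one down[of c d] d(1) by auto
      then have "ereal (- d) \<le> upper_rep \<Omega> (\<lambda>y. - w y) x" unfolding upper_rep_def by (auto intro!: Sup_upper)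
      with d(2) show False by (metis ereal_minus_le_minus leD uminus_ereal.simps(1) ereal_uminus_uminus)
    qed
  qed
qed

lemma lower_rep_le_upper_rep:
  fixes \<Omega> :: "'a::euclidean_space set"
  shows "lower_rep \<Omega> w x \<le> upper_rep \<Omega> w x"
  unfolding lower_rep_def upper_rep_def using density_one_subset_plus by (intro Sup_subset_mono) blast

text \<open>
  The upper bound is monotonicity. For the lower bound \<open>- w\<^sup>+ \<le> - w\<^sup>- = (- w)\<^sup>+\<close>, and \<open>- w \<le> v\<close> too.
\<close>

lemma abs_upper_rep_le:
  fixes \<Omega> :: "'a::euclidean_space set"
  assumes O: "open \<Omega>" and w: "w \<in> borel_measurable (lebesgue_on \<Omega>)" and v: "v \<in> borel_measurable (lebesgue_on \<Omega>)"
    and le: "\<And>y. y \<in> \<Omega> \<Longrightarrow> \<bar>w y\<bar> \<le> v y" and x: "x \<in> \<Omega>"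
  shows "\<bar>upper_rep \<Omega> w x\<bar> \<le> upper_rep \<Omega> v x"
proof -
  have 1: "upper_rep \<Omega> w x \<le> upper_rep \<Omega> v x" "upper_rep \<Omega> (\<lambda>y. - w y) x \<le> upper_rep \<Omega> v x"
    by (rule upper_rep_mono[OF O v]; use le in \<open>auto simp: abs_le_iff\<close>)+
  have "- upper_rep \<Omega> w x \<le> upper_rep \<Omega> (\<lambda>y. - w y) x"
    using lower_rep_eq_uminus_upper_rep[OF O w x] lower_rep_le_upper_rep[of \<Omega> w x]
    by (metis ereal_minus_le_minus ereal_uminus_uminus)
  then show ?thesis using 1 by (simp add: ereal_abs_leI)
qed

lemma Sup_ereal_lessThan: "Sup {ereal t | t. t < c} = ereal c"
proof (rule Sup_eqI)
  fix y assume y: "\<And>z. z \<in> {ereal t | t. t < c} \<Longrightarrow> z \<le> y"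
  show "ereal c \<le> y"
  proof (rule ccontr)
    assume "\<not> ereal c \<le> y"
    then obtain d where "y < ereal d" "ereal d < ereal c" using ereal_dense2[of y "ereal c"] by (auto simp: not_le)
    with y[of "ereal d"] show False by auto
  qed
qed auto

text \<open>
  The sign of \<open>s\<close> decides which level sets occur between the values \<open>0\<close> and \<open>s\<close>: those of a positive
  multiple are \<open>A\<close>, those of a negative multiple are its complement. This is why \<open>A\<^sup>+\<close> and \<open>A\<^sup>1\<close>
  trade places between the two isoperimetric conditions.
\<close>

lemma upper_rep_indicator:
  fixes \<Omega> :: "'a::euclidean_space set"
  assumes O: "open \<Omega>" and x: "x \<in> \<Omega>" and A: "A \<in> sets lebesgue"
  shows "0 < s \<Longrightarrow> upper_rep \<Omega> (\<lambda>y. s * indicator A y) x = ereal (s * indicator (density_plus A) x)"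
    and "s < 0 \<Longrightarrow> upper_rep \<Omega> (\<lambda>y. s * indicator A y) x = ereal (s * indicator (density_one A) x)"
    and "s = 0 \<Longrightarrow> upper_rep \<Omega> (\<lambda>y. s * indicator A y) x = 0"
proof -
  have loc: "x \<in> density_plus {y \<in> \<Omega>. s * indicator A y > t} \<longleftrightarrow> x \<in> density_plus {y. s * indicator A y > t}" for t
    by (rule density_plus_local[OF O x]) auto
  have below: "x \<in> density_plus {y. s * indicator A y > t}" if "t < 0" "t < s" for t
  proof -
    have "{y. s * indicator A y > t} = UNIV" using that by (auto simp: indicator_def)
    then show ?thesis using density_plus_UNIV by simp
  qed
  have above: "x \<notin> density_plus {y. s * indicator A y > t}" if "0 \<le> t" "s \<le> t" for t
  proof -
    have "{y. s * indicator A y > t} = {}" using that by (auto simp: indicator_def)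
    then show ?thesis using density_plus_empty by simp
  qed
  have Sup: "upper_rep \<Omega> (\<lambda>y. s * indicator A y) x = ereal c"
    if "\<And>t. x \<in> density_plus {y. s * indicator A y > t} \<longleftrightarrow> t < c" for c
    unfolding upper_rep_def loc that by (rule Sup_ereal_lessThan)
  show "upper_rep \<Omega> (\<lambda>y. s * indicator A y) x = ereal (s * indicator (density_plus A) x)" if s: "0 < s"
  proof (rule Sup)
    fix t
    consider "t < 0" | "0 \<le> t" "t < s" | "s \<le> t" by linarith
    then show "x \<in> density_plus {y. s * indicator A y > t} \<longleftrightarrow> t < s * indicator (density_plus A) x"
    proof cases
      case 2
      then have "{y. s * indicator A y > t} = A" by (auto simp: indicator_def)
      then show ?thesis using 2 by (auto simp: indicator_def)
    qed (use s below[of t] above[of t] in \<open>auto simp: indicator_def\<close>)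
  qed
  show "upper_rep \<Omega> (\<lambda>y. s * indicator A y) x = ereal (s * indicator (density_one A) x)" if s: "s < 0"
  proof (rule Sup)
    fix t
    consider "t < s" | "s \<le> t" "t < 0" | "0 \<le> t" by linarith
    then show "x \<in> density_plus {y. s * indicator A y > t} \<longleftrightarrow> t < s * indicator (density_one A) x"
    proof cases
      case 2
      then have "{y. s * indicator A y > t} = - A" by (auto simp: indicator_def)
      then show ?thesis using 2 density_one_iff[OF A, of x] by (auto simp: indicator_def)
    qed (use s below[of t] above[of t] in \<open>auto simp: indicator_def\<close>)
  qed
  show "upper_rep \<Omega> (\<lambda>y. s * indicator A y) x = 0" if s: "s = 0"
    using Sup[of 0] below above s by (metis less_le_not_le linorder_not_less zero_ereal_def)
qed

section \<open>Convergence in mean of difference quotients\<close>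

lemma lborel_translate:
  fixes f :: "'a::euclidean_space \<Rightarrow> 'b::{banach, second_countable_topology}"
  assumes [measurable]: "f \<in> borel_measurable borel"
  shows integrable_lborel_translate: "integrable lborel (\<lambda>x. f (x + c)) \<longleftrightarrow> integrable lborel f"
    and integral_lborel_translate: "(LBINT x. f (x + c)) = (LBINT x. f x)"
proof -
  have "integrable lborel f \<longleftrightarrow> integrable (distr lborel borel ((+) c)) f" by (simp add: lborel_distr_plus)
  also have "\<dots> \<longleftrightarrow> integrable lborel (\<lambda>x. f (c + x))" by (rule integrable_distr_eq) measurable
  finally show "integrable lborel (\<lambda>x. f (x + c)) \<longleftrightarrow> integrable lborel f" by (simp add: add.commute)
  have "(LBINT x. f x) = integral\<^sup>L (distr lborel borel ((+) c)) f" by (simp add: lborel_distr_plus)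
  also have "\<dots> = (LBINT x. f (c + x))" by (rule integral_distr) measurable
  finally show "(LBINT x. f (x + c)) = (LBINT x. f x)" by (simp add: add.commute)
qed

lemma compact_inner_approximation:
  fixes M :: "'a::euclidean_space measure"
  assumes M: "sets M = sets borel" "emeasure M (space M) \<noteq> \<infinity>" and B: "B \<in> sets borel" and "0 < (\<epsilon>::real)"
  obtains K where "compact K" "K \<subseteq> B" "emeasure M (B - K) < ennreal \<epsilon>"
proof -
  have eq: "emeasure M B = (SUP K \<in> {K. K \<subseteq> B \<and> compact K}. emeasure M K)"
    by (rule inner_regular[OF M B])
  have fin: "emeasure M X < \<infinity>" for X
    using order.strict_trans1[OF emeasure_space[of M X]] M(2) by (simp add: less_top)
  have ne: "{K. K \<subseteq> B \<and> compact K} \<noteq> {}" by (auto intro!: exI[of _ "{}"])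
  have "\<exists>K\<in>{K. K \<subseteq> B \<and> compact K}. emeasure M B < emeasure M K + ennreal \<epsilon>"
    by (rule SUP_approx_ennreal[OF assms(4) ne eq]) (use fin[of B] in auto)
  then obtain K where K: "K \<in> {K. K \<subseteq> B \<and> compact K}" "emeasure M B < emeasure M K + ennreal \<epsilon>"
    by blast
  have Kb: "K \<in> sets M" using K M(1) by (auto intro: borel_compact)
  have "emeasure M K + emeasure M (B - K) = emeasure M (K \<union> (B - K))"
    by (rule plus_emeasure) (use Kb B M(1) in auto)
  also have "K \<union> (B - K) = B" using K by auto
  finally have "emeasure M K + emeasure M (B - K) < emeasure M K + ennreal \<epsilon>" using K(2) by simp
  then have "emeasure M (B - K) < ennreal \<epsilon>" by (simp add: ennreal_add_left_cancel_less)
  with K that show ?thesis by auto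
qed

text \<open>
  For an indicator choose \<open>K \<subseteq> A \<subseteq> V\<close> with \<open>K\<close> compact, \<open>V\<close> open and \<open>V - K\<close> of small measure. A small
  translation keeps \<open>K\<close> inside \<open>V\<close>, so the indicator can change at \<open>x\<close> only if \<open>x\<close> or its translate lies in
  \<open>V - K\<close>. Sums and limits in mean inherit the property.
\<close>

lemma continuous_translation_L1:
  fixes f :: "'a::euclidean_space \<Rightarrow> real"
  assumes "integrable lborel f" "0 < \<epsilon>"
  shows "\<exists>\<delta>>0. \<forall>h. norm h < \<delta> \<longrightarrow> (LBINT x. \<bar>f (x + h) - f x\<bar>) < \<epsilon>"
  using assms
proof (induction arbitrary: \<epsilon> rule: integrable_induct)
  case (base A c)
  have A: "A \<in> sets borel" "emeasure lborel A < \<infinity>" using base by auto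
  \<comment> \<open>The set \<open>V - K\<close> and its translate have measure at most \<open>2 \<eta>\<close> each.\<close>
  define \<eta> where "\<eta> = \<epsilon> / (4 * (\<bar>c\<bar> + 1))"
  have eta: "0 < \<eta>" unfolding \<eta>_def using base by auto
  define M where "M = density lborel (indicator A :: 'a \<Rightarrow> ennreal)"
  have M: "sets M = sets borel" "emeasure M (space M) \<noteq> \<infinity>"
    unfolding M_def using A by (auto simp: emeasure_density)
  obtain K where K: "compact K" "K \<subseteq> A" "emeasure M (A - K) < ennreal \<eta>"
    using compact_inner_approximation[OF M A(1) eta] by blast
  have Kb: "K \<in> sets borel" using K by (auto intro: borel_compact)
  have "emeasure M (A - K) = (\<integral>\<^sup>+x\<in>A - K. indicator A x \<partial>lborel)"
    unfolding M_def by (rule emeasure_density) (use A Kb in auto)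
  also have "\<dots> = (\<integral>\<^sup>+x. indicator (A - K) x \<partial>lborel)" by (intro nn_integral_cong) (auto simp: indicator_def)
  also have "\<dots> = emeasure lborel (A - K)" using A Kb by simp
  finally have AK: "emeasure lborel (A - K) < ennreal \<eta>" using K(3) by simp
  obtain V where V: "open V" "A \<subseteq> V" "emeasure lborel (V - A) < ennreal \<eta>"
    using outer_regular_lborel[OF A(1) eta] by blast
  obtain \<delta> where d: "\<delta> > 0" "(\<Union>x\<in>K. ball x \<delta>) \<subseteq> V"
    using compact_subset_open_imp_ball_epsilon_subset[OF K(1) V(1)] K(2) V(2) by auto
  define W where "W = V - K"
  have Wb: "W \<in> sets borel" unfolding W_def using V Kb by auto
  have "W = (V - A) \<union> (A - K)" unfolding W_def using K V by auto
  then have "emeasure lborel W \<le> emeasure lborel (V - A) + emeasure lborel (A - K)"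
    using emeasure_subadditive[of "V - A" lborel "A - K"] A V Kb by auto
  also have "\<dots> \<le> ennreal \<eta> + ennreal \<eta>" using V(3) AK by (intro add_mono) auto
  finally have W: "emeasure lborel W \<le> ennreal (2 * \<eta>)" using eta by (simp flip: ennreal_plus)
  have Wfin: "emeasure lborel W < \<infinity>" using W by (simp add: le_less_trans)
  have Wi: "integrable lborel (indicat_real W)" by (rule integrable_real_indicator) (use Wb Wfin in auto)
  have Wm: "measure lborel W \<le> 2 * \<eta>"
    using W eta by (simp add: measure_def enn2real_leI)
  show ?case
  proof (intro exI[of _ \<delta>] conjI allI impI d(1))
    fix h :: 'a assume h: "norm h < \<delta>"
    have near: "x + h \<in> V" "x - h \<in> V" if "x \<in> K" for x
    proof -
      have "x + h \<in> ball x \<delta>" "x - h \<in> ball x \<delta>" using h by (auto simp: dist_norm)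
      then show "x + h \<in> V" "x - h \<in> V" using d(2) that by blast+
    qed
    have pt: "\<bar>indicator A (x + h) *\<^sub>R c - indicator A x *\<^sub>R c\<bar> \<le> \<bar>c\<bar> * (indicat_real W x + indicat_real W (x + h))" for x
    proof -
      have "indicator W x + indicator W (x + h) \<ge> (1::real)" if "(x + h \<in> A) \<noteq> (x \<in> A)"
        using that near(1)[of x] near(2)[of "x + h"] K(2) V(2) unfolding W_def by (auto simp: indicator_def)
      then have "\<bar>indicat_real A (x + h) - indicator A x\<bar> \<le> indicat_real W x + indicat_real W (x + h)"
        by (cases "x \<in> A"; cases "x + h \<in> A"; cases "x \<in> W"; cases "x + h \<in> W") auto
      then have "\<bar>c\<bar> * \<bar>indicat_real A (x + h) - indicator A x\<bar> \<le> \<bar>c\<bar> * (indicat_real W x + indicat_real W (x + h))"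
        by (intro mult_left_mono) auto
      moreover have "\<bar>indicator A (x + h) *\<^sub>R c - indicator A x *\<^sub>R c\<bar> = \<bar>c\<bar> * \<bar>indicat_real A (x + h) - indicator A x\<bar>"
        by (simp add: abs_mult[symmetric] algebra_simps)
      ultimately show ?thesis by simp
    qed
    have Wi': "integrable lborel (\<lambda>x. indicat_real W (x + h))"
      by (subst integrable_lborel_translate) (use Wb Wi in auto)
    have "(LBINT x. \<bar>indicator A (x + h) *\<^sub>R c - indicator A x *\<^sub>R c\<bar>)
        \<le> (LBINT x. \<bar>c\<bar> * (indicat_real W x + indicat_real W (x + h)))"
      by (rule integral_mono') (use Wi Wi' pt in auto)
    also have "\<dots> = \<bar>c\<bar> * (measure lborel W + measure lborel W)"
      using Wi Wi' integral_lborel_translate[of "indicat_real W" h] Wb by simp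
    also have "\<dots> \<le> \<bar>c\<bar> * (4 * \<eta>)" using Wm by (intro mult_left_mono) auto
    also have "\<dots> = \<epsilon> * (\<bar>c\<bar> / (\<bar>c\<bar> + 1))" unfolding \<eta>_def by (simp add: field_simps)
    also have "\<dots> < \<epsilon> * 1" by (intro mult_strict_left_mono) (use base in \<open>auto simp: field_simps\<close>)
    finally show "(LBINT x. \<bar>indicator A (x + h) *\<^sub>R c - indicator A x *\<^sub>R c\<bar>) < \<epsilon>" by simp
  qed
next
  case (add f g)
  obtain \<delta>1 where d1: "\<delta>1 > 0" "\<And>h. norm h < \<delta>1 \<Longrightarrow> (LBINT x. \<bar>f (x + h) - f x\<bar>) < \<epsilon> / 2"
    using add.IH(1)[of "\<epsilon> / 2"] add.prems by auto
  obtain \<delta>2 where d2: "\<delta>2 > 0" "\<And>h. norm h < \<delta>2 \<Longrightarrow> (LBINT x. \<bar>g (x + h) - g x\<bar>) < \<epsilon> / 2"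
    using add.IH(2)[of "\<epsilon> / 2"] add.prems by auto
  have m: "f \<in> borel_measurable borel" "g \<in> borel_measurable borel"
    using borel_measurable_integrable[OF add.hyps(1)] borel_measurable_integrable[OF add.hyps(2)] by auto
  show ?case
  proof (intro exI[of _ "min \<delta>1 \<delta>2"] conjI allI impI)
    fix h :: 'a assume h: "norm h < min \<delta>1 \<delta>2"
    have i: "integrable lborel (\<lambda>x. f (x + h) - f x)" "integrable lborel (\<lambda>x. g (x + h) - g x)"
      using add.hyps m by (auto intro!: Bochner_Integration.integrable_diff simp: integrable_lborel_translate)
    have "(LBINT x. \<bar>f (x + h) + g (x + h) - (f x + g x)\<bar>) \<le>
        (LBINT x. \<bar>f (x + h) - f x\<bar> + \<bar>g (x + h) - g x\<bar>)"
      by (rule integral_mono') (use i in auto)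
    also have "\<dots> = (LBINT x. \<bar>f (x + h) - f x\<bar>) + (LBINT x. \<bar>g (x + h) - g x\<bar>)"
      using i by (intro Bochner_Integration.integral_add) auto
    also have "\<dots> < \<epsilon>" using d1(2)[of h] d2(2)[of h] h by simp
    finally show "(LBINT x. \<bar>f (x + h) + g (x + h) - (f x + g x)\<bar>) < \<epsilon>" .
  qed (use d1 d2 in auto)
next
  case (lim f s)
  have m: "f \<in> borel_measurable borel" "\<And>i. s i \<in> borel_measurable borel"
    using borel_measurable_integrable[OF lim.hyps(4)] borel_measurable_integrable[OF lim.hyps(1)] by auto
  have "(\<lambda>i. LBINT x. \<bar>s i x - f x\<bar>) \<longlonglongrightarrow> (LINT x|(lborel::'a measure). 0)"
  proof (rule integral_dominated_convergence[where w = "\<lambda>x. 3 * \<bar>f x\<bar>"])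
    show "AE x in lborel. (\<lambda>i. \<bar>s i x - f x\<bar>) \<longlonglongrightarrow> 0"
      using lim.hyps(2) by (auto intro!: tendsto_rabs_zero LIM_zero)
    show "AE x in lborel. norm \<bar>s i x - f x\<bar> \<le> 3 * \<bar>f x\<bar>" for i
    proof (rule AE_I2)
      fix x :: 'a
      have "\<bar>s i x\<bar> \<le> 2 * \<bar>f x\<bar>" using lim.hyps(3)[of x i] by simp
      then show "norm \<bar>s i x - f x\<bar> \<le> 3 * \<bar>f x\<bar>" by simp
    qed
  qed (use lim.hyps m in auto)
  then have "eventually (\<lambda>i. (LBINT x. \<bar>s i x - f x\<bar>) < \<epsilon> / 4) sequentially"
    using lim.prems by (intro order_tendstoD(2)) auto
  then obtain i where i: "(LBINT x. \<bar>s i x - f x\<bar>) < \<epsilon> / 4" by (auto simp: eventually_sequentially)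
  obtain \<delta> where d: "\<delta> > 0" "\<And>h. norm h < \<delta> \<Longrightarrow> (LBINT x. \<bar>s i (x + h) - s i x\<bar>) < \<epsilon> / 2"
    using lim.IH[of "\<epsilon> / 2" i] lim.prems by auto
  show ?case
  proof (intro exI[of _ \<delta>] conjI allI impI d(1))
    fix h :: 'a assume h: "norm h < \<delta>"
    have j: "integrable lborel (\<lambda>x. s i x - f x)" using lim.hyps by auto
    have j': "integrable lborel (\<lambda>x. s i (x + h) - f (x + h))"
      using integrable_lborel_translate[of "\<lambda>x. s i x - f x" h] j m by auto
    have j'': "integrable lborel (\<lambda>x. s i (x + h) - s i x)"
      using lim.hyps m by (auto intro!: Bochner_Integration.integrable_diff simp: integrable_lborel_translate)
    have "(LBINT x. \<bar>f (x + h) - f x\<bar>) \<le>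
        (LBINT x. \<bar>s i (x + h) - f (x + h)\<bar> + \<bar>s i x - f x\<bar> + \<bar>s i (x + h) - s i x\<bar>)"
      by (rule integral_mono') (use j j' j'' in auto)
    also have "\<dots> = (LBINT x. \<bar>s i (x + h) - f (x + h)\<bar>) + (LBINT x. \<bar>s i x - f x\<bar>) + (LBINT x. \<bar>s i (x + h) - s i x\<bar>)"
      using j j' j'' by simp
    also have "(LBINT x. \<bar>s i (x + h) - f (x + h)\<bar>) = (LBINT x. \<bar>s i x - f x\<bar>)"
      by (rule integral_lborel_translate) (use m in measurable)
    also have "(LBINT x. \<bar>s i x - f x\<bar>) + (LBINT x. \<bar>s i x - f x\<bar>) + (LBINT x. \<bar>s i (x + h) - s i x\<bar>) < \<epsilon>"
      using i d(2)[OF h] by simp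
    finally show "(LBINT x. \<bar>f (x + h) - f x\<bar>) < \<epsilon>" .
  qed
qed

text \<open>
  The sign of \<open>f\<close> is approximated by the difference of two cutoff functions, which are \<open>1\<close> on large compact
  parts of \<open>{f > 0}\<close> and of \<open>{f < 0}\<close> and have disjoint supports.
\<close>

lemma L1_norm_le_test_functions:
  fixes f :: "'a::euclidean_space \<Rightarrow> real"
  assumes f: "integrable lborel f"
    and le: "\<And>\<psi> G. test_function UNIV \<psi> G \<Longrightarrow> (\<And>x. \<bar>\<psi> x\<bar> \<le> 1) \<Longrightarrow> (LBINT x. f x * \<psi> x) \<le> \<eta>"
  shows "(LBINT x. \<bar>f x\<bar>) \<le> \<eta>"
proof (rule field_le_epsilon)
  fix \<epsilon> :: real assume e: "0 < \<epsilon>"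
  have m[measurable]: "f \<in> borel_measurable borel" using borel_measurable_integrable[OF f] by simp
  define M where "M = density lborel (\<lambda>x. ennreal \<bar>f x\<bar>)"
  have M: "sets M = sets borel" "emeasure M (space M) \<noteq> \<infinity>"
    using f unfolding M_def integrable_iff_bounded by (auto simp: emeasure_density)
  have Mm: "emeasure M B = (\<integral>\<^sup>+x\<in>B. \<bar>f x\<bar> \<partial>lborel)" if "B \<in> sets borel" for B
    unfolding M_def using that by (subst emeasure_density) auto
  have Pb: "{x. f x > 0} \<in> sets borel" "{x. f x < 0} \<in> sets borel" by measurable
  obtain K where K: "compact K" "K \<subseteq> {x. f x > 0}" "emeasure M ({x. f x > 0} - K) < ennreal (\<epsilon> / 4)"
    using compact_inner_approximation[OF M Pb(1), of "\<epsilon> / 4"] e by auto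
  obtain L where L: "compact L" "L \<subseteq> {x. f x < 0}" "emeasure M ({x. f x < 0} - L) < ennreal (\<epsilon> / 4)"
    using compact_inner_approximation[OF M Pb(2), of "\<epsilon> / 4"] e by auto
  have "K \<inter> L = {}" using K(2) L(2) by force
  then obtain U V where UV: "open U" "open V" "K \<subseteq> U" "L \<subseteq> V" "U \<inter> V = {}"
    using separation_normal[of K L] K(1) L(1) compact_imp_closed by metis
  obtain \<psi>1 G1 where p1: "test_function U \<psi>1 G1" "\<And>x. 0 \<le> \<psi>1 x" "\<And>x. \<psi>1 x \<le> 1" "\<And>x. x \<in> K \<Longrightarrow> \<psi>1 x = 1"
    using smooth_cutoff_exists[OF K(1) UV(1,3)] by (metis subsetD)
  obtain \<psi>2 G2 where p2: "test_function V \<psi>2 G2" "\<And>x. 0 \<le> \<psi>2 x" "\<And>x. \<psi>2 x \<le> 1" "\<And>x. x \<in> L \<Longrightarrow> \<psi>2 x = 1"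
    using smooth_cutoff_exists[OF L(1) UV(2,4)] by (metis subsetD)
  define \<psi> where "\<psi> x = \<psi>1 x - \<psi>2 x" for x
  have supp: "\<psi>1 x = 0" if "x \<notin> U" for x
    using p1(1) that closure_subset[of "{x. \<psi>1 x \<noteq> 0}"] unfolding test_function_def compactly_contained_def by auto
  have supp2: "\<psi>2 x = 0" if "x \<notin> V" for x
    using p2(1) that closure_subset[of "{x. \<psi>2 x \<noteq> 0}"] unfolding test_function_def compactly_contained_def by auto
  have test: "test_function UNIV \<psi> (\<lambda>x. G1 x - G2 x)"
  proof -
    have "has_continuous_gradient \<psi> (\<lambda>x. G1 x - G2 x)"
      unfolding \<psi>_def by (intro has_continuous_gradient_diff test_function_gradient[OF p1(1)] test_function_gradient[OF p2(1)])
    moreover have "compact (closure {x. \<psi> x \<noteq> 0})"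
    proof -
      have "bounded {x. \<psi>1 x \<noteq> 0}" "bounded {x. \<psi>2 x \<noteq> 0}"
        using p1(1) p2(1) unfolding test_function_def compactly_contained_def by (auto dest: compact_imp_bounded)
      then have "bounded ({x. \<psi>1 x \<noteq> 0} \<union> {x. \<psi>2 x \<noteq> 0})" by simp
      then have "bounded {x. \<psi> x \<noteq> 0}" by (rule bounded_subset) (auto simp: \<psi>_def)
      then show ?thesis by simp
    qed
    ultimately show ?thesis
      unfolding test_function_def has_continuous_gradient_def compactly_contained_def by auto
  qed
  have b: "\<bar>\<psi> x\<bar> \<le> 1" for x
    using p1(2,3)[of x] p2(2,3)[of x] unfolding \<psi>_def by (auto simp: abs_le_iff)
  have mpsi[measurable]: "\<psi> \<in> borel_measurable borel"
    by (rule borel_measurable_continuous_onI[OF test_function_continuous[OF test]])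
  have fp: "integrable lborel (\<lambda>x. f x * \<psi> x)"
  proof (rule Bochner_Integration.integrable_bound[OF f])
    show "AE x in lborel. norm (f x * \<psi> x) \<le> norm (f x)"
      using b by (auto simp: abs_mult intro!: mult_left_le)
  qed measurable
  \<comment> \<open>Outside \<open>R\<close> the product of \<open>f\<close> with the test function is \<open>\<bar>f\<bar>\<close>, and on \<open>R\<close> it is at least \<open>- \<bar>f\<bar>\<close>.\<close>
  define R where "R = ({x. f x > 0} - K) \<union> ({x. f x < 0} - L)"
  have Rb[measurable]: "R \<in> sets borel" unfolding R_def by (intro sets.Un sets.Diff Pb borel_compact K(1) L(1))
  have "emeasure M R \<le> ennreal (\<epsilon> / 4) + ennreal (\<epsilon> / 4)"
  proof -
    have "emeasure M R \<le> emeasure M ({x. f x > 0} - K) + emeasure M ({x. f x < 0} - L)"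
      unfolding R_def
      by (rule emeasure_subadditive; unfold M(1)) (intro sets.Diff Pb borel_compact K(1) L(1))+
    also have "\<dots> \<le> ennreal (\<epsilon> / 4) + ennreal (\<epsilon> / 4)" using K(3) L(3) by (intro add_mono) auto
    finally show ?thesis .
  qed
  also have "\<dots> = ennreal (\<epsilon> / 2)" using e by (simp flip: ennreal_plus)
  finally have R: "(\<integral>\<^sup>+x\<in>R. \<bar>f x\<bar> \<partial>lborel) \<le> ennreal (\<epsilon> / 2)" using Mm[OF Rb] by simp
  have fR: "integrable lborel (\<lambda>x. indicator R x *\<^sub>R \<bar>f x\<bar>)"
    by (rule integrable_mult_indicator) (use f in auto)
  have "ennreal (LBINT x. indicator R x *\<^sub>R \<bar>f x\<bar>) = (\<integral>\<^sup>+x. ennreal (indicator R x *\<^sub>R \<bar>f x\<bar>) \<partial>lborel)"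
    by (rule nn_integral_eq_integral[symmetric]) (use fR in auto)
  also have "\<dots> = (\<integral>\<^sup>+x\<in>R. \<bar>f x\<bar> \<partial>lborel)" by (intro nn_integral_cong) (auto simp: indicator_def)
  finally have "ennreal (LBINT x. indicator R x *\<^sub>R \<bar>f x\<bar>) \<le> ennreal (\<epsilon> / 2)" using R by (simp only:)
  then have R2: "(LBINT x. indicator R x *\<^sub>R \<bar>f x\<bar>) \<le> \<epsilon> / 2"
    using e by (subst (asm) ennreal_le_iff) auto
  have pt: "\<bar>f x\<bar> \<le> f x * \<psi> x + 2 * (indicator R x *\<^sub>R \<bar>f x\<bar>)" for x
  proof -
    have "x \<in> K \<or> x \<in> L \<or> f x = 0 \<or> x \<in> R" unfolding R_def by auto
    then consider "x \<in> K" | "x \<in> L" | "f x = 0" | "x \<in> R" by blast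
    then show ?thesis
    proof cases
      case 1
      then have "\<psi> x = 1" unfolding \<psi>_def using p1(4) supp2[of x] UV(3,5) by auto
      then show ?thesis using 1 K(2) by (auto simp: indicator_def)
    next
      case 2
      then have "\<psi> x = -1" unfolding \<psi>_def using p2(4) supp[of x] UV(4,5) by auto
      then show ?thesis using 2 L(2) by (auto simp: indicator_def)
    next
      case 4
      have "\<bar>f x * \<psi> x\<bar> \<le> \<bar>f x\<bar>" using b[of x] by (simp add: abs_mult mult_left_le)
      then have "- \<bar>f x\<bar> \<le> f x * \<psi> x" by linarith
      then show ?thesis using 4 by simp
    qed simp
  qed
  have "(LBINT x. \<bar>f x\<bar>) \<le> (LBINT x. f x * \<psi> x + 2 * (indicator R x *\<^sub>R \<bar>f x\<bar>))"
    by (rule integral_mono) (use f fp fR pt in auto)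
  also have "\<dots> = (LBINT x. f x * \<psi> x) + 2 * (LBINT x. indicator R x *\<^sub>R \<bar>f x\<bar>)"
    using fp fR by simp
  also have "\<dots> \<le> \<eta> + \<epsilon>" using le[OF test b] R2 by simp
  finally show "(LBINT x. \<bar>f x\<bar>) \<le> \<eta> + \<epsilon>" .
qed

lemma test_function_translate:
  assumes "test_function UNIV \<psi> G"
  shows "test_function UNIV (\<lambda>x. \<psi> (x - c)) (\<lambda>x. G (x - c))"
proof -
  have g: "(\<psi> has_derivative (\<lambda>h. h \<bullet> G y)) (at y)" and c: "continuous_on UNIV G"
    and k: "compact (closure {x. \<psi> x \<noteq> 0})" for y
    using assms unfolding test_function_def gderiv_def compactly_contained_def by auto
  have "((\<lambda>x. \<psi> (x - c)) has_derivative (\<lambda>h. h \<bullet> G (x - c))) (at x)" for x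
    by (rule has_derivative_compose[OF _ g, of "\<lambda>x. x - c" "\<lambda>h. h" x UNIV]) (auto intro!: derivative_eq_intros)
  moreover have "continuous_on UNIV (\<lambda>x. G (x - c))"
    by (rule continuous_on_compose2[OF c]) (auto intro!: continuous_intros)
  moreover have "compact (closure {x. \<psi> (x - c) \<noteq> 0})"
  proof -
    have "bounded {x. \<psi> x \<noteq> 0}" using k closure_subset bounded_subset compact_imp_bounded by metis
    then have "bounded ((+) c ` {x. \<psi> x \<noteq> 0})" by (rule bounded_translation)
    moreover have "{x. \<psi> (x - c) \<noteq> 0} \<subseteq> (+) c ` {x. \<psi> x \<noteq> 0}"
    proof
      fix x assume "x \<in> {x. \<psi> (x - c) \<noteq> 0}"
      then show "x \<in> (+) c ` {x. \<psi> x \<noteq> 0}" by (intro image_eqI[of _ _ "x - c"]) auto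
    qed
    ultimately show ?thesis by (simp add: bounded_subset)
  qed
  ultimately show ?thesis unfolding test_function_def gderiv_def compactly_contained_def by auto
qed

lemma test_function_lipschitz:
  assumes t: "test_function U \<psi> G" and c: "\<And>x. norm (G x) \<le> c"
  shows "\<bar>\<psi> x - \<psi> y\<bar> \<le> c * norm (x - y)"
proof -
  have "norm (\<psi> x - \<psi> y) \<le> c * norm (x - y)"
  proof (rule differentiable_bound[of UNIV \<psi> "\<lambda>x h. h \<bullet> G x"])
    show "(\<psi> has_derivative (\<lambda>h. h \<bullet> G x)) (at x)" for x
      using t unfolding test_function_def gderiv_def by auto
    show "onorm (\<lambda>h. h \<bullet> G x) \<le> c" for x
    proof (rule onorm_le)
      fix h
      have "norm (h \<bullet> G x) \<le> norm h * norm (G x)" by (simp add: Cauchy_Schwarz_ineq2)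
      also have "\<dots> \<le> norm h * c" by (intro mult_left_mono c) auto
      finally show "norm (h \<bullet> G x) \<le> c * norm h" by (simp add: mult.commute)
    qed
  qed auto
  then show ?thesis by simp
qed

lemma integrable_mult_bounded:
  fixes w f :: "'a::euclidean_space \<Rightarrow> real"
  assumes "integrable lborel w" "f \<in> borel_measurable borel" "\<And>x. \<bar>f x\<bar> \<le> c"
  shows "integrable lborel (\<lambda>x. w x * f x)"
proof (rule Bochner_Integration.integrable_bound[where f = "\<lambda>x. c * w x"])
  show "AE x in lborel. norm (w x * f x) \<le> norm (c * w x)"
  proof (rule AE_I2)
    fix x :: 'a
    have "\<bar>w x\<bar> * \<bar>f x\<bar> \<le> \<bar>w x\<bar> * \<bar>c\<bar>"
      using assms(3)[of x] by (intro mult_left_mono) auto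
    then show "norm (w x * f x) \<le> norm (c * w x)" by (simp add: abs_mult mult.commute)
  qed
qed (use assms borel_measurable_integrable[OF assms(1)] in auto)

text \<open>
  Differentiation under the integral: the difference quotients of the test function are bounded by the
  bound of its gradient. The derivative falls on the test function, so \<open>w\<close> only has to be integrable.
\<close>

lemma DERIV_integral_translated_test_function:
  fixes w :: "'a::euclidean_space \<Rightarrow> real"
  assumes w: "integrable lborel w" and t: "test_function UNIV \<psi> G"
  shows "((\<lambda>s. LBINT x. w x * \<psi> (x - s *\<^sub>R e)) has_real_derivative
    - (LBINT x. w x * (G (x - s *\<^sub>R e) \<bullet> e))) (at s)"
  unfolding DERIV_def tendsto_at_iff_sequentially
proof (intro allI impI)
  fix X :: "nat \<Rightarrow> real" assume X: "\<forall>i. X i \<in> UNIV - {0}" "X \<longlonglongrightarrow> 0"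
  have wm[measurable]: "w \<in> borel_measurable borel" using borel_measurable_integrable[OF w] by simp
  obtain b where b: "\<And>x. \<bar>\<psi> x\<bar> \<le> b" using test_function_bounded[OF t] by metis
  obtain c where c: "c \<ge> 0" "\<And>x. norm (G x) \<le> c" using test_function_gradient_bounded[OF t] by metis
  have pm[measurable]: "\<psi> \<in> borel_measurable borel"
    by (rule borel_measurable_continuous_onI[OF test_function_continuous[OF t]])
  have Gm[measurable]: "G \<in> borel_measurable borel"
    using t unfolding test_function_def by (auto intro: borel_measurable_continuous_onI)
  have i: "integrable lborel (\<lambda>x. w x * \<psi> (x - d))" for d
    by (rule integrable_mult_bounded[OF w _ b]) measurable
  have quot: "((LBINT x. w x * \<psi> (x - (s + h) *\<^sub>R e)) - (LBINT x. w x * \<psi> (x - s *\<^sub>R e))) / h =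
      (LBINT x. w x * ((\<psi> (x - (s + h) *\<^sub>R e) - \<psi> (x - s *\<^sub>R e)) / h))" for h
  proof -
    have "((LBINT x. w x * \<psi> (x - (s + h) *\<^sub>R e)) - (LBINT x. w x * \<psi> (x - s *\<^sub>R e))) =
      (LBINT x. w x * \<psi> (x - (s + h) *\<^sub>R e) - w x * \<psi> (x - s *\<^sub>R e))"
      by (rule Bochner_Integration.integral_diff[symmetric]) (rule i)+
    then show ?thesis by (simp add: right_diff_distrib)
  qed
  have "(\<lambda>n. LBINT x. w x * ((\<psi> (x - (s + X n) *\<^sub>R e) - \<psi> (x - s *\<^sub>R e)) / X n))
    \<longlonglongrightarrow> (LBINT x. w x * - (G (x - s *\<^sub>R e) \<bullet> e))"
  proof (rule integral_dominated_convergence[where w = "\<lambda>x. \<bar>w x\<bar> * (c * norm e)"])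
    show "AE x in lborel. (\<lambda>n. w x * ((\<psi> (x - (s + X n) *\<^sub>R e) - \<psi> (x - s *\<^sub>R e)) / X n))
        \<longlonglongrightarrow> w x * - (G (x - s *\<^sub>R e) \<bullet> e)"
    proof (rule AE_I2, rule tendsto_mult[OF tendsto_const])
      fix x :: 'a
      have g: "(\<psi> has_derivative (\<lambda>h. h \<bullet> G y)) (at y)" for y
        using t unfolding test_function_def gderiv_def by auto
      have "((\<lambda>s. \<psi> (x - s *\<^sub>R e)) has_derivative (\<lambda>h. (- (h *\<^sub>R e)) \<bullet> G (x - s *\<^sub>R e))) (at s)"
        by (rule has_derivative_compose[OF _ g, of "\<lambda>s. x - s *\<^sub>R e" "\<lambda>h. - (h *\<^sub>R e)" s UNIV])
          (auto intro!: derivative_eq_intros)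
      then have "((\<lambda>s. \<psi> (x - s *\<^sub>R e)) has_real_derivative - (G (x - s *\<^sub>R e) \<bullet> e)) (at s)"
        unfolding has_field_derivative_def
        by (rule has_derivative_eq_rhs) (auto simp: inner_commute)
      then show "(\<lambda>n. (\<psi> (x - (s + X n) *\<^sub>R e) - \<psi> (x - s *\<^sub>R e)) / X n) \<longlonglongrightarrow> - (G (x - s *\<^sub>R e) \<bullet> e)"
        using X unfolding DERIV_def tendsto_at_iff_sequentially comp_def by auto
    qed
    show "AE x in lborel. norm (w x * ((\<psi> (x - (s + X n) *\<^sub>R e) - \<psi> (x - s *\<^sub>R e)) / X n)) \<le> \<bar>w x\<bar> * (c * norm e)" for n
    proof (rule AE_I2)
      fix x :: 'a
      have "\<bar>\<psi> (x - (s + X n) *\<^sub>R e) - \<psi> (x - s *\<^sub>R e)\<bar> \<le> c * norm ((x - (s + X n) *\<^sub>R e) - (x - s *\<^sub>R e))"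
        by (rule test_function_lipschitz[OF t c(2)])
      also have "(x - (s + X n) *\<^sub>R e) - (x - s *\<^sub>R e) = (- X n) *\<^sub>R e" by (simp add: algebra_simps)
      finally have "\<bar>\<psi> (x - (s + X n) *\<^sub>R e) - \<psi> (x - s *\<^sub>R e)\<bar> / \<bar>X n\<bar> \<le> c * norm e"
        using X(1) by (simp add: field_simps)
      then show "norm (w x * ((\<psi> (x - (s + X n) *\<^sub>R e) - \<psi> (x - s *\<^sub>R e)) / X n)) \<le> \<bar>w x\<bar> * (c * norm e)"
        by (simp only: real_norm_def abs_mult abs_divide) (intro mult_left_mono, auto)
    qed
    show "integrable lborel (\<lambda>x. \<bar>w x\<bar> * (c * norm e))" using w by auto
  qed measurable
  then show "((\<lambda>h. ((LBINT x. w x * \<psi> (x - (s + h) *\<^sub>R e)) - (LBINT x. w x * \<psi> (x - s *\<^sub>R e))) / h) \<circ> X)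
      \<longlonglongrightarrow> - (LBINT x. w x * (G (x - s *\<^sub>R e) \<bullet> e))"
    unfolding comp_def quot by simp
qed

text \<open>
  Translating \<open>\<psi>\<close> leaves its integral unchanged, so the directional derivatives integrate to zero. The
  indicator of a large ball serves as the integrable weight.
\<close>

lemma integral_gradient_zero:
  fixes G :: "'a::euclidean_space \<Rightarrow> 'a"
  assumes t: "test_function UNIV \<psi> G"
  shows "(LBINT x. G x) = 0"
proof -
  have "bounded (closure {x. \<psi> x \<noteq> 0})"
    using t unfolding test_function_def compactly_contained_def by (auto dest: compact_imp_bounded)
  then obtain R where R: "R > 0" "closure {x. \<psi> x \<noteq> 0} \<subseteq> ball 0 R" by (auto dest: bounded_subset_ballD)
  define w :: "'a \<Rightarrow> real" where "w = indicator (ball 0 (R + 1))"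
  have w: "integrable lborel w"
    unfolding w_def by (rule integrable_real_indicator) (auto simp: emeasure_lborel_ball_finite[unfolded infinity_ennreal_def])
  have Gm[measurable]: "G \<in> borel_measurable borel" and pm[measurable]: "\<psi> \<in> borel_measurable borel"
    using t test_function_continuous[OF t] unfolding test_function_def by (auto intro: borel_measurable_continuous_onI)
  obtain c where c: "c \<ge> 0" "\<And>x. norm (G x) \<le> c" using test_function_gradient_bounded[OF t] by metis
  have G0: "w x *\<^sub>R G x = G x" for x
    using test_function_gradient_zero[OF t, of x] R(2) unfolding w_def by (cases "x \<in> closure {x. \<psi> x \<noteq> 0}") (auto simp: indicator_def)
  have Gi: "integrable lborel G"
  proof (rule Bochner_Integration.integrable_bound[where f = "\<lambda>x. c * w x"])
    show "AE x in lborel. norm (G x) \<le> norm (c * w x)"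
    proof (rule AE_I2)
      fix x
      have "norm (w x *\<^sub>R G x) \<le> norm (c * w x)" using c(1) mult_left_mono[OF c(2)[of x], of "\<bar>w x\<bar>"] by (simp add: mult.commute abs_mult)
      then show "norm (G x) \<le> norm (c * w x)" unfolding G0 .
    qed
  qed (use w in auto)
  have "(LBINT x. G x) \<bullet> e = 0" if e: "e \<in> Basis" for e
  proof -
    have const: "(LBINT x. w x * \<psi> (x - s *\<^sub>R e)) = (LBINT x. \<psi> x)" if s: "\<bar>s\<bar> < 1" for s
    proof -
      have "(LBINT x. w x * \<psi> (x - s *\<^sub>R e)) = (LBINT x. \<psi> (x - s *\<^sub>R e))"
      proof (rule Bochner_Integration.integral_cong[OF refl])
        fix x
        show "w x * \<psi> (x - s *\<^sub>R e) = \<psi> (x - s *\<^sub>R e)"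
        proof (cases "\<psi> (x - s *\<^sub>R e) = 0")
          case False
          then have "norm (x - s *\<^sub>R e) < R" using R(2) closure_subset[of "{x. \<psi> x \<noteq> 0}"] by auto
          then have "norm x < R + 1" using norm_triangle_sub[of x "s *\<^sub>R e"] s e by simp
          then show ?thesis unfolding w_def by simp
        qed simp
      qed
      also have "\<dots> = (LBINT x. \<psi> x)"
        using integral_lborel_translate[OF pm, of "- (s *\<^sub>R e)"] by simp
      finally show ?thesis .
    qed
    have "((\<lambda>s. LBINT x. \<psi> x) has_real_derivative - (LBINT x. w x * (G (x - 0 *\<^sub>R e) \<bullet> e))) (at 0)"
      by (rule has_field_derivative_transform_within_open[OF DERIV_integral_translated_test_function[OF w t], of "{-1<..<1}"])
        (use const in auto)
    then have "- (LBINT x. w x * (G (x - 0 *\<^sub>R e) \<bullet> e)) = 0" by (rule DERIV_unique) auto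
    then have "(LBINT x. (w x *\<^sub>R G x) \<bullet> e) = 0" by simp
    then show ?thesis unfolding G0 using Gi by simp
  qed
  then show ?thesis by (auto intro: euclidean_eqI)
qed

text \<open>
  The condition behind \<open>Sobolev_1_1\<close> on the whole space. Integrability with respect to
  Lebesgue-Borel measure makes both functions Borel measurable, as is required of densities.
\<close>

definition has_weak_gradient :: "('a::euclidean_space \<Rightarrow> real) \<Rightarrow> ('a \<Rightarrow> 'a) \<Rightarrow> bool" where
  "has_weak_gradient u g \<longleftrightarrow> integrable lborel u \<and> integrable lborel g \<and>
     (\<forall>\<psi> G. test_function UNIV \<psi> G \<longrightarrow> (LBINT x. u x *\<^sub>R G x) = - (LBINT x. \<psi> x *\<^sub>R g x))"

lemma has_weak_gradientD:
  assumes "has_weak_gradient u g"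
  shows "integrable lborel u" "integrable lborel g"
    "test_function UNIV \<psi> G \<Longrightarrow> (LBINT x. u x *\<^sub>R G x) = - (LBINT x. \<psi> x *\<^sub>R g x)"
  using assms unfolding has_weak_gradient_def by auto

text \<open>
  Tested against \<open>\<psi>\<close>, the difference quotient equals, by the mean value theorem, a translate of
  \<open>g \<bullet> e\<close> tested against \<open>\<psi>\<close>, with a shift that is at most \<open>h\<close> in the direction \<open>e\<close>. Its distance to \<open>g \<bullet> e\<close> is then
  controlled by continuity of translations, uniformly over test functions bounded by one, and duality
  yields the estimate in mean.
\<close>

lemma difference_quotient_L1:
  fixes u :: "'a::euclidean_space \<Rightarrow> real" and g :: "'a \<Rightarrow> 'a"
  assumes ug: "has_weak_gradient u g"
    and "0 < \<eta>"
  shows "\<exists>\<delta>>0. \<forall>h. 0 < h \<longrightarrow> h < \<delta> \<longrightarrow> (LBINT x. \<bar>(u (x + h *\<^sub>R e) - u x) / h - g x \<bullet> e\<bar>) \<le> \<eta>"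
proof -
  note u = has_weak_gradientD(1)[OF ug] and g = has_weak_gradientD(2)[OF ug]
    and parts = has_weak_gradientD(3)[OF ug]
  define k where "k x = g x \<bullet> e" for x
  have k: "integrable lborel k" unfolding k_def using g by auto
  have um[measurable]: "u \<in> borel_measurable borel" and gm[measurable]: "g \<in> borel_measurable borel"
    and km[measurable]: "k \<in> borel_measurable borel"
    using borel_measurable_integrable[OF u] borel_measurable_integrable[OF g] borel_measurable_integrable[OF k] by auto
  obtain \<delta> where d: "\<delta> > 0" "\<And>v. norm v < \<delta> \<Longrightarrow> (LBINT x. \<bar>k (x + v) - k x\<bar>) < \<eta>"
    using continuous_translation_L1[OF k assms(2)] by auto
  have main: "(LBINT x. \<bar>(u (x + h *\<^sub>R e) - u x) / h - k x\<bar>) \<le> \<eta>"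
    if h: "0 < h" "h < \<delta> / (norm e + 1)" for h
  proof (rule L1_norm_le_test_functions)
    have uh: "integrable lborel (\<lambda>x. u (x + h *\<^sub>R e))" using u by (simp add: integrable_lborel_translate)
    show "integrable lborel (\<lambda>x. (u (x + h *\<^sub>R e) - u x) / h - k x)" using u uh k by auto
    fix \<psi> :: "'a \<Rightarrow> real" and G assume t: "test_function UNIV \<psi> G" and b: "\<And>x. \<bar>\<psi> x\<bar> \<le> 1"
    have pm[measurable]: "\<psi> \<in> borel_measurable borel"
      by (rule borel_measurable_continuous_onI[OF test_function_continuous[OF t]])
    define J where "J s = (LBINT x. u x * \<psi> (x - s *\<^sub>R e))" for s
    have "(J has_real_derivative (LBINT x. \<psi> (x - s *\<^sub>R e) * k x)) (at s)" for s
    proof -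
      have t': "test_function UNIV (\<lambda>x. \<psi> (x - s *\<^sub>R e)) (\<lambda>x. G (x - s *\<^sub>R e))"
        by (rule test_function_translate[OF t])
      obtain c where c: "\<And>x. norm (G x) \<le> c" using test_function_gradient_bounded[OF t] by metis
      have Gm[measurable]: "G \<in> borel_measurable borel"
        using t unfolding test_function_def by (auto intro: borel_measurable_continuous_onI)
      have i1: "integrable lborel (\<lambda>x. u x *\<^sub>R G (x - s *\<^sub>R e))"
      proof (rule Bochner_Integration.integrable_bound[where f = "\<lambda>x. c * u x"])
        show "AE x in lborel. norm (u x *\<^sub>R G (x - s *\<^sub>R e)) \<le> norm (c * u x)"
        proof (rule AE_I2)
          fix x :: 'a
          have "\<bar>u x\<bar> * norm (G (x - s *\<^sub>R e)) \<le> \<bar>u x\<bar> * \<bar>c\<bar>"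
            using c[of "x - s *\<^sub>R e"] by (intro mult_left_mono) auto
          then show "norm (u x *\<^sub>R G (x - s *\<^sub>R e)) \<le> norm (c * u x)" by (simp add: abs_mult mult.commute)
        qed
      qed (use u in auto)
      have i2: "integrable lborel (\<lambda>x. \<psi> (x - s *\<^sub>R e) *\<^sub>R g x)"
      proof (rule Bochner_Integration.integrable_bound[OF g])
        show "AE x in lborel. norm (\<psi> (x - s *\<^sub>R e) *\<^sub>R g x) \<le> norm (g x)"
          using b by (auto intro!: mult_left_le_one_le)
      qed measurable
      have "(LBINT x. u x * (G (x - s *\<^sub>R e) \<bullet> e)) = (LBINT x. u x *\<^sub>R G (x - s *\<^sub>R e)) \<bullet> e"
        using i1 by (subst integral_inner_left[symmetric]) auto
      also have "\<dots> = - ((LBINT x. \<psi> (x - s *\<^sub>R e) *\<^sub>R g x) \<bullet> e)"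
        unfolding parts[OF t'] by simp
      also have "(LBINT x. \<psi> (x - s *\<^sub>R e) *\<^sub>R g x) \<bullet> e = (LBINT x. \<psi> (x - s *\<^sub>R e) * k x)"
        using i2 by (subst integral_inner_left[symmetric]) (auto simp: k_def)
      finally show ?thesis
        unfolding J_def using DERIV_integral_translated_test_function[OF u t, of e s] by simp
    qed
    then obtain z where z: "0 < z" "z < h" "J h - J 0 = (h - 0) * (LBINT x. \<psi> (x - z *\<^sub>R e) * k x)"
      using MVT2[of 0 h J "\<lambda>s. LBINT x. \<psi> (x - s *\<^sub>R e) * k x"] h by auto
    have Jz: "(LBINT x. \<psi> (x - z *\<^sub>R e) * k x) = (LBINT x. \<psi> x * k (x + z *\<^sub>R e))"
      using integral_lborel_translate[of "\<lambda>x. \<psi> (x - z *\<^sub>R e) * k x" "z *\<^sub>R e"] by simp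
    have Jh: "J h = (LBINT x. u (x + h *\<^sub>R e) * \<psi> x)"
      unfolding J_def using integral_lborel_translate[of "\<lambda>x. u x * \<psi> (x - h *\<^sub>R e)" "h *\<^sub>R e"] by simp
    have kz: "integrable lborel (\<lambda>x. k (x + z *\<^sub>R e))" using k by (simp add: integrable_lborel_translate)
    have i: "integrable lborel (\<lambda>x. u (x + h *\<^sub>R e) * \<psi> x)" "integrable lborel (\<lambda>x. u x * \<psi> x)" "integrable lborel (\<lambda>x. k x * \<psi> x)"
      "integrable lborel (\<lambda>x. k (x + z *\<^sub>R e) * \<psi> x)"
      by (rule integrable_mult_bounded[OF _ pm b]; fact)+
    have "(LBINT x. ((u (x + h *\<^sub>R e) - u x) / h - k x) * \<psi> x) =
        (LBINT x. (u (x + h *\<^sub>R e) * \<psi> x - u x * \<psi> x) / h - k x * \<psi> x)"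
      by (intro Bochner_Integration.integral_cong) (auto simp: algebra_simps diff_divide_distrib)
    also have "\<dots> = ((LBINT x. u (x + h *\<^sub>R e) * \<psi> x) - (LBINT x. u x * \<psi> x)) / h - (LBINT x. k x * \<psi> x)"
      using i by simp
    also have "\<dots> = (J h - J 0) / h - (LBINT x. k x * \<psi> x)" unfolding Jh by (simp add: J_def)
    also have "\<dots> = (LBINT x. k (x + z *\<^sub>R e) * \<psi> x) - (LBINT x. k x * \<psi> x)"
      unfolding z(3) Jz using h by (simp add: mult.commute)
    also have "\<dots> = (LBINT x. (k (x + z *\<^sub>R e) - k x) * \<psi> x)"
      using i by (simp add: left_diff_distrib)
    also have "\<dots> \<le> (LBINT x. \<bar>k (x + z *\<^sub>R e) - k x\<bar>)"
    proof (rule integral_mono)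
      show "integrable lborel (\<lambda>x. (k (x + z *\<^sub>R e) - k x) * \<psi> x)" using i by (simp add: left_diff_distrib)
      show "integrable lborel (\<lambda>x. \<bar>k (x + z *\<^sub>R e) - k x\<bar>)" using k kz by auto
      fix x
      have "(k (x + z *\<^sub>R e) - k x) * \<psi> x \<le> \<bar>k (x + z *\<^sub>R e) - k x\<bar> * \<bar>\<psi> x\<bar>"
        using abs_ge_self[of "(k (x + z *\<^sub>R e) - k x) * \<psi> x"] by (simp add: abs_mult)
      also have "\<dots> \<le> \<bar>k (x + z *\<^sub>R e) - k x\<bar>" using b[of x] by (intro mult_left_le) auto
      finally show "(k (x + z *\<^sub>R e) - k x) * \<psi> x \<le> \<bar>k (x + z *\<^sub>R e) - k x\<bar>" .
    qed
    also have "\<dots> \<le> \<eta>"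
    proof (rule less_imp_le, rule d(2))
      have "z * (norm e + 1) < \<delta>"
      proof -
        have "z * (norm e + 1) < h * (norm e + 1)" using z(2) by (intro mult_strict_right_mono) (auto simp: add_nonneg_pos)
        also have "\<dots> < \<delta>" using h(2) by (subst (asm) pos_less_divide_eq) (auto simp: add_nonneg_pos)
        finally show ?thesis .
      qed
      moreover have "z * norm e \<le> z * (norm e + 1)" using z(1) by simp
      ultimately have "z * norm e < \<delta>" by linarith
      then show "norm (z *\<^sub>R e) < \<delta>" using z(1) by simp
    qed
    finally show "(LBINT x. ((u (x + h *\<^sub>R e) - u x) / h - k x) * \<psi> x) \<le> \<eta>" .
  qed
  show ?thesis
    by (rule exI[of _ "\<delta> / (norm e + 1)"]) (use main d(1) in \<open>auto simp: k_def add_nonneg_pos\<close>)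
qed

section \<open>Chain rule and product rule for Sobolev functions\<close>

text \<open>
  The factor \<open>m\<close> is an explicit form of the difference quotient of \<open>sqrt (1 + s\<^sup>2)\<close>; it is continuous in
  both arguments and bounded by one, which is all that the chain rule uses.
\<close>

lemma sqrt_one_plus_square_diff:
  fixes a b :: real
  defines "m \<equiv> (a + b) / (sqrt (1 + a\<^sup>2) + sqrt (1 + b\<^sup>2))"
  shows "sqrt (1 + b\<^sup>2) - sqrt (1 + a\<^sup>2) = (b - a) * m" and "\<bar>m\<bar> \<le> 1"
proof -
  have p: "sqrt (1 + a\<^sup>2) > 0" "sqrt (1 + b\<^sup>2) > 0" by (auto intro: add_pos_nonneg)
  have "(sqrt (1 + b\<^sup>2) - sqrt (1 + a\<^sup>2)) * (sqrt (1 + a\<^sup>2) + sqrt (1 + b\<^sup>2)) = (sqrt (1 + b\<^sup>2))\<^sup>2 - (sqrt (1 + a\<^sup>2))\<^sup>2"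
    by (simp add: power2_eq_square algebra_simps)
  also have "\<dots> = (b - a) * (a + b)" by (simp add: power2_eq_square algebra_simps)
  finally show "sqrt (1 + b\<^sup>2) - sqrt (1 + a\<^sup>2) = (b - a) * m"
    unfolding m_def times_divide_eq_right by (rule eq_divide_imp[rotated]) (use p in linarith)
  have "\<bar>a\<bar> \<le> sqrt (1 + a\<^sup>2)" "\<bar>b\<bar> \<le> sqrt (1 + b\<^sup>2)" by (auto intro: real_le_rsqrt)
  then have "\<bar>a + b\<bar> \<le> sqrt (1 + a\<^sup>2) + sqrt (1 + b\<^sup>2)" by linarith
  moreover have "0 < sqrt (1 + a\<^sup>2) + sqrt (1 + b\<^sup>2)" using p by linarith
  ultimately show "\<bar>m\<bar> \<le> 1" unfolding m_def by (simp add: abs_divide divide_le_eq_1_pos)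
qed

lemma tendsto_zero_nonneg:
  fixes f :: "nat \<Rightarrow> real"
  assumes "\<And>n. 0 \<le> f n" "\<And>\<eta>. 0 < \<eta> \<Longrightarrow> eventually (\<lambda>n. f n < \<eta>) sequentially"
  shows "f \<longlonglongrightarrow> 0"
  using assms by (intro order_tendstoI) (auto intro!: always_eventually intro: less_le_trans)

text \<open>
  The difference quotients of \<open>F(u)\<close>, with \<open>F(s) = sqrt (1 + s\<^sup>2) - 1\<close>, are \<open>q \<cdot> \<mu>\<close>, where \<open>q\<close> is the difference
  quotient of \<open>u\<close> and \<open>\<bar>\<mu>\<bar> \<le> 1\<close>. In the limit \<open>q\<close> converges in mean and \<open>\<mu>\<close> converges almost everywhere along a
  subsequence. Subtracting \<open>1\<close> makes \<open>F(u)\<close> integrable.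
\<close>

lemma chain_rule_sqrt_directional:
  fixes u :: "'a::euclidean_space \<Rightarrow> real" and g :: "'a \<Rightarrow> 'a"
  assumes ug: "has_weak_gradient u g" and t: "test_function UNIV \<psi> G"
  shows "(LBINT x. (sqrt (1 + (u x)\<^sup>2) - 1) * (G x \<bullet> e)) =
    - (LBINT x. \<psi> x * (u x / sqrt (1 + (u x)\<^sup>2) * (g x \<bullet> e)))"
proof -
  note u = has_weak_gradientD(1)[OF ug] and g = has_weak_gradientD(2)[OF ug]
  define F where "F a = sqrt (1 + a\<^sup>2) - 1" for a :: real
  define m where "m a b = (a + b) / (sqrt (1 + a\<^sup>2) + sqrt (1 + b\<^sup>2))" for a b :: real
  have Fm: "F b - F a = (b - a) * m a b" and m1: "\<bar>m a b\<bar> \<le> 1" for a b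
    unfolding F_def m_def using sqrt_one_plus_square_diff[where a = a and b = b] by auto
  have maa: "m a a = a / sqrt (1 + a\<^sup>2)" for a
    unfolding m_def by (simp add: field_simps)
  define k where "k x = g x \<bullet> e" for x
  have k: "integrable lborel k" unfolding k_def using g by auto
  have [measurable]: "u \<in> borel_measurable borel" "g \<in> borel_measurable borel" "k \<in> borel_measurable borel"
    using borel_measurable_integrable[OF u] borel_measurable_integrable[OF g] borel_measurable_integrable[OF k] by auto
  have pm[measurable]: "\<psi> \<in> borel_measurable borel"
    by (rule borel_measurable_continuous_onI[OF test_function_continuous[OF t]])
  obtain c where c: "c \<ge> 0" "\<And>x. \<bar>\<psi> x\<bar> \<le> c" using test_function_bounded[OF t] by metis
  define Fu where "Fu x = F (u x)" for x
  have Fum[measurable]: "Fu \<in> borel_measurable borel" unfolding Fu_def F_def by measurable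
  have Fu: "integrable lborel Fu"
  proof (rule Bochner_Integration.integrable_bound[OF u])
    show "AE x in lborel. norm (Fu x) \<le> norm (u x)"
    proof (rule AE_I2)
      fix x :: 'a
      have "\<bar>F (u x) - F 0\<bar> = \<bar>u x\<bar> * \<bar>m 0 (u x)\<bar>" unfolding Fm by (simp add: abs_mult)
      also have "\<dots> \<le> \<bar>u x\<bar>" using m1 by (intro mult_left_le) auto
      finally show "norm (Fu x) \<le> norm (u x)" unfolding Fu_def by (simp add: F_def)
    qed
  qed measurable
  define h where "h n = 1 / (real n + 1)" for n :: nat
  have hpos: "h n > 0" for n unfolding h_def by auto
  have hlim: "h \<longlonglongrightarrow> 0" unfolding h_def by real_asymp
  define q where "q n x = (u (x + h n *\<^sub>R e) - u x) / h n" for n x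
  define \<mu> where "\<mu> n x = m (u x) (u (x + h n *\<^sub>R e))" for n x
  have mum[measurable]: "\<mu> n \<in> borel_measurable borel" for n unfolding \<mu>_def m_def by measurable
  have qm[measurable]: "q n \<in> borel_measurable borel" for n unfolding q_def by measurable
  have uh: "integrable lborel (\<lambda>x. u (x + v))" for v using u by (simp add: integrable_lborel_translate)
  have qi: "integrable lborel (q n)" for n unfolding q_def using u uh by auto
  have ev: "eventually (\<lambda>n. norm (h n *\<^sub>R e) < \<delta>) sequentially" if "\<delta> > 0" for \<delta>
  proof -
    have "(\<lambda>n. norm (h n *\<^sub>R e)) \<longlonglongrightarrow> norm (0 *\<^sub>R e)"
      by (intro tendsto_norm tendsto_scaleR hlim tendsto_const)
    then show ?thesis using that by (auto dest!: order_tendstoD(2)[of _ _ _ \<delta>])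
  qed
  have qlim: "(\<lambda>n. LBINT x. \<bar>q n x - k x\<bar>) \<longlonglongrightarrow> 0"
  proof (rule tendsto_zero_nonneg)
    fix \<eta> :: real assume "0 < \<eta>"
    then obtain \<delta> where d: "\<delta> > 0" "\<And>s. 0 < s \<Longrightarrow> s < \<delta> \<Longrightarrow> (LBINT x. \<bar>(u (x + s *\<^sub>R e) - u x) / s - g x \<bullet> e\<bar>) \<le> \<eta> / 2"
      using difference_quotient_L1[OF ug, of "\<eta> / 2" e] by auto
    have "eventually (\<lambda>n. h n < \<delta>) sequentially" by (rule order_tendstoD(2)[OF hlim d(1)])
    then show "eventually (\<lambda>n. (LBINT x. \<bar>q n x - k x\<bar>) < \<eta>) sequentially"
    proof eventually_elim
      case (elim n)
      then show ?case using d(2)[OF hpos[of n]] \<open>0 < \<eta>\<close> unfolding q_def k_def by fastforce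
    qed
  qed simp
  have ulim: "(\<lambda>n. LBINT x. norm (u (x + h n *\<^sub>R e) - u x)) \<longlonglongrightarrow> 0"
  proof (rule tendsto_zero_nonneg)
    fix \<eta> :: real assume "0 < \<eta>"
    then obtain \<delta> where d: "\<delta> > 0" "\<And>v. norm v < \<delta> \<Longrightarrow> (LBINT x. \<bar>u (x + v) - u x\<bar>) < \<eta>"
      using continuous_translation_L1[OF u] by auto
    show "eventually (\<lambda>n. (LBINT x. norm (u (x + h n *\<^sub>R e) - u x)) < \<eta>) sequentially"
      using ev[OF d(1)] by eventually_elim (use d(2) in auto)
  qed simp
  \<comment> \<open>Convergence in mean gives convergence almost everywhere only along a subsequence, which is enough because the limit is already known to exist.\<close>
  obtain r where r: "strict_mono r" "AE x in lborel. (\<lambda>n. u (x + h (r n) *\<^sub>R e) - u x) \<longlonglongrightarrow> 0"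
    using tendsto_L1_AE_subseq[OF _ ulim] u uh by auto
  have mubound: "\<bar>\<psi> x * \<mu> n x\<bar> \<le> c" for x n
  proof -
    have "\<bar>\<psi> x\<bar> * \<bar>\<mu> n x\<bar> \<le> \<bar>\<psi> x\<bar>" unfolding \<mu>_def using m1 by (intro mult_left_le) auto
    then show ?thesis using c(2)[of x] by (simp add: abs_mult)
  qed
  have i: "integrable lborel (\<lambda>x. w x * (\<psi> x * \<mu> n x))" if "integrable lborel w" for w n
    by (rule integrable_mult_bounded[OF that _ mubound]) measurable
  define Q where "Q n = (LBINT x. q n x * (\<psi> x * \<mu> n x))" for n
  have Q1: "Q \<longlonglongrightarrow> - (LBINT x. Fu x * (G x \<bullet> e))"
  proof -
    have D: "((\<lambda>s. LBINT x. Fu x * \<psi> (x - s *\<^sub>R e)) has_real_derivative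
        - (LBINT x. Fu x * (G (x - 0 *\<^sub>R e) \<bullet> e))) (at 0)"
      by (rule DERIV_integral_translated_test_function[OF Fu t])
    have "((LBINT x. Fu x * \<psi> (x - (0 + h n) *\<^sub>R e)) - (LBINT x. Fu x * \<psi> (x - 0 *\<^sub>R e))) / h n = Q n" for n
    proof -
      have tr: "(LBINT x. Fu x * \<psi> (x - (0 + h n) *\<^sub>R e)) = (LBINT x. Fu (x + h n *\<^sub>R e) * \<psi> x)"
        using integral_lborel_translate[of "\<lambda>x. Fu x * \<psi> (x - h n *\<^sub>R e)" "h n *\<^sub>R e"] by simp
      have Fuh: "integrable lborel (\<lambda>x. Fu (x + h n *\<^sub>R e))" using Fu by (simp add: integrable_lborel_translate)
      have "(LBINT x. Fu (x + h n *\<^sub>R e) * \<psi> x) - (LBINT x. Fu x * \<psi> x) =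
          (LBINT x. Fu (x + h n *\<^sub>R e) * \<psi> x - Fu x * \<psi> x)"
        by (rule Bochner_Integration.integral_diff[symmetric]) (rule integrable_mult_bounded[OF _ pm c(2)], fact)+
      also have "\<dots> = (LBINT x. h n * (q n x * (\<psi> x * \<mu> n x)))"
      proof (rule Bochner_Integration.integral_cong[OF refl])
        fix x
        have d: "Fu (x + h n *\<^sub>R e) - Fu x = (h n * q n x) * \<mu> n x"
          unfolding Fu_def Fm \<mu>_def q_def using hpos[of n] by simp
        show "Fu (x + h n *\<^sub>R e) * \<psi> x - Fu x * \<psi> x = h n * (q n x * (\<psi> x * \<mu> n x))"
          unfolding left_diff_distrib[symmetric] d by (simp only: mult_ac)
      qed
      finally show ?thesis unfolding tr Q_def using hpos[of n] by simp
    qed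
    moreover have "(\<lambda>n. ((LBINT x. Fu x * \<psi> (x - (0 + h n) *\<^sub>R e)) - (LBINT x. Fu x * \<psi> (x - 0 *\<^sub>R e))) / h n)
      \<longlonglongrightarrow> - (LBINT x. Fu x * (G (x - 0 *\<^sub>R e) \<bullet> e))"
    proof -
      have "\<forall>n. h n \<in> UNIV - {0}" by (auto simp: h_def)
      from D[unfolded DERIV_def tendsto_at_iff_sequentially, THEN spec, THEN mp, OF this, THEN mp, OF hlim]
      show ?thesis by (simp only: comp_def)
    qed
    ultimately show ?thesis by simp
  qed
  have Q2: "(\<lambda>n. Q (r n)) \<longlonglongrightarrow> (LBINT x. \<psi> x * (u x / sqrt (1 + (u x)\<^sup>2) * k x))"
  proof -
    have A: "(\<lambda>n. LBINT x. k x * (\<psi> x * \<mu> (r n) x)) \<longlonglongrightarrow> (LBINT x. k x * (\<psi> x * m (u x) (u x)))"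
    proof (rule integral_dominated_convergence[where w = "\<lambda>x. \<bar>k x\<bar> * c"])
      show "(\<lambda>x. k x * (\<psi> x * m (u x) (u x))) \<in> borel_measurable lborel" unfolding m_def by measurable
      show "integrable lborel (\<lambda>x. \<bar>k x\<bar> * c)" using k by auto
      show "AE x in lborel. (\<lambda>n. k x * (\<psi> x * \<mu> (r n) x)) \<longlonglongrightarrow> k x * (\<psi> x * m (u x) (u x))"
        using r(2)
      proof eventually_elim
        case (elim x)
        have "(\<lambda>n. u (x + h (r n) *\<^sub>R e)) \<longlonglongrightarrow> u x" using LIM_zero_cancel[OF elim] .
        moreover have "sqrt (1 + (u x)\<^sup>2) + sqrt (1 + (u x)\<^sup>2) \<noteq> 0"
          by (smt (verit) real_sqrt_ge_1_iff zero_le_power2)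
        ultimately show ?case unfolding \<mu>_def m_def by (intro tendsto_intros)
      qed
      show "AE x in lborel. norm (k x * (\<psi> x * \<mu> (r n) x)) \<le> \<bar>k x\<bar> * c" for n
        using mubound by (auto simp: abs_mult[of "k _"] simp del: abs_mult intro!: mult_left_mono)
    qed measurable
    have B: "(\<lambda>n. Q (r n) - (LBINT x. k x * (\<psi> x * \<mu> (r n) x))) \<longlonglongrightarrow> 0"
    proof (rule Lim_null_comparison)
      show "(\<lambda>n. c * (LBINT x. \<bar>q (r n) x - k x\<bar>)) \<longlonglongrightarrow> 0"
        using tendsto_mult_right_zero[OF LIMSEQ_subseq_LIMSEQ[OF qlim r(1), unfolded comp_def], of c] .
      have "norm (Q n - (LBINT x. k x * (\<psi> x * \<mu> n x))) \<le> c * (LBINT x. \<bar>q n x - k x\<bar>)" for n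
      proof -
        have "Q n - (LBINT x. k x * (\<psi> x * \<mu> n x)) = (LBINT x. (q n x - k x) * (\<psi> x * \<mu> n x))"
          unfolding Q_def left_diff_distrib
          by (rule Bochner_Integration.integral_diff[symmetric]) (rule i, fact)+
        also have "norm \<dots> \<le> (LBINT x. norm ((q n x - k x) * (\<psi> x * \<mu> n x)))"
          by (rule integral_norm_bound)
        also have "\<dots> \<le> (LBINT x. c * \<bar>q n x - k x\<bar>)"
        proof (rule integral_mono)
          show "integrable lborel (\<lambda>x. norm ((q n x - k x) * (\<psi> x * \<mu> n x)))"
            by (rule integrable_norm, rule i) (use qi k in auto)
          show "integrable lborel (\<lambda>x. c * \<bar>q n x - k x\<bar>)" using qi k by auto
          fix x
          have "\<bar>q n x - k x\<bar> * \<bar>\<psi> x * \<mu> n x\<bar> \<le> \<bar>q n x - k x\<bar> * c"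
            by (intro mult_left_mono mubound) auto
          then show "norm ((q n x - k x) * (\<psi> x * \<mu> n x)) \<le> c * \<bar>q n x - k x\<bar>"
            by (simp only: real_norm_def abs_mult mult.commute)
        qed
        finally show ?thesis by simp
      qed
      then show "\<forall>\<^sub>F n in sequentially. norm (Q (r n) - (LBINT x. k x * (\<psi> x * \<mu> (r n) x))) \<le> c * (LBINT x. \<bar>q (r n) x - k x\<bar>)"
        by (intro always_eventually allI)
    qed
    have "(LBINT x. k x * (\<psi> x * m (u x) (u x))) = (LBINT x. \<psi> x * (u x / sqrt (1 + (u x)\<^sup>2) * k x))"
      unfolding maa by (intro Bochner_Integration.integral_cong) (auto simp: mult_ac)
    with tendsto_add[OF B A] show ?thesis by simp
  qed
  have "- (LBINT x. Fu x * (G x \<bullet> e)) = (LBINT x. \<psi> x * (u x / sqrt (1 + (u x)\<^sup>2) * k x))"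
    by (rule LIMSEQ_unique[OF LIMSEQ_subseq_LIMSEQ[OF Q1 r(1), unfolded comp_def] Q2])
  then show ?thesis unfolding Fu_def F_def k_def by simp
qed

lemma completion_ex_borel_measurable_euclidean:
  fixes f :: "'a \<Rightarrow> 'b::euclidean_space"
  assumes "f \<in> borel_measurable (completion M)"
  shows "\<exists>f'\<in>borel_measurable M. AE x in M. f x = f' x"
proof -
  have "\<exists>h\<in>borel_measurable M. AE x in M. f x \<bullet> i = h x" for i
    by (rule completion_ex_borel_measurable_real) (use assms in measurable)
  then obtain h where h: "\<And>i. h i \<in> borel_measurable M" "\<And>i. AE x in M. f x \<bullet> i = h i x" by metis
  define f' where "f' x = (\<Sum>i\<in>Basis. h i x *\<^sub>R i)" for x
  have "f' \<in> borel_measurable M" unfolding f'_def using h(1) by measurable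
  moreover have "AE x in M. \<forall>i\<in>Basis. f x \<bullet> i = h i x" by (rule AE_finite_allI) (auto simp: h)
  then have "AE x in M. f x = f' x"
  proof eventually_elim
    case (elim x)
    have "f' x = (\<Sum>i\<in>Basis. (f x \<bullet> i) *\<^sub>R i)" unfolding f'_def by (intro sum.cong) (use elim in auto)
    then show ?case by (simp only: euclidean_representation)
  qed
  ultimately show ?thesis by blast
qed

text \<open>
  Polar densities are Borel functions, but functions of bounded variation are only Lebesgue measurable;
  this lemma moves between the two integrals.
\<close>

lemma integral_lebesgue_eq_lborel:
  fixes f f' :: "'a::euclidean_space \<Rightarrow> 'b::{banach, second_countable_topology}"
  assumes "f \<in> borel_measurable lebesgue" "f' \<in> borel_measurable borel" "AE x in lborel. f x = f' x"
  shows "integral\<^sup>L lebesgue f = integral\<^sup>L lborel f'" "integrable lebesgue f \<longleftrightarrow> integrable lborel f'"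
proof -
  have f': "f' \<in> borel_measurable lborel" using assms(2) by simp
  have f'': "f' \<in> borel_measurable lebesgue" using measurable_completion[OF f'] .
  have ae: "AE x in lebesgue. f x = f' x" using AE_completion[OF assms(3)] .
  show "integral\<^sup>L lebesgue f = integral\<^sup>L lborel f'"
    using integral_cong_AE[OF assms(1) f'' ae] integral_completion[OF f'] by simp
  show "integrable lebesgue f \<longleftrightarrow> integrable lborel f'"
    using integrable_cong_AE[OF assms(1) f'' ae] integrable_completion[OF f'] by simp
qed

lemma integrable_bounded_scaleR:
  fixes f :: "'a::euclidean_space \<Rightarrow> 'b::{banach, second_countable_topology}" and a :: "'a \<Rightarrow> real"
  assumes f: "integrable lborel f" and [measurable]: "a \<in> borel_measurable borel" and "\<And>x. \<bar>a x\<bar> \<le> c"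
  shows "integrable lborel (\<lambda>x. a x *\<^sub>R f x)"
proof (rule Bochner_Integration.integrable_bound[where f = "\<lambda>x. c *\<^sub>R f x"])
  have [measurable]: "f \<in> borel_measurable borel" using borel_measurable_integrable[OF f] by simp
  show "(\<lambda>x. a x *\<^sub>R f x) \<in> borel_measurable lborel" by measurable
  show "AE x in lborel. norm (a x *\<^sub>R f x) \<le> norm (c *\<^sub>R f x)"
  proof (rule AE_I2)
    fix x
    have "\<bar>a x\<bar> \<le> \<bar>c\<bar>" using assms(3)[of x] by linarith
    then show "norm (a x *\<^sub>R f x) \<le> norm (c *\<^sub>R f x)" by (simp add: mult_right_mono)
  qed
qed (use f in auto)

lemma integrable_scaleR_bounded:
  fixes G :: "'a::euclidean_space \<Rightarrow> 'b::{banach, second_countable_topology}" and u :: "'a \<Rightarrow> real"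
  assumes u: "integrable lborel u" and [measurable]: "G \<in> borel_measurable borel" and "\<And>x. norm (G x) \<le> c"
  shows "integrable lborel (\<lambda>x. u x *\<^sub>R G x)"
proof (rule Bochner_Integration.integrable_bound[where f = "\<lambda>x. c * u x"])
  have [measurable]: "u \<in> borel_measurable borel" using borel_measurable_integrable[OF u] by simp
  show "(\<lambda>x. u x *\<^sub>R G x) \<in> borel_measurable lborel" by measurable
  show "AE x in lborel. norm (u x *\<^sub>R G x) \<le> norm (c * u x)"
  proof (rule AE_I2)
    fix x
    have "norm (G x) \<le> \<bar>c\<bar>" using assms(3)[of x] by linarith
    then have "\<bar>u x\<bar> * norm (G x) \<le> \<bar>u x\<bar> * \<bar>c\<bar>" by (intro mult_left_mono) auto
    then show "norm (u x *\<^sub>R G x) \<le> norm (c * u x)" by (simp add: abs_mult mult.commute)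
  qed
qed (use u in auto)

lemma test_function_borel:
  assumes "test_function U \<psi> G"
  shows "\<psi> \<in> borel_measurable borel" "G \<in> borel_measurable borel"
  using assms test_function_continuous[OF assms] unfolding test_function_def
  by (auto intro: borel_measurable_continuous_onI)

lemma test_function_zero_outside:
  assumes "test_function U \<psi> G" "x \<notin> U"
  shows "\<psi> x = 0" "G x = 0"
  using assms closure_subset[of "{x. \<psi> x \<noteq> 0}"] test_function_gradient_zero[OF assms(1), of x]
  unfolding test_function_def compactly_contained_def by auto

lemma test_function_gradient_integrable:
  assumes t: "test_function U \<psi> G"
  shows "integrable lborel G"
proof -
  obtain c where c: "\<And>x. norm (G x) \<le> c" using test_function_gradient_bounded[OF t] by metis
  note [measurable] = test_function_borel[OF t]
  have "integrable lborel (\<lambda>x. indicat_real (closure {x. \<psi> x \<noteq> 0}) x *\<^sub>R G x)"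
  proof (rule integrable_scaleR_bounded[OF _ _ c])
    have "compact (closure {x. \<psi> x \<noteq> 0})" using t unfolding test_function_def compactly_contained_def by auto
    then show "integrable lborel (indicat_real (closure {x. \<psi> x \<noteq> 0}))"
      using emeasure_compact_finite[of "closure {x. \<psi> x \<noteq> 0}"]
      by (intro integrable_real_indicator) auto
  qed measurable
  moreover have "indicat_real (closure {x. \<psi> x \<noteq> 0}) x *\<^sub>R G x = G x" for x
    using test_function_gradient_zero[OF t, of x] by (auto simp: indicator_def)
  ultimately show ?thesis by simp
qed

lemma Sobolev_1_1_borel_representative:
  fixes u\<^sub>0 :: "'a::euclidean_space \<Rightarrow> real"
  assumes "u\<^sub>0 \<in> Sobolev_1_1 UNIV"
  obtains u g where "has_weak_gradient u g" "u\<^sub>0 \<in> borel_measurable lebesgue" "AE x in lborel. u\<^sub>0 x = u x"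
proof -
  obtain g0 where g0: "integrable lebesgue g0" and u0: "integrable lebesgue u\<^sub>0"
    and parts: "\<And>\<psi> G. test_function UNIV \<psi> G \<Longrightarrow>
           (LINT x|lebesgue. u\<^sub>0 x *\<^sub>R G x) = - (LINT x|lebesgue. \<psi> x *\<^sub>R g0 x)"
    using assms unfolding Sobolev_1_1_def set_integrable_def set_lebesgue_integral_def by auto
  have mu0: "u\<^sub>0 \<in> borel_measurable lebesgue" and mg0: "g0 \<in> borel_measurable lebesgue" using u0 g0 by auto
  obtain u where u: "u \<in> borel_measurable borel" "AE x in lborel. u\<^sub>0 x = u x"
    using completion_ex_borel_measurable_real[OF mu0] by auto
  obtain g where g: "g \<in> borel_measurable borel" "AE x in lborel. g0 x = g x"
    using completion_ex_borel_measurable_euclidean[OF mg0] by auto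
  have ui: "integrable lborel u" using integral_lebesgue_eq_lborel(2)[OF mu0 u] u0 by simp
  have gi: "integrable lborel g" using integral_lebesgue_eq_lborel(2)[OF mg0 g] g0 by simp
  have "has_weak_gradient u g"
    unfolding has_weak_gradient_def
  proof (intro conjI allI impI ui gi)
    fix \<psi> :: "'a \<Rightarrow> real" and G assume t: "test_function UNIV \<psi> G"
    have m: "\<psi> \<in> borel_measurable lebesgue" "G \<in> borel_measurable lebesgue"
      using test_function_borel[OF t] by (auto intro!: measurable_completion)
    have "(LBINT x. u x *\<^sub>R G x) = (LINT x|lebesgue. u\<^sub>0 x *\<^sub>R G x)"
      by (rule integral_lebesgue_eq_lborel(1)[symmetric])
        (use mu0 m u test_function_borel[OF t] in \<open>auto intro!: borel_measurable_scaleR\<close>)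
    also have "(LINT x|lebesgue. \<psi> x *\<^sub>R g0 x) = (LBINT x. \<psi> x *\<^sub>R g x)"
      by (rule integral_lebesgue_eq_lborel(1))
        (use mg0 m g test_function_borel[OF t] in \<open>auto intro!: borel_measurable_scaleR\<close>)
    then have "(LINT x|lebesgue. u\<^sub>0 x *\<^sub>R G x) = - (LBINT x. \<psi> x *\<^sub>R g x)" using parts[OF t] by simp
    finally show "(LBINT x. u x *\<^sub>R G x) = - (LBINT x. \<psi> x *\<^sub>R g x)" .
  qed
  then show ?thesis using mu0 u(2) by (rule that)
qed

lemma sqrt_one_plus_square_bounds:
  fixes a :: real
  shows "1 \<le> sqrt (1 + a\<^sup>2)" "sqrt (1 + a\<^sup>2) \<le> 1 + \<bar>a\<bar>" "\<bar>a / sqrt (1 + a\<^sup>2)\<bar> \<le> 1"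
    "\<bar>a\<bar> \<le> sqrt (1 + a\<^sup>2)"
proof -
  show 1: "1 \<le> sqrt (1 + a\<^sup>2)" by simp
  show "sqrt (1 + a\<^sup>2) \<le> 1 + \<bar>a\<bar>" by (rule real_le_lsqrt) (auto simp: power2_eq_square algebra_simps)
  show 2: "\<bar>a\<bar> \<le> sqrt (1 + a\<^sup>2)" by (rule real_le_rsqrt) auto
  have "0 < sqrt (1 + a\<^sup>2)" using 1 by linarith
  then show "\<bar>a / sqrt (1 + a\<^sup>2)\<bar> \<le> 1" using 2 by (simp add: abs_divide divide_le_eq_1_pos)
qed

text \<open>
  The directional version for \<open>sqrt (1 + u\<^sup>2) - 1\<close>, in all directions at once; the missing constant
  contributes the integral of a gradient, which is zero.
\<close>

lemma chain_rule_sqrt: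
  fixes u :: "'a::euclidean_space \<Rightarrow> real" and g :: "'a \<Rightarrow> 'a"
  assumes ug: "has_weak_gradient u g" and t: "test_function UNIV \<psi> G"
  shows "(LBINT x. sqrt (1 + (u x)\<^sup>2) *\<^sub>R G x) = - (LBINT x. \<psi> x *\<^sub>R (u x / sqrt (1 + (u x)\<^sup>2)) *\<^sub>R g x)"
proof -
  note u = has_weak_gradientD(1)[OF ug] and g = has_weak_gradientD(2)[OF ug]
  have [measurable]: "u \<in> borel_measurable borel" "g \<in> borel_measurable borel"
    using borel_measurable_integrable[OF u] borel_measurable_integrable[OF g] by auto
  note [measurable] = test_function_borel[OF t]
  obtain b where b: "\<And>x. \<bar>\<psi> x\<bar> \<le> b" using test_function_bounded[OF t] by metis
  obtain c where c: "\<And>x. norm (G x) \<le> c" using test_function_gradient_bounded[OF t] by metis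
  let ?F = "\<lambda>x. sqrt (1 + (u x)\<^sup>2) - 1"
  have F: "integrable lborel ?F"
  proof (rule Bochner_Integration.integrable_bound[OF u])
    show "AE x in lborel. norm (?F x) \<le> norm (u x)"
      using sqrt_one_plus_square_bounds(1,2)[of "u _"] by (auto simp: abs_le_iff algebra_simps)
  qed measurable
  note ratio = sqrt_one_plus_square_bounds(3)
  have i1: "integrable lborel (\<lambda>x. ?F x *\<^sub>R G x)" by (rule integrable_scaleR_bounded[OF F _ c]) measurable
  have i2: "integrable lborel G" by (rule test_function_gradient_integrable[OF t])
  have i3: "integrable lborel (\<lambda>x. \<psi> x *\<^sub>R (u x / sqrt (1 + (u x)\<^sup>2)) *\<^sub>R g x)"
    by (rule integrable_bounded_scaleR[OF integrable_bounded_scaleR[OF g _ ratio] _ b]) measurable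
  have "(LBINT x. ?F x *\<^sub>R G x) = - (LBINT x. \<psi> x *\<^sub>R (u x / sqrt (1 + (u x)\<^sup>2)) *\<^sub>R g x)"
  proof (rule euclidean_eqI)
    fix e :: 'a
    have "(LBINT x. ?F x *\<^sub>R G x) \<bullet> e = (LBINT x. ?F x * (G x \<bullet> e))"
      using i1 by (subst integral_inner_left[symmetric]) auto
    also have "\<dots> = - (LBINT x. \<psi> x * (u x / sqrt (1 + (u x)\<^sup>2) * (g x \<bullet> e)))"
      by (rule chain_rule_sqrt_directional[OF ug t])
    also have "(LBINT x. \<psi> x * (u x / sqrt (1 + (u x)\<^sup>2) * (g x \<bullet> e))) =
        (LBINT x. (\<psi> x *\<^sub>R (u x / sqrt (1 + (u x)\<^sup>2)) *\<^sub>R g x) \<bullet> e)" by (simp add: mult.assoc)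
    also have "\<dots> = (LBINT x. \<psi> x *\<^sub>R (u x / sqrt (1 + (u x)\<^sup>2)) *\<^sub>R g x) \<bullet> e"
      by (rule integral_inner_left) (rule i3)
    finally show "(LBINT x. ?F x *\<^sub>R G x) \<bullet> e = (- (LBINT x. \<psi> x *\<^sub>R (u x / sqrt (1 + (u x)\<^sup>2)) *\<^sub>R g x)) \<bullet> e"
      by simp
  qed
  moreover have "(LBINT x. sqrt (1 + (u x)\<^sup>2) *\<^sub>R G x) = (LBINT x. ?F x *\<^sub>R G x + G x)"
    by (intro Bochner_Integration.integral_cong) (auto simp: scaleR_left_diff_distrib)
  ultimately show ?thesis using i1 i2 integral_gradient_zero[OF t] by simp
qed

lemma cutoff_integrable:
  fixes u :: "'a::euclidean_space \<Rightarrow> real" and g :: "'a \<Rightarrow> 'b::{banach, second_countable_topology}"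
  assumes u: "integrable lborel u" and g: "integrable lborel g" and eta: "test_function V \<eta> X"
  shows "integrable lborel (\<lambda>x. (1 - \<eta> x) * u x)" "integrable lborel (\<lambda>x. (1 - \<eta> x) *\<^sub>R g x)"
    "integrable lborel (\<lambda>x. u x *\<^sub>R X x)"
proof -
  note [measurable] = test_function_borel[OF eta]
  obtain d where d: "\<And>x. \<bar>\<eta> x\<bar> \<le> d" using test_function_bounded[OF eta] by metis
  obtain k where k: "\<And>x. norm (X x) \<le> k" using test_function_gradient_bounded[OF eta] by metis
  have d': "\<bar>1 - \<eta> x\<bar> \<le> 1 + d" for x using d[of x] by linarith
  show "integrable lborel (\<lambda>x. (1 - \<eta> x) * u x)"
    using integrable_bounded_scaleR[OF u _ d'] by simp
  show "integrable lborel (\<lambda>x. (1 - \<eta> x) *\<^sub>R g x)"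
    by (rule integrable_bounded_scaleR[OF g _ d']) measurable
  show "integrable lborel (\<lambda>x. u x *\<^sub>R X x)" by (rule integrable_scaleR_bounded[OF u _ k]) measurable
qed

text \<open>
  The product \<open>(1 - \<eta>) \<psi>\<close> is again a test function.
\<close>

lemma product_rule_cutoff:
  fixes u :: "'a::euclidean_space \<Rightarrow> real" and g :: "'a \<Rightarrow> 'a"
  assumes ug: "has_weak_gradient u g" and eta: "test_function V \<eta> X" and t: "test_function UNIV \<psi> G"
  shows "(LBINT x. ((1 - \<eta> x) * u x) *\<^sub>R G x) = - (LBINT x. \<psi> x *\<^sub>R ((1 - \<eta> x) *\<^sub>R g x - u x *\<^sub>R X x))"
proof -
  note u = has_weak_gradientD(1)[OF ug] and g = has_weak_gradientD(2)[OF ug]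
  note [measurable] = test_function_borel[OF t]
  obtain b where b: "\<And>x. \<bar>\<psi> x\<bar> \<le> b" using test_function_bounded[OF t] by metis
  obtain c where c: "\<And>x. norm (G x) \<le> c" using test_function_gradient_bounded[OF t] by metis
  note i1 = cutoff_integrable(1)[OF u g eta] and i2 = cutoff_integrable(2)[OF u g eta]
    and i3 = cutoff_integrable(3)[OF u g eta]
  have i4: "integrable lborel (\<lambda>x. ((1 - \<eta> x) * u x) *\<^sub>R G x)" by (rule integrable_scaleR_bounded[OF i1 _ c]) measurable
  have i5: "integrable lborel (\<lambda>x. \<psi> x *\<^sub>R (u x *\<^sub>R X x))" by (rule integrable_bounded_scaleR[OF i3 _ b]) measurable
  have i6: "integrable lborel (\<lambda>x. \<psi> x *\<^sub>R ((1 - \<eta> x) *\<^sub>R g x))" by (rule integrable_bounded_scaleR[OF i2 _ b]) measurable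
  have "has_continuous_gradient (\<lambda>x. (1 - \<eta> x) * \<psi> x) (\<lambda>x. (1 - \<eta> x) *\<^sub>R G x + \<psi> x *\<^sub>R (0 - X x))"
    by (intro has_continuous_gradient_mult has_continuous_gradient_diff has_continuous_gradient_const
        test_function_gradient[OF t] test_function_gradient[OF eta])
  moreover have "compact (closure {x. (1 - \<eta> x) * \<psi> x \<noteq> 0})"
  proof -
    have "bounded {x. \<psi> x \<noteq> 0}"
      using t unfolding test_function_def compactly_contained_def by (auto dest: compact_imp_bounded)
    then have "bounded {x. (1 - \<eta> x) * \<psi> x \<noteq> 0}" by (rule bounded_subset) auto
    then show ?thesis by simp
  qed
  ultimately have "test_function UNIV (\<lambda>x. (1 - \<eta> x) * \<psi> x) (\<lambda>x. (1 - \<eta> x) *\<^sub>R G x + \<psi> x *\<^sub>R (0 - X x))"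
    unfolding test_function_def has_continuous_gradient_def compactly_contained_def by auto
  from has_weak_gradientD(3)[OF ug this] have "(LBINT x. u x *\<^sub>R ((1 - \<eta> x) *\<^sub>R G x + \<psi> x *\<^sub>R (0 - X x))) = - (LBINT x. \<psi> x *\<^sub>R ((1 - \<eta> x) *\<^sub>R g x))"
    by (simp add: mult.commute)
  moreover have "(LBINT x. u x *\<^sub>R ((1 - \<eta> x) *\<^sub>R G x + \<psi> x *\<^sub>R (0 - X x))) =
      (LBINT x. ((1 - \<eta> x) * u x) *\<^sub>R G x - \<psi> x *\<^sub>R (u x *\<^sub>R X x))"
    by (intro Bochner_Integration.integral_cong) (auto simp: scaleR_right_distrib scaleR_right_diff_distrib mult.commute)
  moreover have "\<dots> = (LBINT x. ((1 - \<eta> x) * u x) *\<^sub>R G x) - (LBINT x. \<psi> x *\<^sub>R (u x *\<^sub>R X x))"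
    using i4 i5 by (rule Bochner_Integration.integral_diff)
  moreover have "(LBINT x. \<psi> x *\<^sub>R ((1 - \<eta> x) *\<^sub>R g x - u x *\<^sub>R X x)) =
      (LBINT x. \<psi> x *\<^sub>R ((1 - \<eta> x) *\<^sub>R g x)) - (LBINT x. \<psi> x *\<^sub>R (u x *\<^sub>R X x))"
    unfolding scaleR_right_diff_distrib using i6 i5 by (rule Bochner_Integration.integral_diff)
  ultimately show "(LBINT x. ((1 - \<eta> x) * u x) *\<^sub>R G x) = - (LBINT x. \<psi> x *\<^sub>R ((1 - \<eta> x) *\<^sub>R g x - u x *\<^sub>R X x))"
    by (simp add: algebra_simps)
qed

section \<open>Gluing two measures\<close>

text \<open>
  The singular derivative of \<open>s 1\<^sub>A\<close> and the absolutely continuous derivative of \<open>(1 - \<eta>) u\<^sub>0\<close> become a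
  single measure with a density once the perimeter measure is used on the closure of \<open>A\<close> and Lebesgue measure
  outside of it.
\<close>

lemma glued_measure_exists:
  assumes M2: "sets M2 = sets M1" and K: "K \<in> sets M1"
  obtains M where "sets M = sets M1"
    "\<And>B. B \<in> sets M1 \<Longrightarrow> emeasure M B = emeasure M1 (B \<inter> K) + emeasure M2 (B - K)"
proof -
  define f where "f B = emeasure M1 (B \<inter> K) + emeasure M2 (B - K)" for B
  have ca: "countably_additive (sets M1) f"
  proof (rule countably_additiveI)
    fix A :: "nat \<Rightarrow> 'a set" assume A: "range A \<subseteq> sets M1" "disjoint_family A" "(\<Union>i. A i) \<in> sets M1"
    have "(\<Sum>i. emeasure M1 (A i \<inter> K)) = emeasure M1 (\<Union>i. A i \<inter> K)"
      by (rule suminf_emeasure) (use A K in \<open>auto simp: disjoint_family_on_def\<close>)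
    moreover have "(\<Sum>i. emeasure M2 (A i - K)) = emeasure M2 (\<Union>i. A i - K)"
      by (rule suminf_emeasure) (use A K M2 in \<open>auto simp: disjoint_family_on_def\<close>)
    ultimately show "(\<Sum>i. f (A i)) = f (\<Union>i. A i)"
      unfolding f_def by (simp add: suminf_add[symmetric])
  qed
  define M where "M = measure_of (space M1) (sets M1) f"
  have s: "sets M = sets M1" unfolding M_def by simp
  moreover have "emeasure M B = f B" if "B \<in> sets M1" for B
    unfolding M_def
    by (rule emeasure_measure_of_sigma[OF sets.sigma_algebra_axioms _ ca that]) (simp add: positive_def f_def)
  ultimately show ?thesis using that unfolding f_def by blast
qed

lemma glued_measure_restrict:
  assumes M: "sets M = sets M1" "sets M2 = sets M1" and K: "K \<in> sets M1"
    and glue: "\<And>B. B \<in> sets M1 \<Longrightarrow> emeasure M B = emeasure M1 (B \<inter> K) + emeasure M2 (B - K)"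
  shows "restrict_space M K = restrict_space M1 K"
    and "restrict_space M (space M1 - K) = restrict_space M2 (space M1 - K)"
proof -
  have sp: "space M = space M1" "space M2 = space M1" using M by (auto dest: sets_eq_imp_space_eq)
  have KS: "K \<subseteq> space M1" using K sets.sets_into_space by auto
  show "restrict_space M K = restrict_space M1 K"
  proof (rule measure_eqI)
    show s: "sets (restrict_space M K) = sets (restrict_space M1 K)" using M(1) by (rule sets_restrict_space_cong)
    fix A assume "A \<in> sets (restrict_space M K)"
    then have A: "A \<subseteq> K" "A \<in> sets M1" using sets_restrict_space_iff[of K M1] K KS s by (auto simp: Int_absorb2)
    then have e: "A \<inter> K = A" "A - K = {}" by auto
    show "emeasure (restrict_space M K) A = emeasure (restrict_space M1 K) A"
      using A K KS M sp glue[OF A(2)] unfolding e by (subst (1 2) emeasure_restrict_space) (auto simp: Int_absorb2)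
  qed
  let ?L = "space M1 - K"
  have L: "?L \<in> sets M1" using K by auto
  show "restrict_space M ?L = restrict_space M2 ?L"
  proof (rule measure_eqI)
    show s: "sets (restrict_space M ?L) = sets (restrict_space M2 ?L)" using M by (intro sets_restrict_space_cong) simp
    fix A assume "A \<in> sets (restrict_space M ?L)"
    then have A: "A \<subseteq> ?L" "A \<in> sets M1" using sets_restrict_space_iff[of ?L M] L M sp by (auto simp: Int_absorb2)
    then have e: "A \<inter> K = {}" "A - K = A" by auto
    show "emeasure (restrict_space M ?L) A = emeasure (restrict_space M2 ?L) A"
      using A L M sp glue[OF A(2)] unfolding e by (subst (1 2) emeasure_restrict_space) (auto simp: Int_absorb2)
  qed
qed

lemma glued_measure_nn_integral:
  assumes M: "sets M = sets M1" "sets M2 = sets M1" and K: "K \<in> sets M1"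
    and glue: "\<And>B. B \<in> sets M1 \<Longrightarrow> emeasure M B = emeasure M1 (B \<inter> K) + emeasure M2 (B - K)"
    and f: "f \<in> borel_measurable M"
  shows "(\<integral>\<^sup>+x. f x \<partial>M) = (\<integral>\<^sup>+x\<in>K. f x \<partial>M1) + (\<integral>\<^sup>+x\<in>space M1 - K. f x \<partial>M2)"
proof -
  have sp: "space M = space M1" "space M2 = space M1" using M by (auto dest: sets_eq_imp_space_eq)
  have KS: "K \<subseteq> space M1" using K sets.sets_into_space by auto
  let ?L = "space M1 - K"
  have L: "?L \<in> sets M1" using K by auto
  have [measurable]: "K \<in> sets M" "?L \<in> sets M" using K L M by auto
  have "(\<integral>\<^sup>+x. f x \<partial>M) = (\<integral>\<^sup>+x. f x * indicator K x + f x * indicator ?L x \<partial>M)"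
    by (intro nn_integral_cong) (auto simp: indicator_def sp)
  also have "\<dots> = (\<integral>\<^sup>+x\<in>K. f x \<partial>M) + (\<integral>\<^sup>+x\<in>?L. f x \<partial>M)"
    by (rule nn_integral_add) (use f in measurable)
  also have "(\<integral>\<^sup>+x\<in>K. f x \<partial>M) = (\<integral>\<^sup>+x\<in>K. f x \<partial>M1)"
    using nn_integral_restrict_space[of K M f] nn_integral_restrict_space[of K M1 f] glued_measure_restrict(1)[OF M K glue] K M KS sp
    by (simp add: Int_absorb2)
  also have "(\<integral>\<^sup>+x\<in>?L. f x \<partial>M) = (\<integral>\<^sup>+x\<in>?L. f x \<partial>M2)"
    using nn_integral_restrict_space[of ?L M f] nn_integral_restrict_space[of ?L M2 f] glued_measure_restrict(2)[OF M K glue] L M sp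
    by (simp add: Int_absorb2)
  finally show ?thesis .
qed

lemma glued_measure_integral:
  fixes f :: "'a \<Rightarrow> 'b::{banach, second_countable_topology}"
  assumes M: "sets M = sets M1" "sets M2 = sets M1" and K: "K \<in> sets M1"
    and glue: "\<And>B. B \<in> sets M1 \<Longrightarrow> emeasure M B = emeasure M1 (B \<inter> K) + emeasure M2 (B - K)"
    and f: "set_integrable M1 K f" "set_integrable M2 (space M1 - K) f"
  shows "integrable M f"
    and "(LINT x|M. f x) = (LINT x:K|M1. f x) + (LINT x:space M1 - K|M2. f x)"
proof -
  have sp: "space M = space M1" "space M2 = space M1" using M by (auto dest: sets_eq_imp_space_eq)
  have KS: "K \<subseteq> space M1" using K sets.sets_into_space by auto
  let ?L = "space M1 - K"
  have L: "?L \<in> sets M1" using K by auto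
  have r: "restrict_space M K = restrict_space M1 K" "restrict_space M ?L = restrict_space M2 ?L"
    by (rule glued_measure_restrict[OF M K glue], assumption)+
  have i: "set_integrable M K f" "set_integrable M ?L f"
    using f integrable_restrict_space[of K M f] integrable_restrict_space[of K M1 f]
      integrable_restrict_space[of ?L M f] integrable_restrict_space[of ?L M2 f] r K L M KS sp
    unfolding set_integrable_def by (simp_all add: Int_absorb2)
  have e: "(LINT x:K|M. f x) = (LINT x:K|M1. f x)" "(LINT x:?L|M. f x) = (LINT x:?L|M2. f x)"
    using integral_restrict_space[of K M f] integral_restrict_space[of K M1 f]
      integral_restrict_space[of ?L M f] integral_restrict_space[of ?L M2 f] r K L M KS sp
    unfolding set_lebesgue_integral_def by (simp_all add: Int_absorb2)
  have U: "K \<union> ?L = space M" using KS sp by auto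
  have "set_integrable M (K \<union> ?L) f"
    by (rule set_integrable_Un[OF i]) (use K L M in auto)
  then show "integrable M f"
    unfolding U set_integrable_def by (subst (asm) Bochner_Integration.integrable_cong[OF refl, where g = f]) auto
  have "(LINT x|M. f x) = (LINT x:K \<union> ?L|M. f x)"
    unfolding U set_lebesgue_integral_def by (intro Bochner_Integration.integral_cong) auto
  also have "\<dots> = (LINT x:K|M. f x) + (LINT x:?L|M. f x)" by (rule set_integral_Un[OF _ i]) auto
  finally show "(LINT x|M. f x) = (LINT x:K|M1. f x) + (LINT x:?L|M2. f x)" unfolding e .
qed

section \<open>The competitors and the majorant\<close>

lemma polar_density_unique_AE:
  assumes U: "open U" and P: "is_polar_density U D \<nu>" "is_polar_density U D \<nu>'"
  shows "AE x in total_variation U D. \<nu> x = \<nu>' x"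
proof -
  have v: "vector_density U D (total_variation U D) \<nu>" "vector_density U D (total_variation U D) \<nu>'"
    using P unfolding is_polar_density_iff_vector_density by auto
  have "vector_density U (\<lambda>B. 0) (total_variation U D) (\<lambda>x. \<nu> x - \<nu>' x)"
    unfolding vector_density_def
  proof (intro conjI ballI)
    show "sets (total_variation U D) = sets (restrict_space borel U)" using v(1) unfolding vector_density_def by auto
    show "(\<lambda>x. \<nu> x - \<nu>' x) \<in> borel_measurable (total_variation U D)"
      using v unfolding vector_density_def by (auto intro: borel_measurable_diff)
    fix B assume "B \<in> cc_borel U"
    then have i: "set_integrable (total_variation U D) B \<nu>" "set_integrable (total_variation U D) B \<nu>'"
      and e: "D B = set_lebesgue_integral (total_variation U D) B \<nu>" "D B = set_lebesgue_integral (total_variation U D) B \<nu>'"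
      using v unfolding vector_density_def by blast+
    show "set_integrable (total_variation U D) B (\<lambda>x. \<nu> x - \<nu>' x)" by (rule set_integral_diff(1)[OF i])
    show "0 = (LINT x:B|total_variation U D. \<nu> x - \<nu>' x)" unfolding set_integral_diff(2)[OF i] e[symmetric] by simp
  qed
  from vector_density_zero_AE[OF U this] show ?thesis by simp
qed

lemma BV_loc_derivative:
  assumes U: "open U" and w: "w \<in> BV_loc U"
  shows "vector_density U (deriv_measure U w) (var_measure U w) (var_direction U w)"
    and "test_function U \<psi> G \<Longrightarrow>
      (LINT x:U|lebesgue. w x *\<^sub>R G x) = - (LINT x|var_measure U w. \<psi> x *\<^sub>R var_direction U w x)"
proof -
  obtain D where "is_derivative_measure U w D" using w unfolding BV_loc_def by auto
  then have D: "is_derivative_measure U w (deriv_measure U w)"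
    unfolding deriv_measure_def by (rule someI[of "is_derivative_measure U w"])
  then obtain \<nu> where nu: "is_polar_density U (deriv_measure U w) \<nu>"
    "\<And>\<psi> G. test_function U \<psi> G \<Longrightarrow>
       (LINT x:U|lebesgue. w x *\<^sub>R G x) = - (LINT x|var_measure U w. \<psi> x *\<^sub>R \<nu> x)"
    unfolding is_derivative_measure_def var_measure_def by auto
  have dir: "is_polar_density U (deriv_measure U w) (var_direction U w)"
    unfolding var_direction_def by (rule someI[of "is_polar_density U (deriv_measure U w)", OF nu(1)])
  then show v: "vector_density U (deriv_measure U w) (var_measure U w) (var_direction U w)"
    unfolding is_polar_density_iff_vector_density var_measure_def .
  have nm: "\<nu> \<in> borel_measurable (var_measure U w)" "var_direction U w \<in> borel_measurable (var_measure U w)"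
    and s: "sets (var_measure U w) = sets (restrict_space borel U)"
    using v nu(1) unfolding is_polar_density_iff_vector_density var_measure_def vector_density_def by auto
  assume t: "test_function U \<psi> G"
  have pm: "\<psi> \<in> borel_measurable (var_measure U w)"
    by (rule borel_measurable_restrict_borel[OF s test_function_borel(1)[OF t]])
  have "AE x in var_measure U w. \<nu> x = var_direction U w x"
    unfolding var_measure_def by (rule polar_density_unique_AE[OF U nu(1) dir])
  then have ae: "AE x in var_measure U w. \<psi> x *\<^sub>R \<nu> x = \<psi> x *\<^sub>R var_direction U w x"
    by eventually_elim simp
  have "(LINT x|var_measure U w. \<psi> x *\<^sub>R \<nu> x) = (LINT x|var_measure U w. \<psi> x *\<^sub>R var_direction U w x)"
    by (rule integral_cong_AE[OF _ _ ae]) (use pm nm in measurable)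
  then show "(LINT x:U|lebesgue. w x *\<^sub>R G x) = - (LINT x|var_measure U w. \<psi> x *\<^sub>R var_direction U w x)"
    using nu(2)[OF t] by simp
qed

lemma integral_restrict_space_zero_outside:
  fixes f :: "'a \<Rightarrow> 'b::{banach, second_countable_topology}"
  assumes "U \<in> sets M" "\<And>x. x \<notin> U \<Longrightarrow> f x = 0"
  shows "(LINT x|restrict_space M U. f x) = (LINT x|M. f x)"
proof -
  have "U \<inter> space M \<in> sets M" using assms(1) by (simp add: sets.Int_space_eq2)
  then have "(LINT x|restrict_space M U. f x) = (LINT x|M. indicator U x *\<^sub>R f x)" by (rule integral_restrict_space)
  also have "\<dots> = (LINT x|M. f x)"
    by (intro Bochner_Integration.integral_cong) (use assms(2) in \<open>auto simp: indicator_def\<close>)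
  finally show ?thesis .
qed

text \<open>
  Restricting \<open>M\<close> to \<open>\<Omega>\<close> changes no integral against a test function of \<open>\<Omega>\<close>.
\<close>

lemma BV_integrable_density:
  fixes \<Omega> :: "'a::euclidean_space set"
  assumes O: "open \<Omega>" and M: "sets M = sets borel" and nu: "integrable M \<nu>"
    and w: "set_integrable lebesgue \<Omega> w"
    and parts: "\<And>\<psi> G. test_function \<Omega> \<psi> G \<Longrightarrow>
      (LINT x:\<Omega>|lebesgue. w x *\<^sub>R G x) = - (LINT x|M. \<psi> x *\<^sub>R \<nu> x)"
  shows "w \<in> BV \<Omega>"
    and "admissible_integrand \<phi> \<Longrightarrow> aniso_variation \<phi> \<Omega> w \<Omega> = (\<integral>\<^sup>+x\<in>\<Omega>. ennreal (\<phi> x (\<nu> x)) \<partial>M)"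
proof -
  have OM: "\<Omega> \<in> sets M" "\<Omega> \<inter> space M \<in> sets M" using O M sets_eq_imp_space_eq[OF M] by auto
  define N where "N = restrict_space M \<Omega>"
  have sN: "sets N = sets (restrict_space borel \<Omega>)" unfolding N_def by (rule sets_restrict_space_cong[OF M])
  have iN: "integrable N \<nu>"
    unfolding N_def integrable_restrict_space[OF OM(2)] by (rule integrable_mult_indicator[OF OM(1) nu])
  define D where "D B = set_lebesgue_integral N B \<nu>" for B
  have D: "vector_density \<Omega> D N \<nu>"
    unfolding vector_density_def D_def
  proof (intro conjI ballI sN refl)
    show "\<nu> \<in> borel_measurable N" using iN by auto
    fix B assume "B \<in> cc_borel \<Omega>"
    then show "set_integrable N B \<nu>"
      unfolding set_integrable_def using cc_borel_in_sets[OF O sN] by (intro integrable_mult_indicator iN)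
  qed
  have fin: "(\<integral>\<^sup>+x. norm (\<nu> x) \<partial>N) < \<infinity>" using iN unfolding integrable_iff_bounded by simp
  have ibp: "(LINT x:\<Omega>|lebesgue. w x *\<^sub>R G x) = - (LINT x|N. \<psi> x *\<^sub>R \<nu> x)" if t: "test_function \<Omega> \<psi> G" for \<psi> G
  proof -
    have "(LINT x|N. \<psi> x *\<^sub>R \<nu> x) = (LINT x|M. \<psi> x *\<^sub>R \<nu> x)"
      unfolding N_def
      by (rule integral_restrict_space_zero_outside[OF OM(1)]) (simp add: test_function_zero_outside(1)[OF t])
    then show ?thesis using parts[OF t] by simp
  qed
  show "w \<in> BV \<Omega>" by (rule BV_density(1)[OF O D w _ fin]) (rule ibp)
  assume phi: "admissible_integrand \<phi>"
  have "aniso_variation \<phi> \<Omega> w \<Omega> = (\<integral>\<^sup>+x. ennreal (\<phi> x (\<nu> x)) \<partial>N)"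
    by (rule BV_density(2)[OF O D w _ fin phi]) (rule ibp)
  then show "aniso_variation \<phi> \<Omega> w \<Omega> = (\<integral>\<^sup>+x\<in>\<Omega>. ennreal (\<phi> x (\<nu> x)) \<partial>M)"
    unfolding N_def nn_integral_restrict_space[OF OM(2)] .
qed

text \<open>
  The last fact localises the derivative: test functions supported off the closure of \<open>A\<close> have vanishing
  integral against it, so by uniqueness it is zero there.
\<close>

lemma finite_perimeter_derivative:
  fixes A :: "'a::euclidean_space set"
  assumes P: "finite_perimeter A"
  defines "M \<equiv> var_measure UNIV (indicator A)" and "\<nu> \<equiv> var_direction UNIV (indicator A)"
  shows "sets M = sets borel" "integrable M \<nu>"
    "test_function UNIV \<psi> G \<Longrightarrow> (LINT x|lebesgue. indicator A x *\<^sub>R G x) = - (LINT x|M. \<psi> x *\<^sub>R \<nu> x)"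
    "AE x in M. x \<notin> closure A \<longrightarrow> \<nu> x = 0"
proof -
  have w: "indicator A \<in> BV_loc (UNIV :: 'a set)" using P unfolding finite_perimeter_def by auto
  note v = BV_loc_derivative(1)[OF open_UNIV w, folded M_def \<nu>_def]
  show s: "sets M = sets borel" using v unfolding vector_density_def by simp
  have sp: "space M = UNIV" using sets_eq_imp_space_eq[OF s] by simp
  have nm: "\<nu> \<in> borel_measurable M" using v unfolding vector_density_def by auto
  have "M = density M (\<lambda>x. ennreal (norm (\<nu> x)))"
    using total_variation_density[OF open_UNIV v] unfolding M_def var_measure_def .
  then have "emeasure M UNIV = emeasure (density M (\<lambda>x. ennreal (norm (\<nu> x)))) UNIV" by simp
  also have "\<dots> = (\<integral>\<^sup>+x. norm (\<nu> x) \<partial>M)" using nm sp s by (subst emeasure_density) auto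
  finally have "(\<integral>\<^sup>+x. norm (\<nu> x) \<partial>M) = emeasure M UNIV" by simp
  also have "\<dots> < \<infinity>" using P unfolding finite_perimeter_def M_def by simp
  finally show i: "integrable M \<nu>" using nm unfolding integrable_iff_bounded by simp
  show parts: "test_function UNIV \<psi> G \<Longrightarrow> (LINT x|lebesgue. indicator A x *\<^sub>R G x) = - (LINT x|M. \<psi> x *\<^sub>R \<nu> x)" for \<psi> G
    using BV_loc_derivative(2)[OF open_UNIV w, folded M_def \<nu>_def]
    unfolding set_lebesgue_integral_def by simp
  let ?U = "- closure A"
  have U: "open ?U" by auto
  have Us: "?U \<in> sets M" unfolding s by auto
  let ?M = "restrict_space M ?U"
  have sM: "sets ?M = sets (restrict_space borel ?U)" using s by (rule sets_restrict_space_cong)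
  have iM: "set_integrable ?M B \<nu>" if "B \<in> sets ?M" for B
    unfolding set_integrable_def
    by (rule integrable_mult_indicator[OF that]) (use i integrable_mult_indicator[OF Us i] Us sp in \<open>simp add: integrable_restrict_space\<close>)
  have mM: "\<nu> \<in> borel_measurable ?M" using nm by (rule measurable_restrict_space1)
  have vd: "vector_density ?U (\<lambda>B. set_lebesgue_integral ?M B \<nu>) ?M \<nu>"
    unfolding vector_density_def using sM mM iM cc_borel_in_sets[OF U sM] by auto
  have vd0: "vector_density ?U (\<lambda>B. 0) ?M (\<lambda>x. 0)"
    unfolding vector_density_def using sM by (auto simp: set_integrable_def set_lebesgue_integral_def)
  have "set_lebesgue_integral ?M B \<nu> = 0" if "B \<in> cc_borel ?U" for B
  proof (rule vector_density_unique[OF U vd vd0 _ that])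
    fix \<psi> G assume t: "test_function ?U \<psi> G"
    have z: "indicat_real A x *\<^sub>R G x = 0" for x
      using test_function_zero_outside(2)[OF t, of x] closure_subset[of A] by (auto simp: indicator_def)
    have "(LINT x|M. \<psi> x *\<^sub>R \<nu> x) = 0"
      using parts[OF test_function_subset[OF t subset_UNIV]] unfolding z by simp
    moreover have "(LINT x|?M. \<psi> x *\<^sub>R \<nu> x) = (LINT x|M. \<psi> x *\<^sub>R \<nu> x)"
      by (rule integral_restrict_space_zero_outside[OF Us]) (simp add: test_function_zero_outside(1)[OF t])
    ultimately show "(LINT x|?M. \<psi> x *\<^sub>R \<nu> x) = (LINT x|?M. \<psi> x *\<^sub>R 0)" by simp
  qed
  then have "vector_density ?U (\<lambda>B. 0) ?M \<nu>" using vd unfolding vector_density_def by simp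
  from vector_density_zero_AE[OF U this] show "AE x in M. x \<notin> closure A \<longrightarrow> \<nu> x = 0"
    using Us sp by (simp add: AE_restrict_space_iff)
qed

lemma test_function_gradient_zero_on_plateau:
  assumes t: "test_function U \<psi> G" and V: "open V" "x \<in> V" "\<And>y. y \<in> V \<Longrightarrow> \<psi> y = c"
  shows "G x = 0"
proof -
  have d: "(\<psi> has_derivative (\<lambda>h. h \<bullet> G x)) (at x)"
    using t unfolding test_function_def gderiv_def by auto
  have "((\<lambda>x. c) has_derivative (\<lambda>h. 0)) (at x)" by simp
  then have "(\<psi> has_derivative (\<lambda>h. 0)) (at x)"
    by (rule has_derivative_transform_within_open[OF _ V(1,2)]) (use V(3) in auto)
  from has_derivative_unique[OF d this] have "h \<bullet> G x = 0" for h by metis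
  then show ?thesis by (metis inner_eq_zero_iff)
qed

text \<open>
  Homogeneity holds for nonnegative factors only; a negative factor reverses the direction and
  thereby leads to the mirrored integrand.
\<close>

lemma aniso_perimeter_homogeneous:
  fixes A :: "'a::euclidean_space set"
  assumes P: "finite_perimeter A" and phi: "admissible_integrand \<phi>"
  defines "M \<equiv> var_measure UNIV (indicator A)" and "\<nu> \<equiv> var_direction UNIV (indicator A)"
  shows "0 \<le> s \<Longrightarrow> (\<integral>\<^sup>+x. ennreal (\<phi> x (s *\<^sub>R \<nu> x)) \<partial>M) = ennreal s * aniso_perimeter \<phi> A"
    and "0 \<le> s \<Longrightarrow> (\<integral>\<^sup>+x. ennreal (\<phi> x (- s *\<^sub>R \<nu> x)) \<partial>M) = ennreal s * aniso_perimeter (mirrored \<phi>) A"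
proof -
  note d = finite_perimeter_derivative[OF P, folded M_def \<nu>_def]
  have s: "sets M = sets (restrict_space borel UNIV)" using d(1) by simp
  have nm: "\<nu> \<in> borel_measurable M" using d(2) by auto
  have m: "(\<lambda>x. \<phi> x (\<nu> x)) \<in> borel_measurable M" "(\<lambda>x. \<phi> x (- \<nu> x)) \<in> borel_measurable M"
    by (rule admissible_integrand_measurable[OF phi s], use nm in measurable)+
  have p: "aniso_perimeter \<psi> A = (\<integral>\<^sup>+x. ennreal (\<psi> x (\<nu> x)) \<partial>M)" for \<psi>
    using P unfolding aniso_perimeter_def aniso_variation_def M_def \<nu>_def by simp
  show "(\<integral>\<^sup>+x. ennreal (\<phi> x (s *\<^sub>R \<nu> x)) \<partial>M) = ennreal s * aniso_perimeter \<phi> A" if "0 \<le> s"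
    unfolding p using that m admissible_integrandD(2,3)[OF phi]
    by (simp add: nn_integral_cmult[symmetric] ennreal_mult)
  show "(\<integral>\<^sup>+x. ennreal (\<phi> x (- s *\<^sub>R \<nu> x)) \<partial>M) = ennreal s * aniso_perimeter (mirrored \<phi>) A" if "0 \<le> s"
  proof -
    have "\<phi> x (- s *\<^sub>R \<nu> x) = s * \<phi> x (- \<nu> x)" for x
      using admissible_integrandD(3)[OF phi that, of x "- \<nu> x"] by simp
    then show ?thesis unfolding p mirrored_def
      using that m admissible_integrandD(2)[OF phi] by (simp add: nn_integral_cmult[symmetric] ennreal_mult)
  qed
qed

text \<open>
  The derivative of the competitor is \<open>s\<close> times the derivative of \<open>1\<^sub>A\<close> on the closure of \<open>A\<close>, and the
  absolutely continuous derivative \<open>\<gamma>\<close> of \<open>(1 - \<eta>) u\<^sub>0\<close> elsewhere. The latter contributes a constant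
  independent of \<open>s\<close>. No subadditivity of \<open>\<phi>\<close> is available, so it is essential that the two parts do not overlap.
\<close>

lemma competitor_BV:
  fixes \<Omega> :: "'a::euclidean_space set" and u\<^sub>0 :: "'a \<Rightarrow> real"
  assumes O: "open \<Omega>" and A: "A \<in> sets lebesgue" "compact (closure A)" and P: "finite_perimeter A"
    and u0S: "u\<^sub>0 \<in> Sobolev_1_1 UNIV"
    and eta: "test_function \<Omega> \<eta> X" and V: "open V" "closure A \<subseteq> V" "\<And>x. x \<in> V \<Longrightarrow> \<eta> x = 1"
    and phi: "admissible_integrand \<phi>"
  defines "M\<^sub>A \<equiv> var_measure UNIV (indicator A)" and "\<nu>\<^sub>A \<equiv> var_direction UNIV (indicator A)"
  shows "\<exists>C\<ge>0. \<forall>s. (\<lambda>x. s * indicator A x + (1 - \<eta> x) * u\<^sub>0 x) \<in> BV \<Omega> \<and>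
    aniso_variation \<phi> \<Omega> (\<lambda>x. s * indicator A x + (1 - \<eta> x) * u\<^sub>0 x) \<Omega>
      \<le> (\<integral>\<^sup>+x. ennreal (\<phi> x (s *\<^sub>R \<nu>\<^sub>A x)) \<partial>M\<^sub>A) + ennreal C"
proof -
  note d = finite_perimeter_derivative[OF P, folded M\<^sub>A_def \<nu>\<^sub>A_def]
  obtain u g where ug: "has_weak_gradient u g"
    and u0: "u\<^sub>0 \<in> borel_measurable lebesgue" "AE x in lborel. u\<^sub>0 x = u x"
    using Sobolev_1_1_borel_representative[OF u0S] by blast
  note u = has_weak_gradientD(1)[OF ug] and g = has_weak_gradientD(2)[OF ug]
  have [measurable]: "u \<in> borel_measurable borel" "g \<in> borel_measurable borel"
    using borel_measurable_integrable[OF u] borel_measurable_integrable[OF g] by auto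
  note [measurable] = test_function_borel[OF eta]
  have spA: "space M\<^sub>A = UNIV" using sets_eq_imp_space_eq[OF d(1)] by simp
  have bmA: "borel_measurable M\<^sub>A = borel_measurable borel" by (rule measurable_cong_sets[OF d(1) refl])
  have bmA': "borel_measurable M\<^sub>A = (borel_measurable borel :: ('a \<Rightarrow> real) set)" by (rule measurable_cong_sets[OF d(1) refl])
  have nuA[measurable]: "\<nu>\<^sub>A \<in> borel_measurable borel" using borel_measurable_integrable[OF d(2)] unfolding bmA .
  define K where "K = closure A"
  have Kb[measurable]: "K \<in> sets borel" unfolding K_def by simp
  define \<gamma> where "\<gamma> x = (1 - \<eta> x) *\<^sub>R g x - u x *\<^sub>R X x" for x
  have gm[measurable]: "\<gamma> \<in> borel_measurable borel" unfolding \<gamma>_def by measurable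
  have gi: "integrable lborel \<gamma>"
    unfolding \<gamma>_def by (intro Bochner_Integration.integrable_diff cutoff_integrable(2,3)[OF u g eta])
  have wi: "integrable lborel (\<lambda>x. (1 - \<eta> x) * u x)" by (rule cutoff_integrable(1)[OF u g eta])
  have gK: "\<gamma> x = 0" if "x \<in> K" for x
  proof -
    have "x \<in> V" using that V(2) unfolding K_def by auto
    then have "X x = 0" by (rule test_function_gradient_zero_on_plateau[OF eta V(1)]) (rule V(3))
    then show ?thesis unfolding \<gamma>_def using V(3)[OF \<open>x \<in> V\<close>] by simp
  qed
  obtain \<beta> where \<beta>: "\<And>x \<xi>. \<phi> x \<xi> \<le> \<beta> * norm \<xi>" "0 < \<beta>"
  proof -
    obtain \<alpha> \<beta> where "0 < \<alpha>" "\<alpha> \<le> \<beta>" "\<And>x \<xi>. \<phi> x \<xi> \<le> \<beta> * norm \<xi>"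
      using phi unfolding admissible_integrand_def by blast
    then show ?thesis using that[of \<beta>] by simp
  qed
  define C where "C = \<beta> * (LBINT x. norm (\<gamma> x))"
  have C0: "C \<ge> 0" unfolding C_def using \<beta>(2) by simp
  have sets2: "sets lborel = sets M\<^sub>A" using d(1) by simp
  have KA: "K \<in> sets M\<^sub>A" using d(1) Kb by simp
  obtain M0 where M0: "sets M0 = sets M\<^sub>A"
    "\<And>B. B \<in> sets M\<^sub>A \<Longrightarrow> emeasure M0 B = emeasure M\<^sub>A (B \<inter> K) + emeasure lborel (B - K)"
    using glued_measure_exists[OF sets2 KA] by blast
  have sets0: "sets M0 = sets borel" using M0(1) d(1) by simp
  have sp0: "space M0 = UNIV" using sets_eq_imp_space_eq[OF sets0] by simp
  have bm0: "borel_measurable M0 = (borel_measurable borel :: ('a \<Rightarrow> 'a) set)" by (rule measurable_cong_sets[OF sets0 refl])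
  show ?thesis
  proof (intro exI[of _ C] conjI allI C0)
    fix s :: real
    define w where "w x = s * indicator A x + (1 - \<eta> x) * u\<^sub>0 x" for x
    \<comment> \<open>The boundary of \<open>A\<close> is contained in \<open>K\<close>, and \<open>\<gamma>\<close> vanishes on \<open>K\<close>.\<close>
    define \<nu> where "\<nu> x = (if x \<in> K then s *\<^sub>R \<nu>\<^sub>A x else \<gamma> x)" for x
    have num[measurable]: "\<nu> \<in> borel_measurable borel" unfolding \<nu>_def by measurable
    have glue: "integrable M0 (\<lambda>x. \<psi> x *\<^sub>R \<nu> x)"
      "(LINT x|M0. \<psi> x *\<^sub>R \<nu> x) = s *\<^sub>R (LINT x|M\<^sub>A. \<psi> x *\<^sub>R \<nu>\<^sub>A x) + (LBINT x. \<psi> x *\<^sub>R \<gamma> x)"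
      if [measurable]: "\<psi> \<in> borel_measurable borel" and b: "\<And>x. \<bar>\<psi> x\<bar> \<le> b" for \<psi> :: "'a \<Rightarrow> real" and b
    proof -
      have i1: "integrable M\<^sub>A (\<lambda>x. \<psi> x *\<^sub>R \<nu>\<^sub>A x)"
      proof (rule Bochner_Integration.integrable_bound[where f = "\<lambda>x. b *\<^sub>R \<nu>\<^sub>A x"])
        show "(\<lambda>x. \<psi> x *\<^sub>R \<nu>\<^sub>A x) \<in> borel_measurable M\<^sub>A" unfolding bmA by measurable
        show "AE x in M\<^sub>A. norm (\<psi> x *\<^sub>R \<nu>\<^sub>A x) \<le> norm (b *\<^sub>R \<nu>\<^sub>A x)"
        proof (rule AE_I2)
          fix x
          have "\<bar>\<psi> x\<bar> \<le> \<bar>b\<bar>" using b[of x] by linarith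
          then show "norm (\<psi> x *\<^sub>R \<nu>\<^sub>A x) \<le> norm (b *\<^sub>R \<nu>\<^sub>A x)" by (simp add: mult_right_mono)
        qed
      qed (use d(2) in auto)
      have i2: "integrable lborel (\<lambda>x. \<psi> x *\<^sub>R \<gamma> x)" by (rule integrable_bounded_scaleR[OF gi _ b]) measurable
      have e1: "indicator K x *\<^sub>R (\<psi> x *\<^sub>R \<nu> x) = s *\<^sub>R (indicator K x *\<^sub>R (\<psi> x *\<^sub>R \<nu>\<^sub>A x))" for x
        unfolding \<nu>_def by (auto simp: indicator_def)
      have e2: "indicator (space M\<^sub>A - K) x *\<^sub>R (\<psi> x *\<^sub>R \<nu> x) = \<psi> x *\<^sub>R \<gamma> x" for x
        unfolding \<nu>_def spA using gK by (auto simp: indicator_def)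
      have s1: "set_integrable M\<^sub>A K (\<lambda>x. \<psi> x *\<^sub>R \<nu> x)"
        unfolding set_integrable_def e1 by (intro integrable_scaleR_right integrable_mult_indicator[OF KA i1])
      have s2: "set_integrable lborel (space M\<^sub>A - K) (\<lambda>x. \<psi> x *\<^sub>R \<nu> x)"
        unfolding set_integrable_def e2 by (rule i2)
      show "integrable M0 (\<lambda>x. \<psi> x *\<^sub>R \<nu> x)"
        by (rule glued_measure_integral(1)[OF M0(1) sets2 KA M0(2) s1 s2])
      have "(LINT x|M0. \<psi> x *\<^sub>R \<nu> x) = (LINT x:K|M\<^sub>A. \<psi> x *\<^sub>R \<nu> x) + (LINT x:space M\<^sub>A - K|lborel. \<psi> x *\<^sub>R \<nu> x)"
        by (rule glued_measure_integral(2)[OF M0(1) sets2 KA M0(2) s1 s2])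
      also have "\<dots> = (LINT x|M\<^sub>A. s *\<^sub>R (indicator K x *\<^sub>R (\<psi> x *\<^sub>R \<nu>\<^sub>A x))) + (LBINT x. \<psi> x *\<^sub>R \<gamma> x)"
        unfolding set_lebesgue_integral_def e1 e2 ..
      also have "(LINT x|M\<^sub>A. s *\<^sub>R (indicator K x *\<^sub>R (\<psi> x *\<^sub>R \<nu>\<^sub>A x))) = s *\<^sub>R (LINT x|M\<^sub>A. indicator K x *\<^sub>R (\<psi> x *\<^sub>R \<nu>\<^sub>A x))"
        by (rule integral_scaleR_right)
      also have "(LINT x|M\<^sub>A. indicator K x *\<^sub>R (\<psi> x *\<^sub>R \<nu>\<^sub>A x)) = (LINT x|M\<^sub>A. \<psi> x *\<^sub>R \<nu>\<^sub>A x)"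
      proof (rule integral_cong_AE)
        show "AE x in M\<^sub>A. indicator K x *\<^sub>R (\<psi> x *\<^sub>R \<nu>\<^sub>A x) = \<psi> x *\<^sub>R \<nu>\<^sub>A x"
          using d(4) by eventually_elim (auto simp: indicator_def K_def)
        show "(\<lambda>x. indicat_real K x *\<^sub>R \<psi> x *\<^sub>R \<nu>\<^sub>A x) \<in> borel_measurable M\<^sub>A" unfolding bmA by measurable
        show "(\<lambda>x. \<psi> x *\<^sub>R \<nu>\<^sub>A x) \<in> borel_measurable M\<^sub>A" unfolding bmA by measurable
      qed
      finally show "(LINT x|M0. \<psi> x *\<^sub>R \<nu> x) = s *\<^sub>R (LINT x|M\<^sub>A. \<psi> x *\<^sub>R \<nu>\<^sub>A x) + (LBINT x. \<psi> x *\<^sub>R \<gamma> x)" .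
    qed
    have i0: "integrable M0 \<nu>" using glue(1)[of "\<lambda>x. 1" 1] by simp
    have etal: "\<eta> \<in> borel_measurable lebesgue" using test_function_borel[OF eta] by (auto intro!: measurable_completion)
    have w2m: "(\<lambda>x. (1 - \<eta> x) * u\<^sub>0 x) \<in> borel_measurable lebesgue" using u0(1) etal by measurable
    have w2ae: "AE x in lborel. (1 - \<eta> x) * u\<^sub>0 x = (1 - \<eta> x) * u x" using u0(2) by eventually_elim simp
    have w2i: "integrable lebesgue (\<lambda>x. (1 - \<eta> x) * u\<^sub>0 x)"
      using integral_lebesgue_eq_lborel(2)[OF w2m _ w2ae] wi by simp
    have Afin: "emeasure lebesgue A < \<infinity>"
    proof -
      have "emeasure lebesgue A \<le> emeasure lebesgue (closure A)" by (rule emeasure_mono) (auto simp: closure_subset)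
      also have "\<dots> = emeasure lborel (closure A)" by (simp add: emeasure_completion)
      also have "\<dots> < \<infinity>" using emeasure_compact_finite[OF A(2)] by simp
      finally show ?thesis .
    qed
    have w1i: "integrable lebesgue (indicat_real A)" by (rule integrable_real_indicator) (use A Afin in auto)
    have wil: "integrable lebesgue w" unfolding w_def using w1i w2i by auto
    have wO: "set_integrable lebesgue \<Omega> w" unfolding set_integrable_def
      by (rule integrable_mult_indicator[OF _ wil]) (use O in auto)
    have ibp: "(LINT x:\<Omega>|lebesgue. w x *\<^sub>R G x) = - (LINT x|M0. \<psi> x *\<^sub>R \<nu> x)" if t: "test_function \<Omega> \<psi> G" for \<psi> G
    proof -
      have tU: "test_function UNIV \<psi> G" by (rule test_function_subset[OF t subset_UNIV])
      obtain b where b: "\<And>x. \<bar>\<psi> x\<bar> \<le> b" using test_function_bounded[OF t] by metis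
      obtain c where c: "\<And>x. norm (G x) \<le> c" using test_function_gradient_bounded[OF t] by metis
      note [measurable] = test_function_borel[OF t]
      have Gl: "G \<in> borel_measurable lebesgue" using test_function_borel[OF t] by (auto intro!: measurable_completion)
      have "(LINT x:\<Omega>|lebesgue. w x *\<^sub>R G x) = (LINT x|lebesgue. s *\<^sub>R (indicat_real A x *\<^sub>R G x) + ((1 - \<eta> x) * u\<^sub>0 x) *\<^sub>R G x)"
        unfolding set_lebesgue_integral_def w_def
        by (intro Bochner_Integration.integral_cong refl)
          (use test_function_zero_outside(2)[OF t] in \<open>auto simp: indicator_def scaleR_left_distrib\<close>)
      also have "\<dots> = s *\<^sub>R (LINT x|lebesgue. indicat_real A x *\<^sub>R G x) + (LINT x|lebesgue. ((1 - \<eta> x) * u\<^sub>0 x) *\<^sub>R G x)"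
      proof -
        have "integrable lebesgue G"
          using test_function_gradient_integrable[OF t] integrable_completion[of G lborel] by simp
        then have j1: "integrable lebesgue (\<lambda>x. indicat_real A x *\<^sub>R G x)" by (rule integrable_mult_indicator[OF A(1)])
        have j2: "integrable lborel (\<lambda>x. ((1 - \<eta> x) * u x) *\<^sub>R G x)" by (rule integrable_scaleR_bounded[OF wi _ c]) measurable
        have ae: "AE x in lborel. ((1 - \<eta> x) * u\<^sub>0 x) *\<^sub>R G x = ((1 - \<eta> x) * u x) *\<^sub>R G x"
          using w2ae by eventually_elim simp
        have j3: "integrable lebesgue (\<lambda>x. ((1 - \<eta> x) * u\<^sub>0 x) *\<^sub>R G x)"
          using integral_lebesgue_eq_lborel(2)[OF borel_measurable_scaleR[OF w2m Gl] _ ae] j2 by simp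
        have j4: "integrable lebesgue (\<lambda>x. s *\<^sub>R (indicat_real A x *\<^sub>R G x))"
          by (intro integrable_scaleR_right j1)
        have "(LINT x|lebesgue. s *\<^sub>R (indicat_real A x *\<^sub>R G x)) = s *\<^sub>R (LINT x|lebesgue. indicat_real A x *\<^sub>R G x)"
          by (rule integral_scaleR_right)
        then show ?thesis by (simp only: Bochner_Integration.integral_add[OF j4 j3])
      qed
      also have "(LINT x|lebesgue. ((1 - \<eta> x) * u\<^sub>0 x) *\<^sub>R G x) = (LBINT x. ((1 - \<eta> x) * u x) *\<^sub>R G x)"
      proof (rule integral_lebesgue_eq_lborel(1)[OF borel_measurable_scaleR[OF w2m Gl]])
        show "AE x in lborel. ((1 - \<eta> x) * u\<^sub>0 x) *\<^sub>R G x = ((1 - \<eta> x) * u x) *\<^sub>R G x"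
          using w2ae by eventually_elim simp
      qed measurable
      also have "\<dots> = - (LBINT x. \<psi> x *\<^sub>R \<gamma> x)"
        unfolding \<gamma>_def by (rule product_rule_cutoff[OF ug eta tU])
      also have "(LINT x|lebesgue. indicat_real A x *\<^sub>R G x) = - (LINT x|M\<^sub>A. \<psi> x *\<^sub>R \<nu>\<^sub>A x)" by (rule d(3)[OF tU])
      also have "s *\<^sub>R - (LINT x|M\<^sub>A. \<psi> x *\<^sub>R \<nu>\<^sub>A x) + - (LBINT x. \<psi> x *\<^sub>R \<gamma> x) = - (LINT x|M0. \<psi> x *\<^sub>R \<nu> x)"
        unfolding glue(2)[OF test_function_borel(1)[OF t] b] by simp
      finally show ?thesis .
    qed
    have "w \<in> BV \<Omega>" by (rule BV_integrable_density(1)[OF O sets0 i0 wO ibp])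
    then show "(\<lambda>x. s * indicator A x + (1 - \<eta> x) * u\<^sub>0 x) \<in> BV \<Omega>" unfolding w_def .
    have phim: "(\<lambda>x. \<phi> x (\<nu> x)) \<in> borel_measurable M0"
      by (rule admissible_integrand_measurable[OF phi, where U = UNIV]) (use sets0 bm0 num in auto)
    have "aniso_variation \<phi> \<Omega> w \<Omega> = (\<integral>\<^sup>+x\<in>\<Omega>. ennreal (\<phi> x (\<nu> x)) \<partial>M0)"
      by (rule BV_integrable_density(2)[OF O sets0 i0 wO ibp phi])
    also have "\<dots> \<le> (\<integral>\<^sup>+x. ennreal (\<phi> x (\<nu> x)) \<partial>M0)" by (intro nn_integral_mono) (auto simp: indicator_def)
    also have "\<dots> = (\<integral>\<^sup>+x\<in>K. ennreal (\<phi> x (\<nu> x)) \<partial>M\<^sub>A) + (\<integral>\<^sup>+x\<in>space M\<^sub>A - K. ennreal (\<phi> x (\<nu> x)) \<partial>lborel)"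
      by (rule glued_measure_nn_integral[OF M0(1) sets2 KA M0(2)]) (use phim in auto)
    also have "\<dots> \<le> (\<integral>\<^sup>+x. ennreal (\<phi> x (s *\<^sub>R \<nu>\<^sub>A x)) \<partial>M\<^sub>A) + (\<integral>\<^sup>+x. ennreal (\<beta> * norm (\<gamma> x)) \<partial>lborel)"
    proof (rule add_mono)
      show "(\<integral>\<^sup>+x\<in>K. ennreal (\<phi> x (\<nu> x)) \<partial>M\<^sub>A) \<le> (\<integral>\<^sup>+x. ennreal (\<phi> x (s *\<^sub>R \<nu>\<^sub>A x)) \<partial>M\<^sub>A)"
        by (intro nn_integral_mono) (auto simp: indicator_def \<nu>_def)
      show "(\<integral>\<^sup>+x\<in>space M\<^sub>A - K. ennreal (\<phi> x (\<nu> x)) \<partial>lborel) \<le> (\<integral>\<^sup>+x. ennreal (\<beta> * norm (\<gamma> x)) \<partial>lborel)"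
        by (intro nn_integral_mono) (use \<beta>(1) in \<open>auto simp: indicator_def \<nu>_def intro!: ennreal_leI\<close>)
    qed
    also have "(\<integral>\<^sup>+x. ennreal (\<beta> * norm (\<gamma> x)) \<partial>lborel) = ennreal C"
      unfolding C_def using gi \<beta>(2) by (subst nn_integral_eq_integral) auto
    finally show "aniso_variation \<phi> \<Omega> (\<lambda>x. s * indicator A x + (1 - \<eta> x) * u\<^sub>0 x) \<Omega>
      \<le> (\<integral>\<^sup>+x. ennreal (\<phi> x (s *\<^sub>R \<nu>\<^sub>A x)) \<partial>M\<^sub>A) + ennreal C" unfolding w_def .
  qed
qed

text \<open>
  The gradient \<open>u / sqrt (1 + u\<^sup>2) \<cdot> g\<close> is integrable because its first factor is bounded, and the
  function itself is integrable because \<open>\<Omega>\<close> is bounded.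
\<close>

lemma sqrt_majorant_BV:
  fixes \<Omega> :: "'a::euclidean_space set" and u\<^sub>0 :: "'a \<Rightarrow> real"
  assumes O: "open \<Omega>" "bounded \<Omega>"
    and u0S: "u\<^sub>0 \<in> Sobolev_1_1 UNIV"
  shows "(\<lambda>x. sqrt (1 + (u\<^sub>0 x)\<^sup>2)) \<in> BV \<Omega>"
proof -
  obtain u g where ug: "has_weak_gradient u g"
    and u0: "u\<^sub>0 \<in> borel_measurable lebesgue" "AE x in lborel. u\<^sub>0 x = u x"
    using Sobolev_1_1_borel_representative[OF u0S] by blast
  note u = has_weak_gradientD(1)[OF ug] and g = has_weak_gradientD(2)[OF ug]
  have [measurable]: "u \<in> borel_measurable borel" "g \<in> borel_measurable borel"
    using borel_measurable_integrable[OF u] borel_measurable_integrable[OF g] by auto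
  define \<nu> where "\<nu> x = (u x / sqrt (1 + (u x)\<^sup>2)) *\<^sub>R g x" for x
  have nui: "integrable lborel \<nu>" unfolding \<nu>_def by (rule integrable_bounded_scaleR[OF g _ sqrt_one_plus_square_bounds(3)]) measurable
  have vm: "(\<lambda>x. sqrt (1 + (u\<^sub>0 x)\<^sup>2)) \<in> borel_measurable lebesgue" using u0(1) by measurable
  have ae: "AE x in lborel. sqrt (1 + (u\<^sub>0 x)\<^sup>2) = sqrt (1 + (u x)\<^sup>2)" using u0(2) by eventually_elim simp
  have u0i: "integrable lebesgue u\<^sub>0" using integral_lebesgue_eq_lborel(2)[OF u0(1) _ u0(2)] u by simp
  have Ofin: "emeasure lebesgue \<Omega> < \<infinity>"
    using emeasure_bounded_finite[OF O(2)] O(1) by (simp add: emeasure_completion)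
  have v: "set_integrable lebesgue \<Omega> (\<lambda>x. sqrt (1 + (u\<^sub>0 x)\<^sup>2))"
    unfolding set_integrable_def
  proof (rule Bochner_Integration.integrable_bound[where f = "\<lambda>x. indicat_real \<Omega> x + \<bar>u\<^sub>0 x\<bar>"])
    show "integrable lebesgue (\<lambda>x. indicat_real \<Omega> x + \<bar>u\<^sub>0 x\<bar>)"
      by (intro Bochner_Integration.integrable_add integrable_real_indicator integrable_abs u0i) (use O Ofin in auto)
    show "(\<lambda>x. indicat_real \<Omega> x *\<^sub>R sqrt (1 + (u\<^sub>0 x)\<^sup>2)) \<in> borel_measurable lebesgue"
      using vm O by (intro borel_measurable_scaleR borel_measurable_indicator) auto
    show "AE x in lebesgue. norm (indicat_real \<Omega> x *\<^sub>R sqrt (1 + (u\<^sub>0 x)\<^sup>2)) \<le> norm (indicat_real \<Omega> x + \<bar>u\<^sub>0 x\<bar>)"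
      using sqrt_one_plus_square_bounds(1,2)[of "u\<^sub>0 _"] by (auto simp: indicator_def)
  qed
  have ibp: "(LINT x:\<Omega>|lebesgue. sqrt (1 + (u\<^sub>0 x)\<^sup>2) *\<^sub>R G x) = - (LBINT x. \<psi> x *\<^sub>R \<nu> x)" if t: "test_function \<Omega> \<psi> G" for \<psi> G
  proof -
    have tU: "test_function UNIV \<psi> G" by (rule test_function_subset[OF t subset_UNIV])
    note [measurable] = test_function_borel[OF t]
    have Gl: "G \<in> borel_measurable lebesgue" using test_function_borel[OF t] by (auto intro!: measurable_completion)
    have "(LINT x:\<Omega>|lebesgue. sqrt (1 + (u\<^sub>0 x)\<^sup>2) *\<^sub>R G x) = (LINT x|lebesgue. sqrt (1 + (u\<^sub>0 x)\<^sup>2) *\<^sub>R G x)"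
      unfolding set_lebesgue_integral_def
      by (intro Bochner_Integration.integral_cong refl)
        (use test_function_zero_outside(2)[OF t] in \<open>auto simp: indicator_def\<close>)
    also have "\<dots> = (LBINT x. sqrt (1 + (u x)\<^sup>2) *\<^sub>R G x)"
    proof (rule integral_lebesgue_eq_lborel(1)[OF borel_measurable_scaleR[OF vm Gl]])
      show "AE x in lborel. sqrt (1 + (u\<^sub>0 x)\<^sup>2) *\<^sub>R G x = sqrt (1 + (u x)\<^sup>2) *\<^sub>R G x"
        using ae by eventually_elim simp
    qed measurable
    also have "\<dots> = - (LBINT x. \<psi> x *\<^sub>R \<nu> x)"
      unfolding \<nu>_def by (rule chain_rule_sqrt[OF ug tU])
    finally show ?thesis .
  qed
  show ?thesis by (rule BV_integrable_density(1)[OF O(1) _ nui v ibp]) simp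
qed

section \<open>The isoperimetric conditions\<close>

text \<open>
  Representatives are not additive in general, but here at every point one of the two summands
  vanishes nearby.
\<close>

lemma upper_rep_add_localized:
  fixes \<Omega> :: "'a::euclidean_space set"
  assumes O: "open \<Omega>" and x: "x \<in> \<Omega>" and A: "A \<in> sets lebesgue"
    and V: "open V" "closure A \<subseteq> V" "\<And>y. y \<in> V \<Longrightarrow> g y = 0"
  shows "real_of_ereal (upper_rep \<Omega> (\<lambda>y. s * indicator A y + g y) x) =
    real_of_ereal (upper_rep \<Omega> (\<lambda>y. s * indicator A y) x) + real_of_ereal (upper_rep \<Omega> g x)"
proof (cases "x \<in> V")
  case True
  have "upper_rep \<Omega> (\<lambda>y. s * indicator A y + g y) x = upper_rep \<Omega> (\<lambda>y. s * indicator A y) x"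
    by (rule upper_rep_local[OF V(1) True]) (simp add: V(3))
  moreover have "upper_rep \<Omega> g x = upper_rep \<Omega> (\<lambda>y. 0 * indicator A y) x"
    by (rule upper_rep_local[OF V(1) True]) (simp add: V(3))
  then have "upper_rep \<Omega> g x = 0" using upper_rep_indicator(3)[OF O x A refl] by simp
  ultimately show ?thesis by simp
next
  case False
  then have S: "open (- closure A)" "x \<in> - closure A" using V(2) by auto
  have out: "indicator A y = (0::real)" if "y \<in> - closure A" for y
    using that closure_subset[of A] by (auto simp: indicator_def)
  have "upper_rep \<Omega> (\<lambda>y. s * indicator A y + g y) x = upper_rep \<Omega> g x"
    by (rule upper_rep_local[OF S]) (simp add: out)
  moreover have "upper_rep \<Omega> (\<lambda>y. s * indicator A y) x = upper_rep \<Omega> (\<lambda>y. 0 * indicator A y) x"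
    by (rule upper_rep_local[OF S]) (simp add: out)
  then have "upper_rep \<Omega> (\<lambda>y. s * indicator A y) x = 0" using upper_rep_indicator(3)[OF O x A refl] by simp
  ultimately show ?thesis by simp
qed

text \<open>
  Traces need not be computed: functions that agree near a point satisfy the same trace condition
  there, and hence the same choice is made for both.
\<close>

lemma bv_trace_local:
  assumes "open S" "x \<in> S" "\<And>y. y \<in> S \<Longrightarrow> w y = v y"
  shows "bv_trace \<Omega> w x = bv_trace \<Omega> v x"
proof -
  obtain e where e: "e > 0" "ball x e \<subseteq> S" using assms(1,2) openE by blast
  have eq: "is_trace_at \<Omega> w x t = is_trace_at \<Omega> v x t" for t
    unfolding is_trace_at_def
  proof (rule tendsto_cong)
    have "(LINT y:(ball x r \<inter> \<Omega>)|lebesgue. \<bar>w y - t\<bar>) = (LINT y:(ball x r \<inter> \<Omega>)|lebesgue. \<bar>v y - t\<bar>)" if "r < e" for r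
    proof -
      have "ball x r \<subseteq> S" using e(2) subset_ball[of r e x] that by auto
      then show ?thesis
        unfolding set_lebesgue_integral_def
        by (intro Bochner_Integration.integral_cong) (use assms(3) in \<open>auto simp: indicator_def\<close>)
    qed
    then show "\<forall>\<^sub>F r in at_right 0. (LINT y:(ball x r \<inter> \<Omega>)|lebesgue. \<bar>w y - t\<bar>) / r ^ DIM('a) =
        (LINT y:(ball x r \<inter> \<Omega>)|lebesgue. \<bar>v y - t\<bar>) / r ^ DIM('a)"
      using e(1) by (auto simp: eventually_at_right_field intro!: exI[of _ e])
  qed
  have "is_trace_at \<Omega> w x = is_trace_at \<Omega> v x" by (rule ext) (rule eq)
  then show ?thesis unfolding bv_trace_def by (simp only:)
qed

lemma admissible_measure_sets:
  assumes "admissible_measure \<Omega> \<mu>"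
  shows "sets \<mu> = sets (restrict_space borel \<Omega>)" "space \<mu> = \<Omega>" "radon_measure_on \<Omega> \<mu>"
  using assms space_restrict_borel[of \<mu> \<Omega>] unfolding admissible_measure_def radon_measure_on_def by auto

text \<open>
  The upper representative of a function that is at least one is at least one.
\<close>

lemma admissible_measure_finite:
  fixes \<Omega> :: "'a::euclidean_space set"
  assumes O: "open \<Omega>" and mu: "admissible_measure \<Omega> \<mu>" and v: "v \<in> BV \<Omega>" "\<And>x. x \<in> \<Omega> \<Longrightarrow> 1 \<le> v x"
  shows "finite_measure \<mu>"
proof -
  have sp: "space \<mu> = \<Omega>" by (rule admissible_measure_sets(2)[OF mu])
  have v0: "\<forall>x\<in>\<Omega>. 0 \<le> v x" using v(2) by force
  have fin: "(\<integral>\<^sup>+x. e2ennreal (upper_rep \<Omega> v x) \<partial>\<mu>) < \<infinity>"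
    using mu v(1) v0 unfolding admissible_measure_def by auto
  have one: "1 \<le> upper_rep \<Omega> v x" if x: "x \<in> \<Omega>" for x
  proof -
    have "ereal t \<le> upper_rep \<Omega> v x" if "t < 1" for t
    proof -
      have "x \<in> density_plus {y \<in> \<Omega>. v y > t} \<longleftrightarrow> x \<in> density_plus UNIV"
        by (rule density_plus_local[OF O x]) (use v(2) that in force)
      then show ?thesis unfolding upper_rep_def using density_plus_UNIV by (auto intro!: Sup_upper)
    qed
    then have "Sup {ereal t | t. t < 1} \<le> upper_rep \<Omega> v x" by (auto intro!: Sup_least)
    then show ?thesis unfolding Sup_ereal_lessThan by (simp add: one_ereal_def)
  qed
  have "emeasure \<mu> \<Omega> = (\<integral>\<^sup>+x. 1 \<partial>\<mu>)" using sp by simp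
  also have "\<dots> \<le> (\<integral>\<^sup>+x. e2ennreal (upper_rep \<Omega> v x) \<partial>\<mu>)"
  proof (rule nn_integral_mono)
    fix x assume "x \<in> space \<mu>"
    then have "e2ennreal 1 \<le> e2ennreal (upper_rep \<Omega> v x)" using one sp by (intro e2ennreal_mono) auto
    then show "1 \<le> e2ennreal (upper_rep \<Omega> v x)" by (simp add: one_ereal_def)
  qed
  finally have "emeasure \<mu> \<Omega> < \<infinity>" using fin by (rule le_less_trans)
  then show ?thesis using sp by (intro finite_measureI) simp
qed

lemma upper_rep_integrable:
  fixes \<Omega> :: "'a::euclidean_space set"
  assumes O: "open \<Omega>" and mu: "admissible_measure \<Omega> \<mu>" and v: "v \<in> BV \<Omega>"
    and g: "g \<in> borel_measurable (lebesgue_on \<Omega>)" and le: "\<And>x. x \<in> \<Omega> \<Longrightarrow> \<bar>g x\<bar> \<le> v x"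
  shows "integrable \<mu> (\<lambda>x. real_of_ereal (upper_rep \<Omega> g x))"
proof -
  have sp: "space \<mu> = \<Omega>" by (rule admissible_measure_sets(2)[OF mu])
  have v0: "\<forall>x\<in>\<Omega>. 0 \<le> v x" using le by force
  have fin: "(\<integral>\<^sup>+x. e2ennreal (upper_rep \<Omega> v x) \<partial>\<mu>) < \<infinity>"
    using mu v v0 unfolding admissible_measure_def by auto
  have vm: "v \<in> borel_measurable (lebesgue_on \<Omega>)"
  proof -
    have "(\<lambda>x. indicator \<Omega> x *\<^sub>R v x) \<in> borel_measurable lebesgue"
      using v unfolding BV_def set_integrable_def by auto
    then show ?thesis using O by (subst borel_measurable_restrict_space_iff) auto
  qed
  have "upper_rep \<Omega> g \<in> borel_measurable \<mu>"
    by (rule borel_measurable_restrict_borel[OF admissible_measure_sets(1)[OF mu] upper_rep_borel_measurable[OF O g]])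
  then have m: "(\<lambda>x. real_of_ereal (upper_rep \<Omega> g x)) \<in> borel_measurable \<mu>" by measurable
  have "(\<integral>\<^sup>+x. norm (real_of_ereal (upper_rep \<Omega> g x)) \<partial>\<mu>) \<le> (\<integral>\<^sup>+x. e2ennreal (upper_rep \<Omega> v x) \<partial>\<mu>)"
  proof (rule nn_integral_mono)
    fix x assume "x \<in> space \<mu>"
    then have "\<bar>upper_rep \<Omega> g x\<bar> \<le> upper_rep \<Omega> v x" using sp by (intro abs_upper_rep_le[OF O g vm le]) auto
    moreover have "ereal \<bar>real_of_ereal (upper_rep \<Omega> g x)\<bar> \<le> \<bar>upper_rep \<Omega> g x\<bar>"
      by (cases "upper_rep \<Omega> g x") auto
    ultimately have "e2ennreal (ereal \<bar>real_of_ereal (upper_rep \<Omega> g x)\<bar>) \<le> e2ennreal (upper_rep \<Omega> v x)"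
      by (intro e2ennreal_mono) (rule order_trans)
    then show "ennreal (norm (real_of_ereal (upper_rep \<Omega> g x))) \<le> e2ennreal (upper_rep \<Omega> v x)" by simp
  qed
  then show ?thesis using m fin unfolding integrable_iff_bounded by (auto intro: le_less_trans)
qed

text \<open>
  An affine function of \<open>s > 0\<close> that is bounded below has nonnegative slope.
\<close>

lemma slope_bound_of_bounded_below:
  fixes P :: ennreal and a C c :: real
  assumes "\<And>s. 0 < s \<Longrightarrow> ereal c \<le> enn2ereal (ennreal s * P) + ereal (s * (- a) + C)"
  shows "ereal a \<le> enn2ereal P"
proof (cases P)
  case (real p)
  have "a \<le> p"
  proof (rule ccontr)
    assume "\<not> a \<le> p"
    then have ap: "0 < a - p" by simp
    define s where "s = (\<bar>C - c\<bar> + 1) / (a - p)"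
    have s: "0 < s" unfolding s_def using ap by (auto intro!: divide_pos_pos)
    have "ennreal s * P = ennreal (s * p)" using s real by (simp add: ennreal_mult)
    then have "c \<le> s * p + (s * (- a) + C)"
      using assms[OF s] s real by (simp add: enn2ereal_ennreal)
    then have "s * (a - p) \<le> C - c" by (simp add: algebra_simps)
    moreover have "s * (a - p) = \<bar>C - c\<bar> + 1" unfolding s_def using ap by simp
    ultimately show False by linarith
  qed
  then show ?thesis using real by (simp add: enn2ereal_ennreal)
qed (simp add: enn2ereal_top)

text \<open>
  Both inequalities come from the family \<open>w s\<close>, the first for \<open>s \<rightarrow> \<infinity>\<close> and the second for \<open>s \<rightarrow> - \<infinity>\<close>.
  The lower representative is handled as minus the upper representative of \<open>- w s\<close>, so one computation of
  integrals (\<open>split\<close>) covers all four cases.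
\<close>

lemma isoperimetric_inequalities:
  fixes \<Omega> :: "'a::euclidean_space set" and u\<^sub>0 :: "'a \<Rightarrow> real"
  assumes O: "open \<Omega>" "bounded \<Omega>" and u0: "u\<^sub>0 \<in> Sobolev_1_1 UNIV" and phi: "admissible_integrand \<phi>"
    and mu: "admissible_measure \<Omega> \<mu>\<^sub>p" "admissible_measure \<Omega> \<mu>\<^sub>m"
    and fin: "finite_measure \<mu>\<^sub>p" "finite_measure \<mu>\<^sub>m"
    and below: "\<And>w. w \<in> BV \<Omega> \<Longrightarrow> ereal c \<le> Phi_hat \<phi> \<Omega> u\<^sub>0 \<mu>\<^sub>p \<mu>\<^sub>m w"
    and A: "A \<in> sets lebesgue" "compactly_contained A \<Omega>" and P: "finite_perimeter A"
  shows "ereal (measure \<mu>\<^sub>m (density_plus A) - measure \<mu>\<^sub>p (density_one A)) \<le> enn2ereal (aniso_perimeter \<phi> A)"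
    and "ereal (measure \<mu>\<^sub>p (density_plus A) - measure \<mu>\<^sub>m (density_one A)) \<le> enn2ereal (aniso_perimeter (mirrored \<phi>) A)"
proof -
  have cA: "compact (closure A)" "closure A \<subseteq> \<Omega>" using A(2) unfolding compactly_contained_def by auto
  have u0m: "u\<^sub>0 \<in> borel_measurable lebesgue"
    using u0 unfolding Sobolev_1_1_def set_integrable_def by auto
  obtain \<eta> X V where eta: "test_function \<Omega> \<eta> X" "\<And>x. 0 \<le> \<eta> x" "\<And>x. \<eta> x \<le> 1"
    and V: "open V" "closure A \<subseteq> V" "\<And>x. x \<in> V \<Longrightarrow> \<eta> x = 1"
    using smooth_cutoff_exists[OF cA(1) O(1) cA(2)] by blast
  define h where "h x = (1 - \<eta> x) * u\<^sub>0 x" for x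
  define w where "w s x = s * indicator A x + h x" for s x
  define v where "v x = sqrt (1 + (u\<^sub>0 x)\<^sup>2)" for x
  have v: "v \<in> BV \<Omega>" unfolding v_def by (rule sqrt_majorant_BV[OF O u0])
  have hv: "\<bar>h x\<bar> \<le> v x" for x
  proof -
    have "\<bar>h x\<bar> \<le> \<bar>u\<^sub>0 x\<bar>" unfolding h_def abs_mult using eta(2,3)[of x] by (intro mult_left_le_one_le) auto
    also have "\<dots> \<le> v x" unfolding v_def by (rule real_le_rsqrt) auto
    finally show ?thesis .
  qed
  have hml: "h \<in> borel_measurable lebesgue"
  proof -
    have "\<eta> \<in> borel_measurable lebesgue" using test_function_borel(1)[OF eta(1)] by (auto intro!: measurable_completion)
    then show ?thesis unfolding h_def using u0m by measurable
  qed
  have hm: "h \<in> borel_measurable (lebesgue_on \<Omega>)" "(\<lambda>x. - h x) \<in> borel_measurable (lebesgue_on \<Omega>)"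
    using hml by (auto intro!: measurable_restrict_space1)
  have wm: "w s \<in> borel_measurable (lebesgue_on \<Omega>)" for s
  proof -
    have "w s \<in> borel_measurable lebesgue" unfolding w_def using hml A(1) by measurable
    then show ?thesis by (rule measurable_restrict_space1)
  qed
  have hV: "h y = 0" if "y \<in> V" for y unfolding h_def using V(3)[OF that] by simp
  obtain C where C: "0 \<le> C" "\<And>s. w s \<in> BV \<Omega>" "\<And>s. aniso_variation \<phi> \<Omega> (w s) \<Omega> \<le>
      (\<integral>\<^sup>+x. ennreal (\<phi> x (s *\<^sub>R var_direction UNIV (indicator A) x)) \<partial>var_measure UNIV (indicator A)) + ennreal C"
    using competitor_BV[OF O(1) A(1) cA(1) P u0 eta(1) V phi]
    unfolding w_def[abs_def] h_def by blast
  define Um where "Um = (\<integral>x. real_of_ereal (upper_rep \<Omega> h x) \<partial>\<mu>\<^sub>m)"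
  define Lp where "Lp = (\<integral>x. real_of_ereal (upper_rep \<Omega> (\<lambda>y. - h y) x) \<partial>\<mu>\<^sub>p)"
  have dens: "density_plus A \<subseteq> \<Omega>" "density_one A \<subseteq> \<Omega>"
    using density_plus_subset_closure[of A] density_one_subset_plus[of A] cA(2) by auto
  have dens_sets: "density_plus A \<in> sets \<mu>" "density_one A \<in> sets \<mu>" if "admissible_measure \<Omega> \<mu>" for \<mu>
    using sets_restrict_borel_iff[OF O(1) admissible_measure_sets(1)[OF that]] dens
      density_plus_borel[OF A(1)] density_one_borel[OF A(1)] by auto
  have split: "(\<integral>x. real_of_ereal (upper_rep \<Omega> (\<lambda>y. s * indicator A y + k y) x) \<partial>\<mu>) =
      s * measure \<mu> E + (\<integral>x. real_of_ereal (upper_rep \<Omega> k x) \<partial>\<mu>)"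
    if \<mu>: "admissible_measure \<Omega> \<mu>" "finite_measure \<mu>" and E: "E \<in> sets \<mu>"
      and ind: "\<And>x. x \<in> \<Omega> \<Longrightarrow> upper_rep \<Omega> (\<lambda>y. s * indicator A y) x = ereal (s * indicator E x)"
      and k: "k \<in> borel_measurable (lebesgue_on \<Omega>)" "\<And>x. \<bar>k x\<bar> \<le> v x" "\<And>y. y \<in> V \<Longrightarrow> k y = 0" for \<mu> s E k
  proof -
    interpret finite_measure \<mu> by (rule \<mu>(2))
    have sp: "space \<mu> = \<Omega>" by (rule admissible_measure_sets(2)[OF \<mu>(1)])
    have i: "integrable \<mu> (\<lambda>x. real_of_ereal (upper_rep \<Omega> k x))"
      by (rule upper_rep_integrable[OF O(1) \<mu>(1) v k(1)]) (rule k(2))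
    have j: "integrable \<mu> (\<lambda>x. s * indicat_real E x)"
      using E by (intro integrable_mult_right integrable_real_indicator) (auto simp: less_top[symmetric])
    have "(\<integral>x. real_of_ereal (upper_rep \<Omega> (\<lambda>y. s * indicator A y + k y) x) \<partial>\<mu>) =
        (\<integral>x. s * indicat_real E x + real_of_ereal (upper_rep \<Omega> k x) \<partial>\<mu>)"
    proof (rule Bochner_Integration.integral_cong[OF refl])
      fix x assume "x \<in> space \<mu>"
      then have x: "x \<in> \<Omega>" using sp by simp
      have "real_of_ereal (upper_rep \<Omega> (\<lambda>y. s * indicator A y + k y) x) =
          real_of_ereal (upper_rep \<Omega> (\<lambda>y. s * indicator A y) x) + real_of_ereal (upper_rep \<Omega> k x)"
        by (rule upper_rep_add_localized[OF O(1) x A(1) V(1,2)]) (rule k(3))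
      then show "real_of_ereal (upper_rep \<Omega> (\<lambda>y. s * indicator A y + k y) x) = s * indicat_real E x + real_of_ereal (upper_rep \<Omega> k x)"
        unfolding ind[OF x] by simp
    qed
    also have "\<dots> = (\<integral>x. s * indicat_real E x \<partial>\<mu>) + (\<integral>x. real_of_ereal (upper_rep \<Omega> k x) \<partial>\<mu>)"
      by (rule Bochner_Integration.integral_add[OF j i])
    also have "(\<integral>x. s * indicat_real E x \<partial>\<mu>) = s * measure \<mu> E"
      using E by (simp add: sets.Int_space_eq2)
    finally show ?thesis .
  qed
  have hv': "\<bar>- h x\<bar> \<le> v x" for x using hv[of x] by simp
  have hV': "- h y = 0" if "y \<in> V" for y using hV[OF that] by simp
  have lower: "(\<integral>x. real_of_ereal (lower_rep \<Omega> (w s) x) \<partial>\<mu>\<^sub>p) =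
      - (\<integral>x. real_of_ereal (upper_rep \<Omega> (\<lambda>y. (- s) * indicator A y + - h y) x) \<partial>\<mu>\<^sub>p)" for s
  proof -
    have "(\<integral>x. real_of_ereal (lower_rep \<Omega> (w s) x) \<partial>\<mu>\<^sub>p) =
        (\<integral>x. - real_of_ereal (upper_rep \<Omega> (\<lambda>y. (- s) * indicator A y + - h y) x) \<partial>\<mu>\<^sub>p)"
    proof (rule Bochner_Integration.integral_cong[OF refl])
      fix x assume "x \<in> space \<mu>\<^sub>p"
      then have x: "x \<in> \<Omega>" using admissible_measure_sets(2)[OF mu(1)] by simp
      have "(\<lambda>y. - w s y) = (\<lambda>y. (- s) * indicator A y + - h y)" unfolding w_def by auto
      then show "real_of_ereal (lower_rep \<Omega> (w s) x) = - real_of_ereal (upper_rep \<Omega> (\<lambda>y. (- s) * indicator A y + - h y) x)"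
        using lower_rep_eq_uminus_upper_rep[OF O(1) wm x, of s] by simp
    qed
    then show ?thesis by simp
  qed
  have lower_pos: "(\<integral>x. real_of_ereal (lower_rep \<Omega> (w s) x) \<partial>\<mu>\<^sub>p) = s * measure \<mu>\<^sub>p (density_one A) - Lp" if "0 < s" for s
    unfolding lower Lp_def
    using split[OF mu(1) fin(1) dens_sets(2)[OF mu(1)] upper_rep_indicator(2)[OF O(1) _ A(1), of _ "- s"] hm(2) hv' hV'] that by simp
  have lower_neg: "(\<integral>x. real_of_ereal (lower_rep \<Omega> (w (- s)) x) \<partial>\<mu>\<^sub>p) = - s * measure \<mu>\<^sub>p (density_plus A) - Lp" if "0 < s" for s
    unfolding lower Lp_def
    using split[OF mu(1) fin(1) dens_sets(1)[OF mu(1)] upper_rep_indicator(1)[OF O(1) _ A(1), of _ s] hm(2) hv' hV'] that by simp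
  have upper_pos: "(\<integral>x. real_of_ereal (upper_rep \<Omega> (w s) x) \<partial>\<mu>\<^sub>m) = s * measure \<mu>\<^sub>m (density_plus A) + Um" if "0 < s" for s
    unfolding w_def[abs_def] Um_def
    using split[OF mu(2) fin(2) dens_sets(1)[OF mu(2)] upper_rep_indicator(1)[OF O(1) _ A(1), of _ s] hm(1) hv hV] that by simp
  have upper_neg: "(\<integral>x. real_of_ereal (upper_rep \<Omega> (w (- s)) x) \<partial>\<mu>\<^sub>m) = - s * measure \<mu>\<^sub>m (density_one A) + Um" if "0 < s" for s
    unfolding w_def[abs_def] Um_def
    using split[OF mu(2) fin(2) dens_sets(2)[OF mu(2)] upper_rep_indicator(2)[OF O(1) _ A(1), of _ "- s"] hm(1) hv hV] that by simp
  \<comment> \<open>Points of the boundary have a neighbourhood in which both \<open>\<eta>\<close> and \<open>1\<^sub>A\<close> vanish.\<close>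
  have trace: "bv_trace \<Omega> (w s) x = bv_trace \<Omega> u\<^sub>0 x" if "x \<in> frontier \<Omega>" for s x
  proof (rule bv_trace_local)
    have "x \<notin> \<Omega>" using that O(1) by (simp add: frontier_def interior_open)
    then show "x \<in> - (closure {y. \<eta> y \<noteq> 0} \<union> closure A)"
      using eta(1) cA(2) unfolding test_function_def compactly_contained_def by auto
    show "open (- (closure {y. \<eta> y \<noteq> 0} \<union> closure A))" by auto
    fix y assume y: "y \<in> - (closure {y. \<eta> y \<noteq> 0} \<union> closure A)"
    then show "w s y = u\<^sub>0 y"
      unfolding w_def h_def using closure_subset[of A] closure_subset[of "{y. \<eta> y \<noteq> 0}"] by (auto simp: indicator_def)
  qed
  have phi0: "\<phi> x 0 = 0" for x using admissible_integrandD(3)[OF phi, of 0 x 0] by simp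
  have bdry: "(\<integral>\<^sup>+x\<in>frontier \<Omega>.
        ennreal (\<phi> x ((bv_trace \<Omega> (w s) x - bv_trace \<Omega> u\<^sub>0 x) *\<^sub>R inward_normal \<Omega> x))
        \<partial>hausdorff_measure (DIM('a) - 1)) = 0" for s
  proof -
    have "(\<integral>\<^sup>+x\<in>frontier \<Omega>.
        ennreal (\<phi> x ((bv_trace \<Omega> (w s) x - bv_trace \<Omega> u\<^sub>0 x) *\<^sub>R inward_normal \<Omega> x))
        \<partial>hausdorff_measure (DIM('a) - 1)) = (\<integral>\<^sup>+x. 0 \<partial>(hausdorff_measure (DIM('a) - 1) :: 'a measure))"
    proof (rule nn_integral_cong)
      fix x
      show "ennreal (\<phi> x ((bv_trace \<Omega> (w s) x - bv_trace \<Omega> u\<^sub>0 x) *\<^sub>R inward_normal \<Omega> x)) * indicator (frontier \<Omega>) x = 0"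
        by (cases "x \<in> frontier \<Omega>") (simp_all add: trace phi0)
    qed
    then show ?thesis by simp
  qed
  have Phi: "ereal c \<le> enn2ereal q + ereal (b - d + C)"
    if "aniso_variation \<phi> \<Omega> (w s) \<Omega> \<le> q + ennreal C"
      and "(\<integral>x. real_of_ereal (lower_rep \<Omega> (w s) x) \<partial>\<mu>\<^sub>p) = b"
      and "(\<integral>x. real_of_ereal (upper_rep \<Omega> (w s) x) \<partial>\<mu>\<^sub>m) = d" for s q b d
  proof -
    have "ereal c \<le> Phi_hat \<phi> \<Omega> u\<^sub>0 \<mu>\<^sub>p \<mu>\<^sub>m (w s)" by (rule below[OF C(2)])
    also have "\<dots> = enn2ereal (aniso_variation \<phi> \<Omega> (w s) \<Omega>) + ereal (b - d)"
      unfolding Phi_hat_def bdry that(2,3)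
      by (cases "enn2ereal (aniso_variation \<phi> \<Omega> (w s) \<Omega>)") (auto simp: zero_ennreal.rep_eq)
    also have "\<dots> \<le> enn2ereal (q + ennreal C) + ereal (b - d)"
      using that(1) by (intro add_right_mono) (simp add: less_eq_ennreal.rep_eq)
    also have "\<dots> = enn2ereal q + ereal (b - d + C)"
      using C(1) by (cases "enn2ereal q") (auto simp: plus_ennreal.rep_eq)
    finally show ?thesis .
  qed
  show "ereal (measure \<mu>\<^sub>m (density_plus A) - measure \<mu>\<^sub>p (density_one A)) \<le> enn2ereal (aniso_perimeter \<phi> A)"
  proof (rule slope_bound_of_bounded_below[of c _ _ "C - Lp - Um"])
    fix s :: real assume s: "0 < s"
    have "aniso_variation \<phi> \<Omega> (w s) \<Omega> \<le> ennreal s * aniso_perimeter \<phi> A + ennreal C"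
      using C(3)[of s] aniso_perimeter_homogeneous(1)[OF P phi, of s] s by simp
    from Phi[OF this lower_pos[OF s] upper_pos[OF s]]
    show "ereal c \<le> enn2ereal (ennreal s * aniso_perimeter \<phi> A) +
        ereal (s * - (measure \<mu>\<^sub>m (density_plus A) - measure \<mu>\<^sub>p (density_one A)) + (C - Lp - Um))"
      by (simp add: algebra_simps)
  qed
  show "ereal (measure \<mu>\<^sub>p (density_plus A) - measure \<mu>\<^sub>m (density_one A)) \<le> enn2ereal (aniso_perimeter (mirrored \<phi>) A)"
  proof (rule slope_bound_of_bounded_below[of c _ _ "C - Lp - Um"])
    fix s :: real assume s: "0 < s"
    have "aniso_variation \<phi> \<Omega> (w (- s)) \<Omega> \<le> ennreal s * aniso_perimeter (mirrored \<phi>) A + ennreal C"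
      using C(3)[of "- s"] aniso_perimeter_homogeneous(2)[OF P phi, of s] s by simp
    from Phi[OF this lower_neg[OF s] upper_neg[OF s]]
    show "ereal c \<le> enn2ereal (ennreal s * aniso_perimeter (mirrored \<phi>) A) +
        ereal (s * - (measure \<mu>\<^sub>p (density_plus A) - measure \<mu>\<^sub>m (density_one A)) + (C - Lp - Um))"
      by (simp add: algebra_simps)
  qed
qed

theorem proposition7p7:
  fixes \<Omega> :: "'a::euclidean_space set"
    and u\<^sub>0 :: "'a \<Rightarrow> real"
    and \<phi> :: "'a \<Rightarrow> 'a \<Rightarrow> real"
    and \<mu>\<^sub>p \<mu>\<^sub>m :: "'a measure"
  assumes "open \<Omega>" and "bounded \<Omega>" and "lipschitz_boundary \<Omega>"
    and "u\<^sub>0 \<in> Sobolev_1_1 UNIV"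
    and "admissible_integrand \<phi>"
    and "admissible_measure \<Omega> \<mu>\<^sub>p" and "admissible_measure \<Omega> \<mu>\<^sub>m"
    and "\<exists>c::real. \<forall>w\<in>BV \<Omega>. ereal c \<le> Phi_hat \<phi> \<Omega> u\<^sub>0 \<mu>\<^sub>p \<mu>\<^sub>m w"
  shows "IC \<phi> \<Omega> 1 \<mu>\<^sub>m \<mu>\<^sub>p \<and> IC (mirrored \<phi>) \<Omega> 1 \<mu>\<^sub>p \<mu>\<^sub>m"
proof -
  obtain c where c: "\<And>w. w \<in> BV \<Omega> \<Longrightarrow> ereal c \<le> Phi_hat \<phi> \<Omega> u\<^sub>0 \<mu>\<^sub>p \<mu>\<^sub>m w" using assms(8) by blast
  have fin: "finite_measure \<mu>\<^sub>p" "finite_measure \<mu>\<^sub>m"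
    by (rule admissible_measure_finite[OF assms(1) _ sqrt_majorant_BV[OF assms(1,2,4)]]; use assms(6,7) in simp)+
  have infinite: "aniso_perimeter \<psi> A = \<infinity>" if "\<not> finite_perimeter A" for \<psi> A
    using that unfolding aniso_perimeter_def by simp
  have ineq: "ereal (measure \<mu>\<^sub>m (density_plus A) - measure \<mu>\<^sub>p (density_one A)) \<le> enn2ereal (aniso_perimeter \<phi> A)"
    "ereal (measure \<mu>\<^sub>p (density_plus A) - measure \<mu>\<^sub>m (density_one A)) \<le> enn2ereal (aniso_perimeter (mirrored \<phi>) A)"
    if A: "A \<in> sets lebesgue" "compactly_contained A \<Omega>" for A
    using isoperimetric_inequalities[OF assms(1,2,4,5,6,7) fin c A]
    by (cases "finite_perimeter A"; simp add: infinite enn2ereal_top)+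
  have radon: "radon_measure_on \<Omega> \<mu>\<^sub>p" "radon_measure_on \<Omega> \<mu>\<^sub>m"
    using admissible_measure_sets(3) assms(6,7) by auto
  have one: "ereal 1 * x = x" for x unfolding one_ereal_def[symmetric] by simp
  show ?thesis
    unfolding IC_def one by (intro conjI ballI impI radon fin ineq) simp_all
qed

end
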